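(* Let $Q=\{(x,y,z)\in\mathbb{R}^3: x^2/a+y^2/b+z^2/c=1\}$ with $a>b>c>0$. All nonsingular periodic billiard trajectories inside $Q$ with elliptic period $m=3$ are described by the following list: for each caustic type, such trajectories of that type exist if and only if the stated condition on $(a,b,c)$ holds, and in that case their caustic parameters $\lambda_1<\lambda_2$ are the stated ones. - Type EH1: condition $c<\dfrac{ab}{a+b+\sqrt{ab}}$; caustic parameters given by $c^3=(c-\lambda_1)(b-c)(a-c)$ and $1/\lambda_2+1/c=1/a+1/b+1/\lambda_1$. - Type H1H1: condition $c<\dfrac{ab}{a+b+2\sqrt{ab}}$; $\lambda_1,\lambda_2$ are the roots of $t^3-(t-a)(t-b)(t-c)$. - Type EH2: condition $2b<a$ and $c<\dfrac{a-2b}{2a-3b}\,a$; $\lambda_1,\lambda_2$ are the roots of $(a-b)(a-c)t^2+(bc-a(b+c))\,a\,t+a^2bc$. - Type H1H2: condition $c<\dfrac{a-2b}{(a-b)^2}\,ab$ and $b>\dfrac{ac}{a+c-\sqrt{ac}}$; caustic parameters given by $b^3=(b-c)(\lambda_2-b)(a-b)$ and $1/\lambda_1+1/b=1/a+1/c+1/\lambda_2$.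
   Context: Confocal quadrics: $Q_\lambda=\{x^2/(a-\lambda)+y^2/(b-\lambda)+z^2/(c-\lambda)=1\}$: an ellipsoid (E) for $\lambda\in(0,c)$, a one-sheet hyperboloid (H1) for $\lambda\in(c,b)$, a two-sheet hyperboloid (H2) for $\lambda\in(b,a)$. The lines containing the segments of a billiard trajectory inside $Q$ are all tangent to the same two confocal quadrics $Q_{\lambda_1},Q_{\lambda_2}$ (caustics; $\lambda_1,\lambda_2$ are the caustic parameters). The trajectory is nonsingular if $\lambda_1\ne\lambda_2$ and $\lambda_1,\lambda_2\notin\{a,b,c\}$; we order $\lambda_1<\lambda_2$. The only possible caustic types of nonsingular trajectories are EH1 ($\lambda_1\in(0,c),\lambda_2\in(c,b)$), H1H1 ($\lambda_1,\lambda_2\in(c,b)$), EH2 ($\lambda_1\in(0,c),\lambda_2\in(b,a)$) and H1H2 ($\lambda_1\in(c,b),\lambda_2\in(b,a)$). Jacobi elliptic coordinates: a generic point lies on exactly three quadrics $Q_{\mu_0},Q_{\mu_1},Q_{\mu_2}$ with $\mu_0<c<\mu_1<b<\mu_2<a$; $(\mu_0,\mu_1,\mu_2)$ are its elliptic coordinates (extended by continuity to all points). Let $\{c_1,\ldots,c_5\}=\{a,b,c,\lambda_1,\lambda_2\}$ with $c_0:=0<c_1<\cdots<c_5$. Along a nonsingular trajectory, $\mu_j$ oscillates in $[c_{2j},c_{2j+1}]$, $j=0,1,2$. If the trajectory is periodic, its period $m_0$ is the least number of bounces after which it closes, and its winding numbers $m_0,m_1,m_2$ are the numbers of complete oscillations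 of $\mu_j$ in $[c_{2j},c_{2j+1}]$ along one period (so the $0$-th is the period). One has $\gcd(m_0,m_1,m_2)\in\{1,2\}$, and the elliptic period is $m=m_0/\gcd(m_0,m_1,m_2)$, i.e. the number of bounces after which the trajectory closes in elliptic coordinates. All nonsingular trajectories sharing the same caustics have the same periodicity, period and winding numbers. *)

theory Defs
  imports "HOL-Analysis.Analysis"
begin

(* Only meaningful for l outside {a, b, c}, since x / 0 = 0. *)
definition confocal_quadric :: "real \<Rightarrow> real \<Rightarrow> real \<Rightarrow> real \<Rightarrow> (real ^ 3) set" where
  "confocal_quadric a b c l =
     {p. (p $ 1)\<^sup>2 / (a - l) + (p $ 2)\<^sup>2 / (b - l) + (p $ 3)\<^sup>2 / (c - l) = 1}"

abbreviation ellipsoid :: "real \<Rightarrow> real \<Rightarrow> real \<Rightarrow> (real ^ 3) set" where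
  "ellipsoid a b c \<equiv> confocal_quadric a b c 0"

(* Half the gradient at p of the defining equation of the quadric. *)
definition confocal_normal :: "real \<Rightarrow> real \<Rightarrow> real \<Rightarrow> real \<Rightarrow> real ^ 3 \<Rightarrow> real ^ 3" where
  "confocal_normal a b c l p = vector [p $ 1 / (a - l), p $ 2 / (b - l), p $ 3 / (c - l)]"

(* Tangency of the line through p with direction v, in the projective sense: the second
   alternative is contact at the point at infinity of the line, i.e. v is an asymptotic
   direction and the line lies in the corresponding asymptotic plane. It is needed because
   a segment of a trajectory may lie on an asymptote of a hyperboloid caustic. *)
definition tangent_line :: "real \<Rightarrow> real \<Rightarrow> real \<Rightarrow> real \<Rightarrow> real ^ 3 \<Rightarrow> real ^ 3 \<Rightarrow> bool" where
  "tangent_line a b c l p v \<longleftrightarrow> v \<noteq> 0 \<and>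
     ((\<exists>t. p + t *\<^sub>R v \<in> confocal_quadric a b c l \<and>
           confocal_normal a b c l (p + t *\<^sub>R v) \<bullet> v = 0) \<or>
      (confocal_normal a b c l v \<bullet> v = 0 \<and> confocal_normal a b c l v \<bullet> p = 0))"

definition reflect :: "real ^ 3 \<Rightarrow> real ^ 3 \<Rightarrow> real ^ 3" where
  "reflect n u = u - (2 * (u \<bullet> n) / (n \<bullet> n)) *\<^sub>R n"

(* A trajectory is the bi-infinite sequence of its impact points. *)
definition billiard_trajectory :: "real \<Rightarrow> real \<Rightarrow> real \<Rightarrow> (int \<Rightarrow> real ^ 3) \<Rightarrow> bool" where
  "billiard_trajectory a b c q \<longleftrightarrow>
     (\<forall>k. q k \<in> ellipsoid a b c \<and> q k \<noteq> q (k + 1) \<and>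
          sgn (q (k + 1) - q k) =
            reflect (confocal_normal a b c 0 (q k)) (sgn (q k - q (k - 1))))"

definition nonsingular_trajectory ::
    "real \<Rightarrow> real \<Rightarrow> real \<Rightarrow> real \<Rightarrow> real \<Rightarrow> (int \<Rightarrow> real ^ 3) \<Rightarrow> bool" where
  "nonsingular_trajectory a b c l1 l2 q \<longleftrightarrow>
     billiard_trajectory a b c q \<and> l1 < l2 \<and> l1 \<notin> {a, b, c} \<and> l2 \<notin> {a, b, c} \<and>
     (\<forall>k. tangent_line a b c l1 (q k) (q (k + 1) - q k) \<and>
          tangent_line a b c l2 (q k) (q (k + 1) - q k))"

datatype caustic_type = EH1 | H1H1 | EH2 | H1H2

fun has_caustic_type ::
    "real \<Rightarrow> real \<Rightarrow> real \<Rightarrow> caustic_type \<Rightarrow> real \<Rightarrow> real \<Rightarrow> bool" where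
  "has_caustic_type a b c EH1 l1 l2 \<longleftrightarrow> l1 \<in> {0<..<c} \<and> l2 \<in> {c<..<b}"
| "has_caustic_type a b c H1H1 l1 l2 \<longleftrightarrow> l1 \<in> {c<..<b} \<and> l2 \<in> {c<..<b}"
| "has_caustic_type a b c EH2 l1 l2 \<longleftrightarrow> l1 \<in> {0<..<c} \<and> l2 \<in> {b<..<a}"
| "has_caustic_type a b c H1H2 l1 l2 \<longleftrightarrow> l1 \<in> {c<..<b} \<and> l2 \<in> {b<..<a}"

definition elliptic_coords_generic ::
    "real \<Rightarrow> real \<Rightarrow> real \<Rightarrow> real ^ 3 \<Rightarrow> real \<times> real \<times> real" where
  "elliptic_coords_generic a b c p =
     (THE (m0, m1, m2). m0 < c \<and> c < m1 \<and> m1 < b \<and> b < m2 \<and> m2 < a \<and>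
        p \<in> confocal_quadric a b c m0 \<inter> confocal_quadric a b c m1 \<inter> confocal_quadric a b c m2)"

(* Generic points are those off the coordinate planes; the limit is the extension by
   continuity to all points, and returns the original value at generic points. *)
definition elliptic_coords ::
    "real \<Rightarrow> real \<Rightarrow> real \<Rightarrow> real ^ 3 \<Rightarrow> real \<times> real \<times> real" where
  "elliptic_coords a b c p =
     Lim (at p within {x. \<forall>i. x $ i \<noteq> 0}) (elliptic_coords_generic a b c)"

definition osc_endpoint ::
    "real \<Rightarrow> real \<Rightarrow> real \<Rightarrow> real \<Rightarrow> real \<Rightarrow> nat \<Rightarrow> real" where
  "osc_endpoint a b c l1 l2 k = (0 # sorted_list_of_set {a, b, c, l1, l2}) ! k"

(* The trajectory as a broken line, the bounces being at the integer times. *)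
definition trajectory_path :: "(int \<Rightarrow> real ^ 3) \<Rightarrow> real \<Rightarrow> real ^ 3" where
  "trajectory_path q s = (1 - frac s) *\<^sub>R q \<lfloor>s\<rfloor> + frac s *\<^sub>R q (\<lfloor>s\<rfloor> + 1)"

(* Some interval of length T splits into n consecutive complete oscillations of f in
   [lo, hi], each going monotonically from lo up to hi and then back down to lo. *)
definition complete_oscillations ::
    "(real \<Rightarrow> real) \<Rightarrow> real \<Rightarrow> real \<Rightarrow> real \<Rightarrow> nat \<Rightarrow> bool" where
  "complete_oscillations f lo hi T n \<longleftrightarrow>
     (\<exists>s t. s n = s 0 + T \<and>
        (\<forall>i<n. s i < t i \<and> t i < s (Suc i) \<and>
               f (s i) = lo \<and> f (t i) = hi \<and> f (s (Suc i)) = lo \<and>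
               mono_on {s i..t i} f \<and> antimono_on {t i..s (Suc i)} f))"

definition closes_after :: "(int \<Rightarrow> real ^ 3) \<Rightarrow> nat \<Rightarrow> bool" where
  "closes_after q n \<longleftrightarrow> 0 < n \<and> (\<forall>k. q (k + int n) = q k)"

definition periodic_trajectory :: "(int \<Rightarrow> real ^ 3) \<Rightarrow> bool" where
  "periodic_trajectory q \<longleftrightarrow> (\<exists>n. closes_after q n)"

definition trajectory_period :: "(int \<Rightarrow> real ^ 3) \<Rightarrow> nat" where
  "trajectory_period q = (LEAST n. closes_after q n)"

definition winding_numbers ::
    "real \<Rightarrow> real \<Rightarrow> real \<Rightarrow> real \<Rightarrow> real \<Rightarrow> (int \<Rightarrow> real ^ 3) \<Rightarrow> nat \<Rightarrow> nat \<Rightarrow> nat \<Rightarrow> bool" where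
  "winding_numbers a b c l1 l2 q m0 m1 m2 \<longleftrightarrow>
     (let e = osc_endpoint a b c l1 l2;
          \<mu> = \<lambda>s. elliptic_coords a b c (trajectory_path q s);
          T = real (trajectory_period q)
      in m0 = trajectory_period q \<and>
         complete_oscillations (\<lambda>s. fst (\<mu> s)) (e 0) (e 1) T m0 \<and>
         complete_oscillations (\<lambda>s. fst (snd (\<mu> s))) (e 2) (e 3) T m1 \<and>
         complete_oscillations (\<lambda>s. snd (snd (\<mu> s))) (e 4) (e 5) T m2)"

definition has_elliptic_period ::
    "real \<Rightarrow> real \<Rightarrow> real \<Rightarrow> real \<Rightarrow> real \<Rightarrow> (int \<Rightarrow> real ^ 3) \<Rightarrow> nat \<Rightarrow> bool" where
  "has_elliptic_period a b c l1 l2 q m \<longleftrightarrow>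
     periodic_trajectory q \<and>
     (\<exists>m0 m1 m2. winding_numbers a b c l1 l2 q m0 m1 m2 \<and> m = m0 div gcd m0 (gcd m1 m2))"

definition nonsingular_periodic ::
    "real \<Rightarrow> real \<Rightarrow> real \<Rightarrow> nat \<Rightarrow> real \<Rightarrow> real \<Rightarrow> (int \<Rightarrow> real ^ 3) \<Rightarrow> bool" where
  "nonsingular_periodic a b c m l1 l2 q \<longleftrightarrow>
     nonsingular_trajectory a b c l1 l2 q \<and> has_elliptic_period a b c l1 l2 q m"

end

theory Submission
  imports Defs
begin

text \<open>
  Along a line tangent to two confocal quadrics the three polynomials in \<open>t\<close> that encode position,
  direction and their mixed product form a symmetric 2 by 2 matrix \<open>G t\<close> of determinant
  \<open>- T t\<close>, where \<open>T\<close> vanishes exactly at \<open>c\<^sub>1, \<dots>, c\<^sub>5\<close>. Flights and reflections act on it by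
  \<open>G \<mapsto> M G M\<^sup>T\<close> with unimodular \<open>M\<close> polynomial in \<open>1/t\<close>.

  Forward direction: the elliptic coordinates satisfy
  \<open>\<Sum>\<^sub>j \<mu>\<^sub>j\<^sup>i d\<mu>\<^sub>j / \<plusminus>sqrt T(\<mu>\<^sub>j) = 0\<close> for \<open>i = 0, 1\<close>. Integrating over a period and dividing by the gcd
  of the winding numbers shows that after three bounces the elliptic coordinates and their directions
  return, so \<open>G\<close> returns. At each \<open>c\<^sub>k\<close> the matrix \<open>G\<close> has rank one, so the three-step matrix has
  trace \<open>\<plusminus>2\<close> there; this trace is a cubic in \<open>1/t\<close> with value 2 at 0, and counting roots leaves
  only \<open>t\<^sup>3 - (t - c\<^sub>1)(t - c\<^sub>4)(t - c\<^sub>5) = K (t - c\<^sub>2)(t - c\<^sub>3)\<close>.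

  Backward direction: under this relation there is an explicit orbit of period 6, symmetric under two
  time reversals, whose first bounce has elliptic coordinates \<open>(0, c\<^sub>2, c\<^sub>4)\<close> and whose winding
  numbers are \<open>(6, 4, 2)\<close>.
\<close>

section \<open>Lines and confocal quadrics\<close>

text \<open>All four caustic types are one situation: once \<open>a\<close>, \<open>b\<close>,
  \<open>c\<close> and the caustic parameters are sorted, the dynamics sees only the sorted list,
  and caustics stand on the same footing as axes. The types part only when the final relation is
  turned into inequalities for the axes. The entries of \<open>G\<close> are even under a change of
  sign of a coordinate together with its velocity, so \<open>G\<close> is blind to reflections in
  the coordinate planes; it can return after three bounces although the trajectory itself needs six.
  The obstacle in the forward direction is to pass from integrals over a whole period to the
  position at the third bounce. Two integral relations must pin down the two times at which the two
  upper coordinates have done their share of oscillations, and they do so because the bands of these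
  coordinates are disjoint. The obstacle in the backward direction is reality: the prescribed
  polynomials determine squares of amplitudes, which have to be positive. Their signs depend only on
  the pairs {c1, c2} and {c3, c4}, not on which member of a pair is an axis, so one construction
  serves all types.\<close>

lemma sum_three_fractions:
  fixes A B C :: real
  assumes "A \<noteq> 0" "B \<noteq> 0" "C \<noteq> 0"
  shows "x / A + y / B + z / C = (x * (B * C) + y * (A * C) + z * (A * B)) / (A * B * C)"
  using assms by (simp add: field_simps)

locale semi_axes =
  fixes a b c :: real
  assumes ba: "b < a" and cb: "c < b" and c0: "0 < c"
begin

lemma a0: "0 < a" and b0: "0 < b" and ca: "c < a"
  using ba cb c0 by auto

definition axes_poly :: "real \<Rightarrow> real" where
  "axes_poly t = (a - t) * (b - t) * (c - t)"

text \<open>The three polynomials below are \<open>axes_poly t\<close> times \<open>1 - \<Sum> p\<^sub>i\<^sup>2 / (a\<^sub>i - t)\<close>,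
  \<open>\<Sum> p\<^sub>i v\<^sub>i / (a\<^sub>i - t)\<close> and \<open>\<Sum> v\<^sub>i\<^sup>2 / (a\<^sub>i - t)\<close>, with \<open>(a\<^sub>1, a\<^sub>2, a\<^sub>3) = (a, b, c)\<close>.\<close>

definition pos_poly :: "real ^ 3 \<Rightarrow> real \<Rightarrow> real" where
  "pos_poly p t = axes_poly t - (p $ 1)\<^sup>2 * ((b - t) * (c - t))
     - (p $ 2)\<^sup>2 * ((a - t) * (c - t)) - (p $ 3)\<^sup>2 * ((a - t) * (b - t))"

definition mix_poly :: "real ^ 3 \<Rightarrow> real ^ 3 \<Rightarrow> real \<Rightarrow> real" where
  "mix_poly p v t = p $ 1 * v $ 1 * ((b - t) * (c - t))
     + p $ 2 * v $ 2 * ((a - t) * (c - t)) + p $ 3 * v $ 3 * ((a - t) * (b - t))"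

definition dir_poly :: "real ^ 3 \<Rightarrow> real \<Rightarrow> real" where
  "dir_poly v t = (v $ 1)\<^sup>2 * ((b - t) * (c - t))
     + (v $ 2)\<^sup>2 * ((a - t) * (c - t)) + (v $ 3)\<^sup>2 * ((a - t) * (b - t))"

text \<open>The quotient of the discriminant of the line by \<open>axes_poly\<close>. The position
  enters only through the minors of \<open>p\<close> and \<open>v\<close>, so it is constant along
  the line.\<close>

definition caustic_poly :: "real ^ 3 \<Rightarrow> real ^ 3 \<Rightarrow> real \<Rightarrow> real" where
  "caustic_poly p v t = dir_poly v t - (p $ 1 * v $ 2 - p $ 2 * v $ 1)\<^sup>2 * (c - t)
     - (p $ 1 * v $ 3 - p $ 3 * v $ 1)\<^sup>2 * (b - t) - (p $ 2 * v $ 3 - p $ 3 * v $ 2)\<^sup>2 * (a - t)"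

lemma discriminant_identity:
  "(mix_poly p v t)\<^sup>2 + dir_poly v t * pos_poly p t = axes_poly t * caustic_poly p v t"
  unfolding mix_poly_def dir_poly_def pos_poly_def axes_poly_def caustic_poly_def by algebra

lemma inner3: "(x :: real ^ 3) \<bullet> y = x $ 1 * y $ 1 + x $ 2 * y $ 2 + x $ 3 * y $ 3"
  by (simp add: inner_vec_def sum_3)

lemma norm3: "(norm (x :: real ^ 3))\<^sup>2 = (x $ 1)\<^sup>2 + (x $ 2)\<^sup>2 + (x $ 3)\<^sup>2"
  unfolding power2_norm_eq_inner inner3 by (simp add: power2_eq_square)

lemma pos_poly_line:
  "pos_poly (p + s *\<^sub>R v) t = pos_poly p t - 2 * s * mix_poly p v t - s\<^sup>2 * dir_poly v t"
  unfolding mix_poly_def dir_poly_def pos_poly_def by (simp; algebra)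

lemma mix_poly_line: "mix_poly (p + s *\<^sub>R v) v t = mix_poly p v t + s * dir_poly v t"
  unfolding mix_poly_def dir_poly_def by (simp; algebra)

lemma axes_poly_nz: "t \<notin> {a, b, c} \<Longrightarrow> axes_poly t \<noteq> 0"
  by (auto simp: axes_poly_def)

lemma confocal_quadric_iff:
  assumes "t \<notin> {a, b, c}"
  shows "p \<in> confocal_quadric a b c t \<longleftrightarrow> pos_poly p t = 0"
proof -
  have nz: "a - t \<noteq> 0" "b - t \<noteq> 0" "c - t \<noteq> 0" using assms by auto
  have "(p $ 1)\<^sup>2 / (a - t) + (p $ 2)\<^sup>2 / (b - t) + (p $ 3)\<^sup>2 / (c - t) - 1
      = - pos_poly p t / axes_poly t"
    unfolding sum_three_fractions[OF nz] using axes_poly_nz[OF assms]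
    by (simp add: pos_poly_def axes_poly_def field_simps)
  then show ?thesis
    using axes_poly_nz[OF assms] unfolding confocal_quadric_def mem_Collect_eq
    by (metis (no_types, opaque_lifting) divide_eq_0_iff eq_iff_diff_eq_0 neg_equal_0_iff_equal)
qed

lemma confocal_normal_inner:
  assumes "t \<notin> {a, b, c}"
  shows "confocal_normal a b c t p \<bullet> v = mix_poly p v t / axes_poly t"
proof -
  have nz: "a - t \<noteq> 0" "b - t \<noteq> 0" "c - t \<noteq> 0" using assms by auto
  then show ?thesis
    using sum_three_fractions[OF nz, of "p $ 1 * v $ 1" "p $ 2 * v $ 2" "p $ 3 * v $ 3"]
    by (simp add: confocal_normal_def mix_poly_def axes_poly_def inner3 vector_3)
qed

lemma mix_poly_self: "mix_poly v v t = dir_poly v t"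
  by (simp add: mix_poly_def dir_poly_def power2_eq_square)

lemma mix_poly_commute: "mix_poly p v t = mix_poly v p t"
  by (simp add: mix_poly_def mult.commute)

text \<open>Restricted to the line, \<open>pos_poly\<close> is a quadratic in the line parameter.
  The two alternatives of \<open>tangent_line\<close> are a double root at a finite point and one at
  infinity, so together they say that the discriminant vanishes.\<close>

lemma tangent_line_iff:
  assumes "t \<notin> {a, b, c}" "v \<noteq> 0"
  shows "tangent_line a b c t p v \<longleftrightarrow> caustic_poly p v t = 0"
proof -
  note nz = axes_poly_nz[OF assms(1)]
  have "tangent_line a b c t p v \<longleftrightarrow>
     (\<exists>s. pos_poly p t - 2 * s * mix_poly p v t - s\<^sup>2 * dir_poly v t = 0
        \<and> mix_poly p v t + s * dir_poly v t = 0) \<or> (dir_poly v t = 0 \<and> mix_poly p v t = 0)"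
    unfolding tangent_line_def confocal_quadric_iff[OF assms(1)] confocal_normal_inner[OF assms(1)]
      pos_poly_line mix_poly_line mix_poly_self
    using assms(2) nz by (simp add: mix_poly_commute[of v p])
  also have "\<dots> \<longleftrightarrow> (mix_poly p v t)\<^sup>2 + dir_poly v t * pos_poly p t = 0" (is "?L = ?R")
  proof
    assume ?L then show ?R by (elim disjE exE conjE) algebra+
  next
    assume R: ?R
    show ?L
    proof (cases "dir_poly v t = 0")
      case True then show ?thesis using R by auto
    next
      case False
      define s where "s = - mix_poly p v t / dir_poly v t"
      have 1: "s * dir_poly v t = - mix_poly p v t" using False by (simp add: s_def)
      have "dir_poly v t * (pos_poly p t - 2 * s * mix_poly p v t - s\<^sup>2 * dir_poly v t) = 0"
        using 1 R by algebra
      then show ?thesis using 1 False by auto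
    qed
  qed
  also have "\<dots> \<longleftrightarrow> caustic_poly p v t = 0"
    using nz by (simp add: discriminant_identity)
  finally show ?thesis .
qed

lemma caustic_poly_quadratic:
  assumes "caustic_poly p v l1 = 0" "caustic_poly p v l2 = 0" "l1 \<noteq> l2"
  shows "caustic_poly p v t = (norm v)\<^sup>2 * (t - l1) * (t - l2)"
proof -
  obtain B C where BC: "\<And>s. caustic_poly p v s = (norm v)\<^sup>2 * s\<^sup>2 + B * s + C"
  proof
    show "caustic_poly p v s = (norm v)\<^sup>2 * s\<^sup>2 +
      ((p $ 1 * v $ 2 - p $ 2 * v $ 1)\<^sup>2 + (p $ 1 * v $ 3 - p $ 3 * v $ 1)\<^sup>2
        + (p $ 2 * v $ 3 - p $ 3 * v $ 2)\<^sup>2 - (v $ 1)\<^sup>2 * (b + c)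
        - (v $ 2)\<^sup>2 * (a + c) - (v $ 3)\<^sup>2 * (a + b)) * s +
      caustic_poly p v 0" for s
      unfolding norm3 caustic_poly_def dir_poly_def by algebra
  qed
  have "(l1 - l2) * ((norm v)\<^sup>2 * (l1 + l2) + B) = 0"
    using assms(1,2) unfolding BC by algebra
  then have "(norm v)\<^sup>2 * (l1 + l2) + B = 0" using assms(3) by simp
  then show ?thesis using assms(1) unfolding BC by algebra
qed

section \<open>Elliptic coordinates as the roots of a cubic\<close>

lemma pos_poly_at_axes:
  "pos_poly p a = - ((p $ 1)\<^sup>2 * ((a - b) * (a - c)))"
  "pos_poly p b = (p $ 2)\<^sup>2 * ((a - b) * (b - c))"
  "pos_poly p c = - ((p $ 3)\<^sup>2 * ((a - c) * (b - c)))"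
  unfolding pos_poly_def axes_poly_def by algebra+

text \<open>Roots can collide at \<open>b\<close> or \<open>c\<close> on the coordinate planes.
  Asking for a factorisation of the whole cubic, instead of three roots, keeps the
  multiplicities.\<close>

definition is_ecoords :: "real ^ 3 \<Rightarrow> (nat \<Rightarrow> real) \<Rightarrow> bool" where
  "is_ecoords p m \<longleftrightarrow> m 0 \<le> c \<and> c \<le> m 1 \<and> m 1 \<le> b \<and> b \<le> m 2 \<and> m 2 \<le> a \<and>
     (\<forall>t. pos_poly p t = (m 0 - t) * (m 1 - t) * (m 2 - t))"

definition ecoord :: "nat \<Rightarrow> real ^ 3 \<Rightarrow> real" where
  "ecoord j p = (SOME m. is_ecoords p m) j"

lemma pos_poly_cont: "continuous_on S (pos_poly p)"
  unfolding pos_poly_def axes_poly_def by (intro continuous_intros)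

text \<open>The weak signs of \<open>pos_poly\<close> at \<open>c\<close>, \<open>b\<close>,
  \<open>a\<close> alternate, which gives a root in [c, b] and one in [b, a]; the third comes from
  the sum of the roots. The case distinctions are due to roots at an end shared by two
  bands.\<close>

lemma ex_ecoords: "\<exists>m. is_ecoords p m"
proof -
  have 1: "\<exists>t. c \<le> t \<and> t \<le> b \<and> pos_poly p t = 0"
    using IVT'[of "pos_poly p" c 0 b] pos_poly_cont cb ba ca
    by (simp add: pos_poly_at_axes)
  have 2: "\<exists>t. b \<le> t \<and> t \<le> a \<and> pos_poly p t = 0"
    using IVT2'[of "pos_poly p" a 0 b] pos_poly_cont cb ba ca
    by (simp add: pos_poly_at_axes)
  obtain x where x: "c \<le> x" "x \<le> b" "pos_poly p x = 0" using 1 by auto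
  obtain y where y: "b \<le> y" "y \<le> a" "pos_poly p y = 0" "x \<noteq> y \<or> x = b \<and> y = b \<and> p $ 2 = 0"
  proof (cases "x = b")
    case True
    then have "p $ 2 = 0" using x(3) ba cb by (simp add: pos_poly_at_axes)
    then show ?thesis using that[of b] True ba x(3) by auto
  next
    case False then show ?thesis using 2 that x by force
  qed
  define N2 where "N2 = (p $ 1)\<^sup>2 + (p $ 2)\<^sup>2 + (p $ 3)\<^sup>2"
  define z where "z = a + b + c - N2 - x - y"
  define C1 where "C1 = a*b + b*c + c*a - (p $ 1)\<^sup>2 * (b + c) - (p $ 2)\<^sup>2 * (a + c) - (p $ 3)\<^sup>2 * (a + b)"
  define C0 where "C0 = a*b*c - (p $ 1)\<^sup>2 * (b * c) - (p $ 2)\<^sup>2 * (a * c) - (p $ 3)\<^sup>2 * (a * b)"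
  have P: "pos_poly p t = - (t^3) + (a + b + c - N2) * t\<^sup>2 - C1 * t + C0" for t
    unfolding pos_poly_def axes_poly_def N2_def C1_def C0_def by algebra
  show ?thesis
  proof (cases "x = y")
    case False
    have f: "pos_poly p t = (z - t) * (x - t) * (y - t)" for t
    proof -
      have "(x - y) * (pos_poly p t - (z - t) * (x - t) * (y - t)) = 0"
        using x(3) y(3) unfolding P z_def by algebra
      then show ?thesis using False by simp
    qed
    \<comment> \<open>If all three roots exceeded \<open>c\<close>, then \<open>pos_poly p c\<close>
      would be positive.\<close>
    have z: "z \<le> c \<or> x = b \<and> y = a \<and> c \<le> z \<or> x = c \<and> c \<le> z"
    proof (rule ccontr)
      assume h: "\<not> ?thesis"
      then have "z > c" "x > c" using x by auto
      then have "(z - c) * (x - c) * (y - c) > 0" using y(1) cb by simp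
      then have "pos_poly p c > 0" unfolding f .
      then show False using ca cb by (simp add: pos_poly_at_axes mult_less_0_iff)
    qed
    have sgn_ab: "pos_poly p a \<le> 0" "pos_poly p b \<ge> 0"
      using ba cb ca by (simp_all add: pos_poly_at_axes)
    have A: "(z - a) * (x - a) * (y - a) \<le> 0" "(z - b) * (x - b) * (y - b) \<ge> 0"
      using sgn_ab f[of a] f[of b] by simp_all
    consider "z \<le> c" | "x = c" "c \<le> z" "z \<le> b" | "x = c" "z > b" | "x = b" "y = a" "c \<le> z" "x \<noteq> c"
      using z by linarith
    then show ?thesis
    proof cases
      case 1
      then show ?thesis unfolding is_ecoords_def using x y f
        by (intro exI[of _ "\<lambda>j. if j = 0 then z else if j = 1 then x else y"]) auto
    next
      case 2
      then show ?thesis unfolding is_ecoords_def using x y f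
        by (intro exI[of _ "\<lambda>j. if j = 0 then x else if j = 1 then z else y"]) auto
    next
      case 3
      have "(z - b) * (y - b) \<le> 0" using A(2) 3 cb by (simp add: mult_le_0_iff zero_le_mult_iff mult.assoc mult.left_commute[of _ "c - b"])
      then have "y = b" using 3 y(1) by (simp add: mult_le_0_iff)
      have "(z - a) * ((c - a) * (b - a)) \<le> 0" using A(1) 3 \<open>y = b\<close> by (simp add: mult.assoc)
      then have "z \<le> a" using ba ca by (simp add: mult_le_0_iff zero_le_mult_iff)
      then show ?thesis unfolding is_ecoords_def using x y f 3 \<open>y = b\<close>
        by (intro exI[of _ "\<lambda>j. if j = 0 then x else if j = 1 then y else z"]) auto
    next
      case 4
      have "pos_poly p c \<le> 0" using ca cb by (simp add: pos_poly_at_axes)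
      then have "(z - c) * (b - c) * (a - c) \<le> 0" using f 4 by simp
      then have "z \<le> c" using ca cb by (simp add: mult_le_0_iff zero_le_mult_iff)
      then show ?thesis unfolding is_ecoords_def using x y f
        by (intro exI[of _ "\<lambda>j. if j = 0 then z else if j = 1 then x else y"]) auto
    qed
  next
    case True
    then have xy: "x = b" "y = b" "p $ 2 = 0" using y by auto
    \<comment> \<open>Here \<open>b\<close> was counted for both bands but is only known to be a
      root once. After division by its factor, the two roots of the remaining quadratic enclose
      \<open>c\<close>, and the larger one is placed below or above \<open>b\<close>.\<close>
    have f: "pos_poly p t = (b - t) * ((a - t) * (c - t) - (p $ 1)\<^sup>2 * (c - t) - (p $ 3)\<^sup>2 * (a - t))" for t
      unfolding pos_poly_def axes_poly_def using xy(3) by algebra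
    define g where "g = (\<lambda>t. (a - t) * (c - t) - (p $ 1)\<^sup>2 * (c - t) - (p $ 3)\<^sup>2 * (a - t))"
    have gc: "g c \<le> 0" using ca by (simp add: g_def)
    have ga: "g a \<ge> 0" using ca by (simp add: g_def mult_nonneg_nonpos)
    have "continuous_on S g" for S unfolding g_def by (intro continuous_intros)
    then obtain w where w: "c \<le> w" "w \<le> a" "g w = 0" using IVT'[of g c 0 a] gc ga ca by auto
    define v where "v = a + c - (p $ 1)\<^sup>2 - (p $ 3)\<^sup>2 - w"
    have gf: "g t = (v - t) * (w - t)" for t
      using w(3) unfolding g_def v_def by algebra
    have vc: "v \<le> c \<or> w = c \<and> v \<le> a"
    proof (cases "w = c")
      case True
      have "(v - a) * (c - a) \<ge> 0" using ga gf[of a] True by simp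
      then show ?thesis using True ca by (simp add: zero_le_mult_iff)
    next
      case False
      have "(v - c) * (w - c) \<le> 0" using gc gf[of c] by simp
      then show ?thesis using False w by (simp add: mult_le_0_iff)
    qed
    define m where "m = (min v w)"
    define M where "M = (max v w)"
    have mM: "m \<le> c" "c \<le> M" "M \<le> a" using vc w unfolding m_def M_def by auto
    have gf: "g t = (m - t) * (M - t)" for t unfolding gf m_def M_def by (simp add: min_def max_def)
    have f: "pos_poly p t = (b - t) * ((m - t) * (M - t))" for t
      unfolding f using gf[of t] by (simp add: g_def)
    show ?thesis
    proof (cases "M \<le> b")
      case True
      then show ?thesis unfolding is_ecoords_def using mM f ba
        by (intro exI[of _ "\<lambda>j. if j = 0 then m else if j = 1 then M else b"]) auto
    next
      case False
      then show ?thesis unfolding is_ecoords_def using mM f ba cb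
        by (intro exI[of _ "\<lambda>j. if j = 0 then m else if j = 1 then b else M"]) auto
    qed
  qed
qed

lemma ecoords: "is_ecoords p (\<lambda>j. ecoord j p)"
  unfolding ecoord_def using someI_ex[OF ex_ecoords] by simp

lemma ecoord_bounds:
  "ecoord 0 p \<le> c" "c \<le> ecoord 1 p" "ecoord 1 p \<le> b" "b \<le> ecoord 2 p" "ecoord 2 p \<le> a"
  using ecoords[of p] by (auto simp: is_ecoords_def)

lemma pos_poly_ecoord:
  "pos_poly p t = (ecoord 0 p - t) * (ecoord 1 p - t) * (ecoord 2 p - t)"
  using ecoords[of p] by (auto simp: is_ecoords_def)

lemma tendsto_pos_poly: "((\<lambda>x. pos_poly x t) \<longlongrightarrow> pos_poly p t) (at p within S)"
  unfolding pos_poly_def by (intro tendsto_intros)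

text \<open>Comparing a coordinate with a threshold is a sign condition on \<open>pos_poly\<close>,
  which is polynomial in the point. Continuity of the coordinates follows without a formula for the
  roots, even where roots collide.\<close>

lemma ecoord_cmp:
  "t < c \<Longrightarrow> t < ecoord 0 p \<longleftrightarrow> pos_poly p t > 0"
  "t < c \<Longrightarrow> ecoord 0 p < t \<longleftrightarrow> pos_poly p t < 0"
  "c < t \<Longrightarrow> t < b \<Longrightarrow> t < ecoord 1 p \<longleftrightarrow> pos_poly p t < 0"
  "c < t \<Longrightarrow> t < b \<Longrightarrow> ecoord 1 p < t \<longleftrightarrow> pos_poly p t > 0"
  "b < t \<Longrightarrow> t < a \<Longrightarrow> t < ecoord 2 p \<longleftrightarrow> pos_poly p t > 0"
  "b < t \<Longrightarrow> t < a \<Longrightarrow> ecoord 2 p < t \<longleftrightarrow> pos_poly p t < 0"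
  using ecoord_bounds[of p] cb ba
  by (auto simp: pos_poly_ecoord zero_less_mult_iff mult_less_0_iff)

end

context semi_axes
begin

lemma ecoord_tendsto:
  assumes "j \<le> 2"
  shows "(ecoord j \<longlongrightarrow> ecoord j p) (at p within S)"
proof (rule order_tendstoI)
  have ev: "pos_poly p t > 0 \<Longrightarrow> \<forall>\<^sub>F x in at p within S. pos_poly x t > 0"
    "pos_poly p t < 0 \<Longrightarrow> \<forall>\<^sub>F x in at p within S. pos_poly x t < 0" for t
    using order_tendstoD[OF tendsto_pos_poly] by auto
  consider "j = 0" | "j = 1" | "j = 2" using assms by linarith
  note cs = this
  {
    fix y assume y: "y < ecoord j p"
    obtain t where t: "y < t" "t < ecoord j p" using y dense by blast
    from cs show "\<forall>\<^sub>F x in at p within S. y < ecoord j x"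
    proof cases
      case 1
      have "t < c" using t 1 ecoord_bounds(1)[of p] by simp
      then show ?thesis
        using ev(1)[of t] t ecoord_cmp(1)[of t] unfolding 1
        by (auto elim!: eventually_mono intro: less_trans)
    next
      case 2
      show ?thesis
      proof (cases "c < t")
        case True
        have "t < b" using t 2 ecoord_bounds(3)[of p] by simp
        then show ?thesis
          using ev(2)[of t] t True ecoord_cmp(3)[of t] unfolding 2
          by (auto elim!: eventually_mono intro: less_trans)
      next
        case False
        then have "y < ecoord 1 x" for x using t ecoord_bounds(2)[of x] by simp
        then show ?thesis unfolding 2 by simp
      qed
    next
      case 3
      show ?thesis
      proof (cases "b < t")
        case True
        have "t < a" using t 3 ecoord_bounds(5)[of p] by simp
        then show ?thesis
          using ev(1)[of t] t True ecoord_cmp(5)[of t] unfolding 3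
          by (auto elim!: eventually_mono intro: less_trans)
      next
        case False
        then have "y < ecoord 2 x" for x using t ecoord_bounds(4)[of x] by simp
        then show ?thesis unfolding 3 by simp
      qed
    qed
  next
    fix y assume y: "ecoord j p < y"
    obtain t where t: "t < y" "ecoord j p < t" using y dense by blast
    from cs show "\<forall>\<^sub>F x in at p within S. ecoord j x < y"
    proof cases
      case 1
      show ?thesis
      proof (cases "t < c")
        case True
        then show ?thesis
          using ev(2)[of t] t ecoord_cmp(2)[of t] unfolding 1
          by (auto elim!: eventually_mono intro: less_trans)
      next
        case False
        then have "ecoord 0 x < y" for x using t ecoord_bounds(1)[of x] by simp
        then show ?thesis unfolding 1 by simp
      qed
    next
      case 2
      have "c < t" using t 2 ecoord_bounds(2)[of p] by simp
      show ?thesis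
      proof (cases "t < b")
        case True
        then show ?thesis
          using ev(1)[of t] t \<open>c < t\<close> ecoord_cmp(4)[of t] unfolding 2
          by (auto elim!: eventually_mono intro: less_trans)
      next
        case False
        then have "ecoord 1 x < y" for x using t ecoord_bounds(3)[of x] by simp
        then show ?thesis unfolding 2 by simp
      qed
    next
      case 3
      have "b < t" using t 3 ecoord_bounds(4)[of p] by simp
      show ?thesis
      proof (cases "t < a")
        case True
        then show ?thesis
          using ev(2)[of t] t \<open>b < t\<close> ecoord_cmp(6)[of t] unfolding 3
          by (auto elim!: eventually_mono intro: less_trans)
      next
        case False
        then have "ecoord 2 x < y" for x using t ecoord_bounds(5)[of x] by simp
        then show ?thesis unfolding 3 by simp
      qed
    qed
  }
qed

lemma generic_ecoord_bounds:
  assumes "\<forall>i. p $ i \<noteq> 0"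
  shows "ecoord 0 p < c" "c < ecoord 1 p" "ecoord 1 p < b" "b < ecoord 2 p" "ecoord 2 p < a"
proof -
  have "pos_poly p a \<noteq> 0" "pos_poly p b \<noteq> 0" "pos_poly p c \<noteq> 0"
    using assms ba cb ca by (auto simp: pos_poly_at_axes)
  then show "ecoord 0 p < c" "c < ecoord 1 p" "ecoord 1 p < b" "b < ecoord 2 p" "ecoord 2 p < a"
    using ecoord_bounds[of p] by (auto simp: pos_poly_ecoord)
qed

lemma elliptic_coords_generic_eq:
  assumes "\<forall>i. p $ i \<noteq> 0"
  shows "elliptic_coords_generic a b c p = (ecoord 0 p, ecoord 1 p, ecoord 2 p)"
  unfolding elliptic_coords_generic_def
proof (rule the_equality)
  note g = generic_ecoord_bounds[OF assms]
  show "case (ecoord 0 p, ecoord 1 p, ecoord 2 p) of (m0, m1, m2) \<Rightarrow>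
    m0 < c \<and> c < m1 \<and> m1 < b \<and> b < m2 \<and> m2 < a \<and>
    p \<in> confocal_quadric a b c m0 \<inter> confocal_quadric a b c m1 \<inter> confocal_quadric a b c m2"
    using g ba cb by (simp add: confocal_quadric_iff pos_poly_ecoord)
  fix w
  assume "case w of (m0, m1, m2) \<Rightarrow>
    m0 < c \<and> c < m1 \<and> m1 < b \<and> b < m2 \<and> m2 < a \<and>
    p \<in> confocal_quadric a b c m0 \<inter> confocal_quadric a b c m1 \<inter> confocal_quadric a b c m2"
  then obtain m0 m1 m2 where w: "w = (m0, m1, m2)" and m: "m0 < c" "c < m1" "m1 < b" "b < m2" "m2 < a"
    "p \<in> confocal_quadric a b c m0 \<inter> confocal_quadric a b c m1 \<inter> confocal_quadric a b c m2"
    by (cases w) auto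
  then have "pos_poly p m0 = 0" "pos_poly p m1 = 0" "pos_poly p m2 = 0"
    using ba cb by (auto simp: confocal_quadric_iff)
  then show "w = (ecoord 0 p, ecoord 1 p, ecoord 2 p)"
    using m g unfolding pos_poly_ecoord w by auto
qed

text \<open>A shift along (1, 1, 1) meets the coordinate planes for at most three values of the
  shift. The limit in \<open>elliptic_coords\<close> is determined because of this.\<close>

lemma generic_islimpt: "p islimpt {x :: real ^ 3. \<forall>i. x $ i \<noteq> 0}"
  unfolding islimpt_approachable
proof (intro allI impI)
  fix e :: real assume "e > 0"
  define w :: "real ^ 3" where "w = (\<chi> i. 1)"
  have "w \<noteq> 0" by (simp add: w_def vec_eq_iff)
  then have n: "norm w > 0" by simp
  have "infinite ({0<..<e / norm w} - (\<lambda>i. - (p $ i)) ` UNIV)"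
    using \<open>e > 0\<close> n by (intro Diff_infinite_finite) auto
  then obtain h where h: "0 < h" "h < e / norm w" "\<And>i. h \<noteq> - (p $ i)"
    by (metis (no_types, lifting) DiffE all_not_in_conv finite.emptyI greaterThanLessThan_iff rangeI)
  have "dist (p + h *\<^sub>R w) p < e" using h n by (simp add: dist_norm field_simps)
  moreover have "(p + h *\<^sub>R w) $ i \<noteq> 0" for i
    using h(3)[of i] by (simp add: w_def)
  ultimately show "\<exists>x'\<in>{x. \<forall>i. x $ i \<noteq> 0}. x' \<noteq> p \<and> dist x' p < e"
    using h(1) \<open>w \<noteq> 0\<close> by (intro bexI[of _ "p + h *\<^sub>R w"]) auto
qed

lemma elliptic_coords_eq: "elliptic_coords a b c p = (ecoord 0 p, ecoord 1 p, ecoord 2 p)"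
proof -
  let ?G = "{x :: real ^ 3. \<forall>i. x $ i \<noteq> 0}"
  have "((\<lambda>x. (ecoord 0 x, ecoord 1 x, ecoord 2 x)) \<longlongrightarrow> (ecoord 0 p, ecoord 1 p, ecoord 2 p)) (at p within ?G)"
    by (intro tendsto_intros ecoord_tendsto) auto
  then have "(elliptic_coords_generic a b c \<longlongrightarrow> (ecoord 0 p, ecoord 1 p, ecoord 2 p)) (at p within ?G)"
    by (rule Lim_transform_eventually)
      (auto simp: eventually_at_filter elliptic_coords_generic_eq)
  then show ?thesis
    unfolding elliptic_coords_def
    using generic_islimpt[of p] by (intro tendsto_Lim) (simp_all add: trivial_limit_within)
qed

lemma continuous_on_ecoord: "j \<le> 2 \<Longrightarrow> continuous_on S (ecoord j)"
  unfolding continuous_on_def using ecoord_tendsto by blast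

end

text \<open>Implicit differentiation of a simple root: at \<open>t = f y\<close> the left side of
  \<open>eq\<close> vanishes, which leaves an explicit formula for the difference quotient. The set
  \<open>S\<close> provides the one-sided derivatives that occur at bounces.\<close>

lemma simple_root_has_derivative:
  fixes f g h :: "real \<Rightarrow> real"
  assumes "continuous (at x within S) f"
    and ne: "g x \<noteq> f x" "h x \<noteq> f x"
    and eq: "\<And>y t. y \<in> S \<Longrightarrow> (f y - t) * (g y - t) * (h y - t) =
        (f x - t) * (g x - t) * (h x - t) - 2 * (y - x) * \<beta> t - (y - x)\<^sup>2 * \<alpha> t"
    and "isCont \<beta> (f x)" "isCont \<alpha> (f x)"
  shows "(f has_real_derivative - 2 * \<beta> (f x) / ((g x - f x) * (h x - f x))) (at x within S)"
proof -
  let ?F = "at x within S"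
  have f: "(f \<longlongrightarrow> f x) ?F" using assms(1) by (simp add: continuous_within)
  have \<beta>: "((\<lambda>y. \<beta> (f y)) \<longlongrightarrow> \<beta> (f x)) ?F" and \<alpha>: "((\<lambda>y. \<alpha> (f y)) \<longlongrightarrow> \<alpha> (f x)) ?F"
    using isCont_tendsto_compose[OF _ f] assms(5,6) by auto
  have "((\<lambda>y. - (2 * \<beta> (f y) + (y - x) * \<alpha> (f y)) / ((g x - f y) * (h x - f y))) \<longlongrightarrow>
      - (2 * \<beta> (f x) + (x - x) * \<alpha> (f x)) / ((g x - f x) * (h x - f x))) ?F"
    using ne by (intro tendsto_intros f \<alpha> \<beta>) auto
  moreover have "\<forall>\<^sub>F y in ?F. - (2 * \<beta> (f y) + (y - x) * \<alpha> (f y)) / ((g x - f y) * (h x - f y))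
      = (f y - f x) / (y - x)"
  proof -
    have "\<forall>\<^sub>F y in ?F. g x \<noteq> f y" "\<forall>\<^sub>F y in ?F. h x \<noteq> f y"
      using tendsto_imp_eventually_ne[OF f ne(1)[symmetric]]
        tendsto_imp_eventually_ne[OF f ne(2)[symmetric]]
      by (auto elim: eventually_mono)
    moreover have "\<forall>\<^sub>F y in ?F. y \<in> S \<and> y \<noteq> x" by (simp add: eventually_at_filter)
    ultimately show ?thesis
    proof eventually_elim
      case (elim y)
      have "(y - x) * (2 * \<beta> (f y) + (y - x) * \<alpha> (f y)) = (f x - f y) * ((g x - f y) * (h x - f y))"
        using eq[of y "f y"] elim by (simp add: power2_eq_square algebra_simps)
      then have "2 * \<beta> (f y) + (y - x) * \<alpha> (f y)
          = (f x - f y) / (y - x) * ((g x - f y) * (h x - f y))"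
        using elim by (simp add: nonzero_eq_divide_eq mult.commute)
      moreover have "(f y - f x) / (y - x) = - ((f x - f y) / (y - x))"
        by (simp add: minus_divide_left)
      ultimately show ?case using elim by simp
    qed
  qed
  ultimately have "((\<lambda>y. (f y - f x) / (y - x)) \<longlongrightarrow>
      - (2 * \<beta> (f x) + (x - x) * \<alpha> (f x)) / ((g x - f x) * (h x - f x))) ?F"
    by (rule Lim_transform_eventually)
  then show ?thesis by (simp add: has_field_derivative_iff)
qed

section \<open>Reflections and trajectories\<close>

context semi_axes
begin

abbreviation "normal p \<equiv> confocal_normal a b c 0 p"

lemma normal_nth: "normal p $ 1 = p $ 1 / a" "normal p $ 2 = p $ 2 / b" "normal p $ 3 = p $ 3 / c"
  by (simp_all add: confocal_normal_def vector_3)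

lemma ellipsoid_iff: "p \<in> ellipsoid a b c \<longleftrightarrow> pos_poly p 0 = 0"
  using a0 b0 c0 by (intro confocal_quadric_iff) auto

lemma normal_inner: "normal p \<bullet> v = mix_poly p v 0 / (a * b * c)"
  using confocal_normal_inner[of 0 p v] a0 b0 c0 by (simp add: axes_poly_def)

lemma dir_poly_0_pos: "v \<noteq> 0 \<Longrightarrow> dir_poly v 0 > 0"
proof -
  assume "v \<noteq> 0"
  then have "v $ 1 \<noteq> 0 \<or> v $ 2 \<noteq> 0 \<or> v $ 3 \<noteq> 0" by (auto simp: vec_eq_iff forall_3)
  moreover have "(v $ 1)\<^sup>2 * (b * c) \<ge> 0" "(v $ 2)\<^sup>2 * (a * c) \<ge> 0" "(v $ 3)\<^sup>2 * (a * b) \<ge> 0"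
    using a0 b0 c0 by simp_all
  moreover have "v $ 1 \<noteq> 0 \<Longrightarrow> (v $ 1)\<^sup>2 * (b * c) > 0" "v $ 2 \<noteq> 0 \<Longrightarrow> (v $ 2)\<^sup>2 * (a * c) > 0"
    "v $ 3 \<noteq> 0 \<Longrightarrow> (v $ 3)\<^sup>2 * (a * b) > 0"
    using a0 b0 c0 by simp_all
  ultimately show ?thesis unfolding dir_poly_def by (auto simp del: zero_less_mult_iff)
qed

text \<open>Partial fractions, 1/(A (A - t)) = (1/t) (1/(A - t) - 1/A), express pairings with the
  normal through pairings with the position. The leftover terms at parameter 0 are removed by the
  equation of the ellipsoid and, in the second formula, also by the reflection law.\<close>

lemma reflection_step:
  assumes "pos_poly p 0 = 0" and "2 * (u \<bullet> normal p) = n * (normal p \<bullet> normal p)"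
    and "u' = u - n *\<^sub>R normal p" and "t \<noteq> 0"
  shows "mix_poly p u' t = mix_poly p u t + n / t * pos_poly p t"
    and "dir_poly u' t = dir_poly u t - 2 * (n / t) * mix_poly p u t - (n / t)\<^sup>2 * pos_poly p t"
proof -
  define X Y Z where "X = p $ 1 / a" and "Y = p $ 2 / b" and "Z = p $ 3 / c"
  have p: "p $ 1 = a * X" "p $ 2 = b * Y" "p $ 3 = c * Z"
    using a0 b0 c0 by (simp_all add: X_def Y_def Z_def)
  have e: "a * X\<^sup>2 + b * Y\<^sup>2 + c * Z\<^sup>2 = 1"
  proof -
    have "a * b * c * (1 - (a * X\<^sup>2 + b * Y\<^sup>2 + c * Z\<^sup>2)) = 0"
      using assms(1) unfolding pos_poly_def axes_poly_def p by algebra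
    then show ?thesis using a0 b0 c0 by simp
  qed
  have r: "2 * (u $ 1 * X + u $ 2 * Y + u $ 3 * Z) = n * (X\<^sup>2 + Y\<^sup>2 + Z\<^sup>2)"
    using assms(2) by (simp add: inner3 normal_nth X_def Y_def Z_def power2_eq_square)
  have u': "u' $ 1 = u $ 1 - n * X" "u' $ 2 = u $ 2 - n * Y" "u' $ 3 = u $ 3 - n * Z"
    by (simp_all add: assms(3) normal_nth X_def Y_def Z_def)
  have "t * mix_poly p u' t = t * mix_poly p u t + n * pos_poly p t"
    unfolding mix_poly_def pos_poly_def axes_poly_def p u' using e by algebra
  then show "mix_poly p u' t = mix_poly p u t + n / t * pos_poly p t"
    using assms(4) by (simp add: field_simps)
  have "t\<^sup>2 * dir_poly u' t = t\<^sup>2 * dir_poly u t - 2 * n * t * mix_poly p u t - n\<^sup>2 * pos_poly p t"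
    unfolding mix_poly_def pos_poly_def axes_poly_def dir_poly_def p u' using e r by algebra
  moreover have "t\<^sup>2 * (dir_poly u t - 2 * (n / t) * mix_poly p u t - (n / t)\<^sup>2 * pos_poly p t)
      = t\<^sup>2 * dir_poly u t - 2 * n * t * mix_poly p u t - n\<^sup>2 * pos_poly p t"
    using assms(4) by (simp add: right_diff_distrib power_divide power2_eq_square)
  ultimately show "dir_poly u' t = dir_poly u t - 2 * (n / t) * mix_poly p u t - (n / t)\<^sup>2 * pos_poly p t"
    using assms(4) by (metis mult_left_cancel power_not_zero)
qed

lemma caustic_poly_flight: "caustic_poly (p + s *\<^sub>R v) v t = caustic_poly p v t"
  unfolding caustic_poly_def by (simp; algebra)

lemma caustic_poly_scale: "caustic_poly p (r *\<^sub>R v) t = r\<^sup>2 * caustic_poly p v t"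
  unfolding caustic_poly_def dir_poly_def by (simp; algebra)

end

text \<open>The speed is left free, because the explicit orbit is normalised by its first flight
  instead. For a nonzero kick, \<open>reflection_angle\<close> is the preservation of speed.
  Positive kicks and flights will make the leading coefficient of the trace cubic nonzero.\<close>

locale billiard = semi_axes +
  fixes q :: "int \<Rightarrow> real ^ 3" and u :: "int \<Rightarrow> real ^ 3" and \<tau> \<nu> :: "int \<Rightarrow> real"
  assumes on_ellipsoid: "pos_poly (q k) 0 = 0"
    and flight: "q (k + 1) = q k + \<tau> k *\<^sub>R u k"
    and reflection: "u k = u (k - 1) - \<nu> k *\<^sub>R normal (q k)"
    and reflection_angle: "2 * (u (k - 1) \<bullet> normal (q k)) = \<nu> k * (normal (q k) \<bullet> normal (q k))"
    and \<tau>_pos: "\<tau> k > 0" and \<nu>_pos: "\<nu> k > 0"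

lemma (in semi_axes) billiard_trajectoryD:
  assumes "billiard_trajectory a b c q"
  obtains u \<tau> \<nu> where "billiard a b c q u \<tau> \<nu>" "\<And>k. norm (u k) = 1"
    "\<And>k. \<tau> k = norm (q (k + 1) - q k)" "\<And>k. u k = sgn (q (k + 1) - q k)"
proof -
  define u \<tau> \<nu> where "u = (\<lambda>k. sgn (q (k + 1) - q k))" and "\<tau> = (\<lambda>k. norm (q (k + 1) - q k))"
    and "\<nu> = (\<lambda>k. 2 * (u (k - 1) \<bullet> normal (q k)) / (normal (q k) \<bullet> normal (q k)))"
  have e: "pos_poly (q k) 0 = 0" and ne: "q k \<noteq> q (k + 1)"
    and r: "u k = reflect (normal (q k)) (sgn (q k - q (k - 1)))" for k
    using assms unfolding billiard_trajectory_def ellipsoid_iff u_def by auto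
  have un: "norm (u k) = 1" "\<tau> k > 0" "u k \<noteq> 0" for k
    using ne[of k] by (auto simp: u_def \<tau>_def norm_sgn sgn_zero_iff)
  have f: "q (k + 1) = q k + \<tau> k *\<^sub>R u k" for k
    using ne[of k] by (simp add: u_def \<tau>_def sgn_div_norm)
  have nz: "normal (q k) \<noteq> 0" for k
  proof
    assume "normal (q k) = 0"
    then have "q k $ 1 = 0 \<and> q k $ 2 = 0 \<and> q k $ 3 = 0"
      using normal_nth[of "q k"] a0 b0 c0 by simp
    then show False using e[of k] a0 b0 c0 by (simp add: pos_poly_def axes_poly_def)
  qed
  have angle: "2 * (u (k - 1) \<bullet> normal (q k)) = \<nu> k * (normal (q k) \<bullet> normal (q k))" for k
    using nz[of k] by (simp add: \<nu>_def)
  have refl: "u k = u (k - 1) - \<nu> k *\<^sub>R normal (q k)" for k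
    using r[of k] by (simp add: reflect_def \<nu>_def u_def)
  have "\<nu> k > 0" for k
  proof -
    \<comment> \<open>Followed backwards, the incoming line meets the ellipsoid again at the
      previous bounce; this forces the incoming direction to point outwards.\<close>
    have "q (k - 1) = q k + (- \<tau> (k - 1)) *\<^sub>R u (k - 1)" using f[of "k - 1"] by simp
    then have "0 = pos_poly (q k + (- \<tau> (k - 1)) *\<^sub>R u (k - 1)) 0" using e[of "k - 1"] by simp
    then have "\<tau> (k - 1) * (2 * mix_poly (q k) (u (k - 1)) 0 - \<tau> (k - 1) * dir_poly (u (k - 1)) 0) = 0"
      unfolding pos_poly_line e by algebra
    then have "2 * mix_poly (q k) (u (k - 1)) 0 = \<tau> (k - 1) * dir_poly (u (k - 1)) 0"
      using un(2)[of "k - 1"] by simp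
    moreover have "\<tau> (k - 1) * dir_poly (u (k - 1)) 0 > 0"
      using un(2,3)[of "k - 1"] dir_poly_0_pos by simp
    ultimately have "normal (q k) \<bullet> u (k - 1) > 0"
      using a0 b0 c0 unfolding normal_inner by simp
    then show ?thesis using nz[of k] by (simp add: \<nu>_def inner_commute)
  qed
  then have "billiard a b c q u \<tau> \<nu>"
    by (intro billiard.intro billiard_axioms.intro semi_axes_axioms e f refl angle un)
  then show thesis using that un(1) \<tau>_def u_def by auto
qed

lemma (in semi_axes) billiard_trajectoryI:
  assumes "billiard a b c q u \<tau> \<nu>" and "\<And>k. norm (u k) = U" and "U > 0"
  shows "billiard_trajectory a b c q"
  unfolding billiard_trajectory_def
proof (intro allI conjI)
  interpret billiard a b c q u \<tau> \<nu> by fact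
  fix k
  show "q k \<in> ellipsoid a b c" using on_ellipsoid by (simp add: ellipsoid_iff)
  have d: "q (k + 1) - q k = \<tau> k *\<^sub>R u k" for k using flight by simp
  have s: "sgn (q (k + 1) - q k) = (1 / U) *\<^sub>R u k" for k
    unfolding d using \<tau>_pos[of k] assms(2)[of k] by (simp add: sgn_scaleR) (simp add: sgn_div_norm inverse_eq_divide)
  have "u k \<noteq> 0" using assms(2)[of k] assms(3) by auto
  then have "\<tau> k *\<^sub>R u k \<noteq> 0" using \<tau>_pos[of k] by simp
  then show "q k \<noteq> q (k + 1)" using d[of k] by auto
  have n: "normal (q k) \<bullet> normal (q k) > 0"
  proof -
    have "normal (q k) \<noteq> 0"
    proof
      assume "normal (q k) = 0"
      then have "q k $ 1 = 0 \<and> q k $ 2 = 0 \<and> q k $ 3 = 0"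
        using normal_nth[of "q k"] a0 b0 c0 by simp
      then show False using on_ellipsoid[of k] a0 b0 c0 by (simp add: pos_poly_def axes_poly_def)
    qed
    then show ?thesis by simp
  qed
  have s1: "sgn (q k - q (k - 1)) = (1 / U) *\<^sub>R u (k - 1)" using s[of "k - 1"] by simp
  have \<nu>_eq: "2 * (u (k - 1) \<bullet> normal (q k)) / (normal (q k) \<bullet> normal (q k)) = \<nu> k"
    using reflection_angle[of k] n by (simp add: nonzero_divide_eq_eq)
  have "2 * ((1 / U) *\<^sub>R u (k - 1) \<bullet> normal (q k)) / (normal (q k) \<bullet> normal (q k)) = \<nu> k / U"
    by (simp add: \<nu>_eq[symmetric] mult.commute)
  then show "sgn (q (k + 1) - q k) = reflect (normal (q k)) (sgn (q k - q (k - 1)))"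
    unfolding reflect_def s1 unfolding s using reflection[of k]
    by (simp add: scaleR_right_diff_distrib)
qed

lemma trajectory_path_segment:
  assumes "of_int k \<le> s" "s \<le> of_int k + 1"
  shows "trajectory_path q s = q k + (s - of_int k) *\<^sub>R (q (k + 1) - q k)"
proof (cases "s = of_int k + 1")
  case True
  then have "\<lfloor>s\<rfloor> = k + 1" by linarith
  then show ?thesis using True by (simp add: trajectory_path_def frac_def)
next
  case False
  then have "\<lfloor>s\<rfloor> = k" using assms by linarith
  then show ?thesis by (simp add: trajectory_path_def frac_def algebra_simps)
qed

lemma trajectory_path_vertex: "trajectory_path q (of_int k) = q k"
  using trajectory_path_segment[of k "of_int k" q] by simp

lemma trajectory_path_shift:
  assumes "\<And>k. q (k + n) = q k"
  shows "trajectory_path q (s + of_int n) = trajectory_path q s"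
proof -
  have "q (\<lfloor>s\<rfloor> + n + 1) = q (\<lfloor>s\<rfloor> + 1)" using assms[of "\<lfloor>s\<rfloor> + 1"] by (simp add: algebra_simps)
  then show ?thesis using assms[of "\<lfloor>s\<rfloor>"] by (simp add: trajectory_path_def frac_def)
qed

lemma continuous_on_trajectory_path: "continuous_on S (trajectory_path q)"
proof -
  have seg: "continuous_on {of_int k..of_int k + 1} (trajectory_path q)" for k
  proof -
    have "continuous_on {of_int k..of_int k + 1 :: real} (\<lambda>s. q k + (s - of_int k) *\<^sub>R (q (k + 1) - q k))"
      by (intro continuous_intros)
    then show ?thesis
      by (rule continuous_on_eq) (auto simp: trajectory_path_segment)
  qed
  have "isCont (trajectory_path q) s" for s
  proof -
    define k where "k = \<lfloor>s\<rfloor>"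
    have "continuous_on ({of_int (k - 1)..of_int (k - 1) + 1} \<union> {of_int k..of_int k + 1}) (trajectory_path q)"
      by (intro continuous_on_closed_Un seg) auto
    moreover have "{of_int (k - 1)..of_int (k - 1) + 1} \<union> {of_int k..of_int k + 1} = {of_int k - 1..of_int k + 1 :: real}"
      by auto
    ultimately have "continuous_on {of_int k - 1..of_int k + 1} (trajectory_path q)" by simp
    moreover have "s \<in> interior {of_int k - 1..of_int k + 1 :: real}"
      unfolding interior_atLeastAtMost_real k_def by (auto; linarith)
    ultimately show ?thesis by (rule continuous_on_interior)
  qed
  then show ?thesis by (simp add: continuous_at_imp_continuous_on)
qed

lemma finite_quadratic_roots:
  fixes A B C :: real
  assumes "A \<noteq> 0 \<or> B \<noteq> 0 \<or> C \<noteq> 0"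
  shows "finite {s. C + B * s + A * s\<^sup>2 = 0}"
proof -
  have "{s. C + B * s + A * s\<^sup>2 = 0} = {s. poly [:C, B, A:] s = 0}"
    by (auto simp: power2_eq_square algebra_simps)
  moreover have "[:C, B, A:] \<noteq> 0" using assms by auto
  ultimately show ?thesis using poly_roots_finite by metis
qed

lemma continuous_le_off_finite:
  fixes f :: "real \<Rightarrow> real"
  assumes "continuous_on {x..y} f" "finite F" "x < y" "\<And>s. s \<in> {x..y} - F \<Longrightarrow> f s \<le> B" "s \<in> {x..y}"
  shows "f s \<le> B"
proof -
  have "(f \<longlongrightarrow> f s) (at s within {x..y})" using assms(1,5) by (auto simp: continuous_on_def)
  moreover have "\<forall>\<^sub>F r in at s within {x..y}. f r \<le> B"
  proof -
    have "open (- (F - {s}))" using assms(2) by (intro open_Compl finite_imp_closed) auto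
    then have "\<forall>\<^sub>F r in at s within {x..y}. r \<in> - (F - {s})"
      unfolding eventually_at_topological by (intro exI[of _ "- (F - {s})"]) auto
    moreover have "\<forall>\<^sub>F r in at s within {x..y}. r \<in> {x..y} \<and> r \<noteq> s" by (simp add: eventually_at_filter)
    ultimately show ?thesis by eventually_elim (use assms(4) in auto)
  qed
  moreover have "at s within {x..y} \<noteq> bot"
    using assms(3,5) by (simp add: trivial_limit_within islimpt_Icc)
  ultimately show ?thesis by (intro tendsto_upperbound) auto
qed

section \<open>Caustics\<close>

text \<open>These are exactly the four types. The conditions \<open>l1 < b\<close> and
  \<open>c < l2\<close> keep the pairs {c, l1} and {b, l2} apart, so that sorting within each pair
  sorts all five parameters.\<close>

locale caustics = semi_axes +
  fixes l1 l2 :: real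
  assumes l1_pos: "0 < l1" and l1_l2: "l1 < l2" and l2_a: "l2 < a"
    and l1_b: "l1 < b" and c_l2: "c < l2" and l1_c: "l1 \<noteq> c" and l2_b: "l2 \<noteq> b"
begin

definition "c1 = min c l1"
definition "c2 = max c l1"
definition "c3 = min b l2"
definition "c4 = max b l2"

lemma c_order: "0 < c1" "c1 < c2" "c2 < c3" "c3 < c4" "c4 < a" "c1 \<le> c" "c \<le> c2" "c3 \<le> b" "b \<le> c4"
  using l1_pos l1_l2 l2_a l1_b c_l2 l1_c l2_b c0 cb ba
  by (auto simp: c1_def c2_def c3_def c4_def)

definition T :: "real \<Rightarrow> real" where
  "T t = (c1 - t) * (c2 - t) * (c3 - t) * (c4 - t) * (a - t)"

lemma T_eq: "T t = axes_poly t * ((t - l1) * (t - l2))"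
proof -
  have "(c1 - t) * (c2 - t) = (c - t) * (l1 - t)" "(c3 - t) * (c4 - t) = (b - t) * (l2 - t)"
    by (auto simp: c1_def c2_def c3_def c4_def min_def max_def)
  then show ?thesis unfolding T_def axes_poly_def by algebra
qed

lemma T_zero_iff: "T t = 0 \<longleftrightarrow> t \<in> {c1, c2, c3, c4, a}"
  by (auto simp: T_def)

lemma osc_endpoints:
  "osc_endpoint a b c l1 l2 0 = 0" "osc_endpoint a b c l1 l2 1 = c1" "osc_endpoint a b c l1 l2 2 = c2"
  "osc_endpoint a b c l1 l2 3 = c3" "osc_endpoint a b c l1 l2 4 = c4" "osc_endpoint a b c l1 l2 5 = a"
proof -
  have "{a, b, c, l1, l2} = set [c1, c2, c3, c4, a]"
    by (auto simp: c1_def c2_def c3_def c4_def min_def max_def)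
  moreover have "sorted_list_of_set (set [c1, c2, c3, c4, a]) = [c1, c2, c3, c4, a]"
    using c_order by (intro sorted_list_of_set.idem_if_sorted_distinct) auto
  ultimately have e: "osc_endpoint a b c l1 l2 k = (0 # [c1, c2, c3, c4, a]) ! k" for k
    by (simp only: osc_endpoint_def)
  show "osc_endpoint a b c l1 l2 0 = 0" "osc_endpoint a b c l1 l2 1 = c1" "osc_endpoint a b c l1 l2 2 = c2"
    "osc_endpoint a b c l1 l2 3 = c3" "osc_endpoint a b c l1 l2 4 = c4" "osc_endpoint a b c l1 l2 5 = a"
    unfolding e by (simp_all add: eval_nat_numeral)
qed

lemma T_simple_zero:
  assumes "T z = 0" and "(T has_real_derivative 0) (at z)"
  shows False
proof -
  have simple: False if R: "\<And>t. T t = (z - t) * R t" "R field_differentiable (at z)" "R z \<noteq> 0" for R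
  proof -
    obtain R' where R': "(R has_real_derivative R') (at z)"
      using R(2) by (auto simp: field_differentiable_def)
    have "((\<lambda>t. (z - t) * R t) has_real_derivative - R z) (at z)"
      by (auto intro!: derivative_eq_intros R')
    then have "(T has_real_derivative - R z) (at z)" using R(1) by presburger
    then show False using DERIV_unique[OF assms(2)] R(3) by fastforce
  qed
  note d = c_order
  from assms(1) consider "z = c1" | "z = c2" | "z = c3" | "z = c4" | "z = a" by (auto simp: T_zero_iff)
  then show False
  proof cases
    case 1 show ?thesis
      by (rule simple[of "\<lambda>t. (c2 - t) * (c3 - t) * (c4 - t) * (a - t)"])
        (use d 1 in \<open>auto simp: T_def mult_ac intro!: derivative_intros\<close>)
  next
    case 2 show ?thesis
      by (rule simple[of "\<lambda>t. (c1 - t) * (c3 - t) * (c4 - t) * (a - t)"])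
        (use d 2 in \<open>auto simp: T_def mult_ac intro!: derivative_intros\<close>)
  next
    case 3 show ?thesis
      by (rule simple[of "\<lambda>t. (c1 - t) * (c2 - t) * (c4 - t) * (a - t)"])
        (use d 3 in \<open>auto simp: T_def mult_ac intro!: derivative_intros\<close>)
  next
    case 4 show ?thesis
      by (rule simple[of "\<lambda>t. (c1 - t) * (c2 - t) * (c3 - t) * (a - t)"])
        (use d 4 in \<open>auto simp: T_def mult_ac intro!: derivative_intros\<close>)
  next
    case 5 show ?thesis
      by (rule simple[of "\<lambda>t. (c1 - t) * (c2 - t) * (c3 - t) * (c4 - t)"])
        (use d 5 in \<open>auto simp: T_def mult_ac intro!: derivative_intros\<close>)
  qed
qed

text \<open>If all three polynomials vanished at \<open>z\<close>, then \<open>T\<close>, a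
  quadratic expression in them, would have a double zero there.\<close>

lemma T_rank_one:
  assumes "\<And>t. (mix_poly p v t)\<^sup>2 + dir_poly v t * pos_poly p t = T t" and "T z = 0"
  shows "pos_poly p z \<noteq> 0 \<or> mix_poly p v z \<noteq> 0 \<or> dir_poly v z \<noteq> 0"
proof (rule ccontr)
  assume "\<not> ?thesis"
  then have z: "pos_poly p z = 0" "mix_poly p v z = 0" "dir_poly v z = 0" by auto
  have "pos_poly p field_differentiable (at z)" "mix_poly p v field_differentiable (at z)"
    "dir_poly v field_differentiable (at z)"
    unfolding pos_poly_def mix_poly_def dir_poly_def axes_poly_def by (intro derivative_intros)+
  then obtain P' M' D' where D: "(pos_poly p has_real_derivative P') (at z)"
    "(mix_poly p v has_real_derivative M') (at z)" "(dir_poly v has_real_derivative D') (at z)"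
    by (auto simp: field_differentiable_def)
  have "((\<lambda>t. (mix_poly p v t)\<^sup>2 + dir_poly v t * pos_poly p t) has_real_derivative 0) (at z)"
    by (rule derivative_eq_intros D refl)+ (simp add: z)
  then have "(T has_real_derivative 0) (at z)" unfolding assms(1) by simp
  then show False using T_simple_zero assms(2) by blast
qed

end

section \<open>Position of the caustic parameters relative to the axes\<close>

context semi_axes
begin

lemma caustic_poly_coordinate_plane:
  "p $ 1 = 0 \<Longrightarrow> v $ 1 = 0 \<Longrightarrow> caustic_poly p v a = 0"
  "p $ 2 = 0 \<Longrightarrow> v $ 2 = 0 \<Longrightarrow> caustic_poly p v b = 0"
  "p $ 3 = 0 \<Longrightarrow> v $ 3 = 0 \<Longrightarrow> caustic_poly p v c = 0"
  by (simp_all add: caustic_poly_def dir_poly_def)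

text \<open>A line inside a coordinate plane would make \<open>caustic_poly\<close> vanish at the
  corresponding axis parameter. Every other line meets each coordinate plane at most once.\<close>

lemma finite_nongeneric:
  assumes "caustic_poly p v a \<noteq> 0" "caustic_poly p v b \<noteq> 0" "caustic_poly p v c \<noteq> 0"
  shows "finite {s. \<exists>i. (p + s *\<^sub>R v) $ i = 0}"
proof -
  have "finite {s. (p + s *\<^sub>R v) $ i = 0}" for i
  proof -
    have "p $ i \<noteq> 0 \<or> v $ i \<noteq> 0"
      using caustic_poly_coordinate_plane[of p v] assms exhaust_3[of i] by auto
    then have "finite {s. p $ i + v $ i * s + 0 * s\<^sup>2 = 0}"
      by (intro finite_quadratic_roots) auto
    then show ?thesis by (simp add: mult.commute)
  qed
  then show ?thesis by (simp add: Collect_ex_eq)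
qed

lemma nonsingular_billiard:
  assumes "nonsingular_trajectory a b c l1 l2 q"
  obtains u \<tau> \<nu> where "billiard a b c q u \<tau> \<nu>" "\<And>k. norm (u k) = 1"
    "\<And>k t. caustic_poly (q k) (u k) t = (t - l1) * (t - l2)"
proof -
  obtain u \<tau> \<nu> where B: "billiard a b c q u \<tau> \<nu>" and un: "\<And>k. norm (u k) = 1"
    using assms billiard_trajectoryD[of q] unfolding nonsingular_trajectory_def by metis
  interpret billiard a b c q u \<tau> \<nu> by fact
  have l: "l1 < l2" "l1 \<notin> {a, b, c}" "l2 \<notin> {a, b, c}"
    and tl: "tangent_line a b c l1 (q k) (q (k + 1) - q k)" "tangent_line a b c l2 (q k) (q (k + 1) - q k)" for k
    using assms unfolding nonsingular_trajectory_def by auto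
  have d: "q (k + 1) - q k = \<tau> k *\<^sub>R u k" for k using flight[of k] by simp
  have dz: "\<tau> k *\<^sub>R u k \<noteq> 0" for k using \<tau>_pos[of k] un[of k] by auto
  have "caustic_poly (q k) (u k) l1 = 0" "caustic_poly (q k) (u k) l2 = 0" for k
    using tl[of k] \<tau>_pos[of k] unfolding d tangent_line_iff[OF l(2) dz] tangent_line_iff[OF l(3) dz]
    by (simp_all add: caustic_poly_scale)
  then have "caustic_poly (q k) (u k) t = (t - l1) * (t - l2)" for k t
    using caustic_poly_quadratic[of "q k" "u k" l1 l2 t] l(1) un by simp
  then show thesis using that B un by blast
qed

text \<open>At a generic point of a segment the discriminant is a square at each elliptic
  coordinate, and the sign of \<open>axes_poly\<close> there is known. This puts
  \<open>ecoord 1 p\<close> between \<open>l1\<close> and \<open>l2\<close>, and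
  \<open>ecoord 2 p\<close> above \<open>l2\<close>. Positivity of \<open>l1\<close> comes from the
  discriminant at 0, a nonzero square because the segment crosses the ellipsoid
  transversally.\<close>

lemma nonsingular_caustics:
  assumes "nonsingular_trajectory a b c l1 l2 q"
  shows "caustics a b c l1 l2"
proof -
  obtain u \<tau> \<nu> where "billiard a b c q u \<tau> \<nu>" and un: "\<And>k. norm (u k) = 1"
    and K: "\<And>k t. caustic_poly (q k) (u k) t = (t - l1) * (t - l2)"
    using nonsingular_billiard[OF assms] by metis
  then interpret billiard a b c q u \<tau> \<nu> by simp
  have l: "l1 < l2" "l1 \<notin> {a, b, c}" "l2 \<notin> {a, b, c}"
    using assms unfolding nonsingular_trajectory_def by auto
  have "caustic_poly (q 0) (u 0) a \<noteq> 0" "caustic_poly (q 0) (u 0) b \<noteq> 0" "caustic_poly (q 0) (u 0) c \<noteq> 0"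
    using l by (auto simp: K)
  then have "finite {s. \<exists>i. (q 0 + s *\<^sub>R u 0) $ i = 0}" by (rule finite_nongeneric)
  then obtain s where s: "\<forall>i. (q 0 + s *\<^sub>R u 0) $ i \<noteq> 0"
    using ex_new_if_finite[OF infinite_UNIV_char_0] by (metis (mono_tags, lifting) mem_Collect_eq)
  define p where "p = q 0 + s *\<^sub>R u 0"
  note g = generic_ecoord_bounds[OF s, folded p_def]
  have disc: "(mix_poly p (u 0) t)\<^sup>2 + dir_poly (u 0) t * pos_poly p t = axes_poly t * ((t - l1) * (t - l2))" for t
    by (simp add: discriminant_identity p_def caustic_poly_flight K)
  have nn: "axes_poly (ecoord j p) * ((ecoord j p - l1) * (ecoord j p - l2)) \<ge> 0" if "j \<in> {0, 1, 2}" for j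
  proof -
    have "pos_poly p (ecoord j p) = 0" using that by (auto simp: pos_poly_ecoord)
    then have "axes_poly (ecoord j p) * ((ecoord j p - l1) * (ecoord j p - l2)) = (mix_poly p (u 0) (ecoord j p))\<^sup>2"
      using disc[of "ecoord j p"] by simp
    then show ?thesis by simp
  qed
  have "axes_poly (ecoord 1 p) < 0" using g unfolding axes_poly_def by (intro mult_pos_neg mult_pos_pos) auto
  then have "(ecoord 1 p - l1) * (ecoord 1 p - l2) \<le> 0" using nn[of 1] by (simp add: zero_le_mult_iff)
  then have 1: "l1 \<le> ecoord 1 p" "ecoord 1 p \<le> l2" using l(1) by (auto simp: mult_le_0_iff)
  have "(b - ecoord 2 p) * (c - ecoord 2 p) > 0" using g by (intro mult_neg_neg) auto
  then have "axes_poly (ecoord 2 p) > 0" using g unfolding axes_poly_def by (simp add: mult.assoc)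
  then have "(ecoord 2 p - l1) * (ecoord 2 p - l2) \<ge> 0" using nn[of 2] by (simp add: zero_le_mult_iff)
  then have 2: "l2 \<le> ecoord 2 p" using 1 g by (simp add: zero_le_mult_iff)
  have m: "mix_poly (q 0) (u 0) 0 \<noteq> 0"
  proof
    assume "mix_poly (q 0) (u 0) 0 = 0"
    then have "pos_poly (q 0 + \<tau> 0 *\<^sub>R u 0) 0 = - ((\<tau> 0)\<^sup>2 * dir_poly (u 0) 0)"
      by (simp add: pos_poly_line on_ellipsoid)
    then have "dir_poly (u 0) 0 = 0" using on_ellipsoid[of 1] flight[of 0] \<tau>_pos[of 0] by simp
    moreover have "u 0 \<noteq> 0" using un[of 0] by auto
    ultimately show False using dir_poly_0_pos[of "u 0"] by simp
  qed
  have "(mix_poly (q 0) (u 0) 0)\<^sup>2 = a * b * c * (l1 * l2)"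
    using discriminant_identity[of "q 0" "u 0" 0] by (simp add: on_ellipsoid K axes_poly_def)
  then have "a * b * c * (l1 * l2) > 0" using m by (metis zero_less_power2)
  then have "l1 * l2 > 0" by (rule zero_less_mult_pos) (simp add: a0 b0 c0)
  then have "l1 > 0" using 1 g c0 by (simp add: zero_less_mult_iff)
  then show ?thesis
    using 1 2 g l by (unfold_locales) auto
qed

end

section \<open>Elliptic coordinates along a trajectory\<close>

locale nonsingular = billiard a b c q u \<tau> \<nu> + caustics a b c l1 l2
  for a b c q u \<tau> \<nu> l1 l2 +
  assumes unit: "norm (u k) = 1"
    and caustic_poly_eq: "caustic_poly (q k) (u k) t = (t - l1) * (t - l2)"
begin

abbreviation "traj \<equiv> trajectory_path q"

definition \<mu> :: "nat \<Rightarrow> real \<Rightarrow> real" where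
  "\<mu> j s = ecoord j (traj s)"

lemma path_segment:
  assumes "s \<in> {of_int k..of_int k + 1}"
  shows "traj s = q k + ((s - of_int k) * \<tau> k) *\<^sub>R u k"
  using assms trajectory_path_segment[of k s q] flight[of k] by simp

lemma path_same_segment:
  assumes "s \<in> {of_int k..of_int k + 1}" "r \<in> {of_int k..of_int k + 1}"
  shows "traj r = traj s + ((r - s) * \<tau> k) *\<^sub>R u k"
  unfolding assms(1,2)[THEN path_segment] by (simp add: algebra_simps flip: scaleR_add_left)

lemma path_discriminant:
  assumes "s \<in> {of_int k..of_int k + 1}"
  shows "(mix_poly (traj s) (u k) t)\<^sup>2 + dir_poly (u k) t * pos_poly (traj s) t = T t"
  unfolding discriminant_identity path_segment[OF assms] caustic_poly_flight caustic_poly_eq T_eq ..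

lemma pos_poly_\<mu>: "pos_poly (traj s) t = (\<mu> 0 s - t) * (\<mu> 1 s - t) * (\<mu> 2 s - t)"
  unfolding \<mu>_def by (rule pos_poly_ecoord)

lemma pos_poly_\<mu>_zero: "j \<in> {0, 1, 2} \<Longrightarrow> pos_poly (traj s) (\<mu> j s) = 0"
  unfolding pos_poly_\<mu> by auto

lemma mix_poly_\<mu>:
  assumes "s \<in> {of_int k..of_int k + 1}" "j \<in> {0, 1, 2}"
  shows "(mix_poly (traj s) (u k) (\<mu> j s))\<^sup>2 = T (\<mu> j s)"
  using path_discriminant[OF assms(1), of "\<mu> j s"] pos_poly_\<mu>_zero[OF assms(2)] by simp

lemma continuous_on_\<mu>: "j \<le> 2 \<Longrightarrow> continuous_on S (\<mu> j)"
  unfolding \<mu>_def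
  by (intro continuous_on_compose2[OF continuous_on_ecoord continuous_on_trajectory_path]) auto

lemma in_segment: "s \<in> {of_int \<lfloor>s\<rfloor>..of_int \<lfloor>s\<rfloor> + 1 :: real}"
  by (simp add: less_imp_le)

lemma finite_nongeneric_segment:
  "finite {s \<in> {of_int k..of_int k + 1}. \<exists>i. traj s $ i = 0}"
proof -
  have "caustic_poly (q k) (u k) a \<noteq> 0" "caustic_poly (q k) (u k) b \<noteq> 0" "caustic_poly (q k) (u k) c \<noteq> 0"
    using l2_a l1_l2 l1_b l2_b l1_c c_l2 unfolding caustic_poly_eq by auto
  then have f: "finite {s. \<exists>i. (q k + s *\<^sub>R u k) $ i = 0}" by (rule finite_nongeneric)
  have "inj (\<lambda>s. (s - of_int k) * \<tau> k)" using \<tau>_pos[of k] by (auto simp: inj_def)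
  then have "finite ((\<lambda>s. (s - of_int k) * \<tau> k) -` {s. \<exists>i. (q k + s *\<^sub>R u k) $ i = 0})"
    using f by (intro finite_vimageI)
  then show ?thesis
    by (rule finite_subset[rotated]) (auto simp: path_segment)
qed

text \<open>\<open>T\<close> is a square at each elliptic coordinate but negative in the gaps
  between the bands. Strict inequalities with the axes at generic points choose the band; continuity
  later extends the bounds to all points.\<close>

lemma \<mu>_generic_bands:
  assumes "\<forall>i. traj s $ i \<noteq> 0"
  shows "\<mu> 0 s \<le> c1" "c2 \<le> \<mu> 1 s" "\<mu> 1 s \<le> c3" "c4 \<le> \<mu> 2 s"
proof -
  note g = generic_ecoord_bounds[OF assms, folded \<mu>_def]
  have nn: "T (\<mu> j s) \<ge> 0" if "j \<in> {0, 1, 2}" for j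
    using mix_poly_\<mu>[OF in_segment that] by (metis zero_le_power2)
  have neg: "T t < 0" if "c1 < t \<and> t < c2 \<or> c3 < t \<and> t < c4" for t
  proof -
    have "(c1 - t) * (c2 - t) * ((c3 - t) * (c4 - t)) < 0"
      using that
    proof
      assume "c1 < t \<and> t < c2"
      then show ?thesis using c_order by (intro mult_neg_pos mult_pos_pos) auto
    next
      assume "c3 < t \<and> t < c4"
      then show ?thesis using c_order by (intro mult_pos_neg mult_neg_neg mult_neg_pos) auto
    qed
    moreover have "a - t > 0" using that c_order by auto
    ultimately have "(c1 - t) * (c2 - t) * ((c3 - t) * (c4 - t)) * (a - t) < 0" by (rule mult_neg_pos)
    then show ?thesis by (simp add: T_def mult.assoc)
  qed
  show "\<mu> 0 s \<le> c1" using nn[of 0] neg[of "\<mu> 0 s"] g c_order by force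
  show "c2 \<le> \<mu> 1 s" using nn[of 1] neg[of "\<mu> 1 s"] g c_order by force
  show "\<mu> 1 s \<le> c3" using nn[of 1] neg[of "\<mu> 1 s"] g c_order by force
  show "c4 \<le> \<mu> 2 s" using nn[of 2] neg[of "\<mu> 2 s"] g c_order by force
qed

lemma \<mu>_bands: "\<mu> 0 s \<le> c1" "c2 \<le> \<mu> 1 s" "\<mu> 1 s \<le> c3" "c4 \<le> \<mu> 2 s" "\<mu> 2 s \<le> a"
proof -
  let ?k = "\<lfloor>s\<rfloor>"
  note le = continuous_le_off_finite[OF _ finite_nongeneric_segment _ _ in_segment]
  show "\<mu> 0 s \<le> c1"
    by (rule le) (auto intro: continuous_on_\<mu> \<mu>_generic_bands)
  show "\<mu> 1 s \<le> c3"
    by (rule le) (auto intro: continuous_on_\<mu> \<mu>_generic_bands simp del: One_nat_def)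
  have "- \<mu> 1 s \<le> - c2"
    by (rule le[where f = "\<lambda>s. - \<mu> 1 s"])
      (auto intro!: continuous_on_minus continuous_on_\<mu> intro: \<mu>_generic_bands simp del: One_nat_def)
  then show "c2 \<le> \<mu> 1 s" by simp
  have "- \<mu> 2 s \<le> - c4"
    by (rule le[where f = "\<lambda>s. - \<mu> 2 s"])
      (auto intro!: continuous_on_minus continuous_on_\<mu> intro: \<mu>_generic_bands)
  then show "c4 \<le> \<mu> 2 s" by simp
  show "\<mu> 2 s \<le> a" unfolding \<mu>_def by (rule ecoord_bounds)
qed

lemma \<mu>_order: "\<mu> 0 s < \<mu> 1 s" "\<mu> 1 s < \<mu> 2 s"
  using \<mu>_bands[of s] c_order by linarith+

lemma pos_poly_path_0:
  assumes "s \<in> {of_int k..of_int k + 1}"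
  shows "pos_poly (traj s) 0 = (s - of_int k) * (of_int k + 1 - s) * ((\<tau> k)\<^sup>2 * dir_poly (u k) 0)"
proof -
  have "pos_poly (q k + \<tau> k *\<^sub>R u k) 0 = 0" using on_ellipsoid[of "k + 1"] flight[of k] by simp
  then have "- 2 * \<tau> k * mix_poly (q k) (u k) 0 = (\<tau> k)\<^sup>2 * dir_poly (u k) 0"
    by (simp add: pos_poly_line on_ellipsoid)
  then show ?thesis unfolding path_segment[OF assms] pos_poly_line on_ellipsoid by algebra
qed

lemma u_nz: "u k \<noteq> 0"
  using unit[of k] by auto

lemma \<mu>0_nonneg: "0 \<le> \<mu> 0 s"
proof -
  have "pos_poly (traj s) 0 \<ge> 0"
    using in_segment[of s] dir_poly_0_pos[OF u_nz[of "\<lfloor>s\<rfloor>"]] unfolding pos_poly_path_0[OF in_segment]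
    by (intro mult_nonneg_nonneg) auto
  then show ?thesis using ecoord_cmp(2)[of 0 "traj s"] c0 unfolding \<mu>_def by force
qed

lemma \<mu>0_pos:
  assumes "s \<notin> \<int>" shows "0 < \<mu> 0 s"
proof -
  have "s - of_int \<lfloor>s\<rfloor> > 0" "of_int \<lfloor>s\<rfloor> + 1 - s > 0"
    using assms frac_gt_0_iff[of s] by (auto simp: frac_def)
  then have "pos_poly (traj s) 0 > 0"
    using dir_poly_0_pos[OF u_nz[of "\<lfloor>s\<rfloor>"]] \<tau>_pos[of "\<lfloor>s\<rfloor>"] unfolding pos_poly_path_0[OF in_segment] by simp
  then show ?thesis using ecoord_cmp(1)[of 0 "traj s"] c0 unfolding \<mu>_def by simp
qed

lemma path_vertex: "traj (of_int k) = q k"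
  by (rule trajectory_path_vertex)

lemma \<mu>0_vertex: "\<mu> 0 (of_int k) = 0"
proof -
  have "\<mu> 1 (of_int k) > 0" "\<mu> 2 (of_int k) > 0" using \<mu>_bands[of "of_int k"] c_order by linarith+
  then show ?thesis using pos_poly_\<mu>[of "of_int k" 0] on_ellipsoid[of k] by (simp add: path_vertex)
qed

text \<open>Minus the derivative of the cubic \<open>pos_poly\<close> at its root.\<close>

definition den :: "nat \<Rightarrow> real \<Rightarrow> real" where
  "den j s = (\<Prod>i\<in>{0, 1, 2} - {j}. \<mu> i s - \<mu> j s)"

lemma den_eq:
  "den 0 s = (\<mu> 1 s - \<mu> 0 s) * (\<mu> 2 s - \<mu> 0 s)"
  "den 1 s = (\<mu> 0 s - \<mu> 1 s) * (\<mu> 2 s - \<mu> 1 s)"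
  "den 2 s = (\<mu> 0 s - \<mu> 2 s) * (\<mu> 1 s - \<mu> 2 s)"
proof -
  have "{0, 1, 2} - {0} = {1, 2 :: nat}" "{0, 1, 2} - {1} = {0, 2 :: nat}" "{0, 1, 2} - {2} = {0, 1 :: nat}"
    by auto
  then show "den 0 s = (\<mu> 1 s - \<mu> 0 s) * (\<mu> 2 s - \<mu> 0 s)"
    "den 1 s = (\<mu> 0 s - \<mu> 1 s) * (\<mu> 2 s - \<mu> 1 s)"
    "den 2 s = (\<mu> 0 s - \<mu> 2 s) * (\<mu> 1 s - \<mu> 2 s)"
    unfolding den_def by simp_all
qed

lemma den_sign: "den 0 s > 0" "den 1 s < 0" "den 2 s > 0"
  using \<mu>_order[of s] unfolding den_eq
  by (auto intro: mult_pos_pos mult_neg_pos mult_neg_neg)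

lemma den_nz: "j \<in> {0, 1, 2} \<Longrightarrow> den j s \<noteq> 0"
  using den_sign[of s] by auto

text \<open>Since \<open>mix_poly\<close> squares to \<open>T\<close> at an elliptic coordinate,
  this is Jacobi's equation of motion with the sign of the square root resolved by the velocity. At
  a bounce it is one-sided, since the velocity jumps.\<close>

lemma \<mu>_deriv:
  assumes s: "s \<in> {of_int k..of_int k + 1}" and j: "j \<in> {0, 1, 2}"
  shows "(\<mu> j has_real_derivative - 2 * (\<tau> k * mix_poly (traj s) (u k) (\<mu> j s)) / den j s)
    (at s within {of_int k..of_int k + 1})"
proof -
  let ?S = "{of_int k..of_int k + 1 :: real}"
  let ?\<beta> = "\<lambda>t. \<tau> k * mix_poly (traj s) (u k) t" and ?\<alpha> = "\<lambda>t. (\<tau> k)\<^sup>2 * dir_poly (u k) t"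
  have eq: "(\<mu> 0 y - t) * (\<mu> 1 y - t) * (\<mu> 2 y - t) =
    (\<mu> 0 s - t) * (\<mu> 1 s - t) * (\<mu> 2 s - t) - 2 * (y - s) * ?\<beta> t - (y - s)\<^sup>2 * ?\<alpha> t"
    if "y \<in> ?S" for y t
    unfolding pos_poly_\<mu>[symmetric] path_same_segment[OF s that] pos_poly_line by algebra
  have cont: "isCont ?\<beta> t" "isCont ?\<alpha> t" for t
    unfolding mix_poly_def dir_poly_def by (intro continuous_intros)+
  have c: "continuous (at s within ?S) (\<mu> j)"
    using continuous_on_\<mu>[of j ?S] s j by (auto simp: continuous_on_eq_continuous_within)
  from j consider "j = 0" | "j = 1" | "j = 2" by auto
  then show ?thesis
  proof cases
    case 1
    show ?thesis unfolding 1 den_eq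
      by (rule simple_root_has_derivative[OF c[unfolded 1], where \<alpha> = ?\<alpha>])
        (use eq \<mu>_order[of s] cont in auto)
  next
    case 2
    show ?thesis unfolding 2 den_eq
      by (rule simple_root_has_derivative[OF c[unfolded 2], where \<alpha> = ?\<alpha>])
        (use eq \<mu>_order[of s] cont in \<open>auto simp: mult_ac simp del: One_nat_def\<close>)
  next
    case 3
    show ?thesis unfolding 3 den_eq
      by (rule simple_root_has_derivative[OF c[unfolded 3], where \<alpha> = ?\<alpha>])
        (use eq \<mu>_order[of s] cont in \<open>auto simp: mult_ac simp del: One_nat_def\<close>)
  qed
qed

lemma rank_one_vertex:
  assumes "T z = 0"
  shows "pos_poly (q k) z \<noteq> 0 \<or> mix_poly (q k) (u k) z \<noteq> 0 \<or> dir_poly (u k) z \<noteq> 0"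
  by (rule T_rank_one[OF _ assms]) (simp add: discriminant_identity caustic_poly_eq T_eq)

lemma finite_edges: "finite {s \<in> {of_int k..of_int k + 1}. \<exists>j\<in>{0, 1, 2}. T (\<mu> j s) = 0}"
proof -
  have f: "finite {s \<in> {of_int k..of_int k + 1}. pos_poly (traj s) z = 0}" if "T z = 0" for z
  proof -
    have "finite {r. pos_poly (q k) z + (- 2 * mix_poly (q k) (u k) z) * r + (- dir_poly (u k) z) * r\<^sup>2 = 0}"
      using rank_one_vertex[OF that, of k] by (intro finite_quadratic_roots) auto
    moreover have "inj (\<lambda>s. (s - of_int k) * \<tau> k)" using \<tau>_pos[of k] by (auto simp: inj_def)
    ultimately have "finite ((\<lambda>s. (s - of_int k) * \<tau> k) -`
        {r. pos_poly (q k) z + (- 2 * mix_poly (q k) (u k) z) * r + (- dir_poly (u k) z) * r\<^sup>2 = 0})"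
      by (intro finite_vimageI)
    moreover have "pos_poly (q k + r *\<^sub>R u k) z = pos_poly (q k) z
        + (- 2 * mix_poly (q k) (u k) z) * r + (- dir_poly (u k) z) * r\<^sup>2" for r
      unfolding pos_poly_line by algebra
    ultimately have fin: "finite ((\<lambda>s. (s - of_int k) * \<tau> k) -` {r. pos_poly (q k + r *\<^sub>R u k) z = 0})"
      by presburger
    show ?thesis
      by (rule finite_subset[OF _ fin]) (auto simp: path_segment)
  qed
  have "{s \<in> {of_int k..of_int k + 1}. \<exists>j\<in>{0, 1, 2}. T (\<mu> j s) = 0}
      \<subseteq> (\<Union>z\<in>{c1, c2, c3, c4, a}. {s \<in> {of_int k..of_int k + 1}. pos_poly (traj s) z = 0})"
  proof
    fix s assume "s \<in> {s \<in> {of_int k..of_int k + 1}. \<exists>j\<in>{0, 1, 2}. T (\<mu> j s) = 0}"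
    then obtain j where j: "j \<in> {0, 1, 2}" "T (\<mu> j s) = 0" "s \<in> {of_int k..of_int k + 1}" by blast
    have "\<mu> j s \<in> {c1, c2, c3, c4, a}" using j(2) unfolding T_zero_iff .
    then show "s \<in> (\<Union>z\<in>{c1, c2, c3, c4, a}. {s \<in> {of_int k..of_int k + 1}. pos_poly (traj s) z = 0})"
      using j(3) pos_poly_\<mu>_zero[OF j(1), of s] by blast
  qed
  moreover have "finite \<dots>" by (intro finite_UN_I f) (auto simp: T_zero_iff)
  ultimately show ?thesis by (rule finite_subset)
qed

text \<open>At a bounce the two one-sided derivatives may differ in size but not in sign: a kick
  changes \<open>mix_poly\<close> by a multiple of \<open>pos_poly\<close>, which vanishes at the
  coordinate.\<close>

lemma \<mu>_transversal:
  assumes j: "j \<in> {0, 1, 2}" and s: "T (\<mu> j s) \<noteq> 0" "\<mu> j s \<noteq> 0"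
  obtains \<sigma> \<epsilon> where "\<sigma> \<noteq> (0 :: real)" "\<epsilon> > 0"
    "\<And>y. \<bar>y - s\<bar> < \<epsilon> \<Longrightarrow> y \<noteq> s \<Longrightarrow> \<sigma> * ((\<mu> j y - \<mu> j s) * (y - s)) > 0"
proof -
  define D where "D k = - 2 * (\<tau> k * mix_poly (traj s) (u k) (\<mu> j s)) / den j s" for k
  have D_nz: "D k \<noteq> 0" if "s \<in> {of_int k..of_int k + 1}" for k
    using mix_poly_\<mu>[OF that j] s \<tau>_pos[of k] den_nz[OF j] by (auto simp: D_def)
  have two: "D k * D k' > 0" if "k' = k \<or> k' = k - 1 \<and> s = of_int k" "s \<in> {of_int k..of_int k + 1}" for k k'
  proof (cases "k' = k")
    case True
    then show ?thesis using D_nz[OF that(2)] by (auto simp: zero_less_mult_iff linorder_neq_iff)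
  next
    case False
    then have k': "k' = k - 1" "s = of_int k" using that by auto
    have "pos_poly (q k) (\<mu> j s) = 0" using pos_poly_\<mu>_zero[OF j, of s] k' by (simp add: path_vertex)
    then have "mix_poly (traj s) (u k) (\<mu> j s) = mix_poly (traj s) (u k') (\<mu> j s)"
      using reflection_step(1)[OF on_ellipsoid reflection_angle reflection s(2)] k' by (simp add: path_vertex)
    then have "D k' = D k / \<tau> k * \<tau> k'" using \<tau>_pos[of k] by (simp add: D_def)
    then have "D k * D k' = (D k)\<^sup>2 * (\<tau> k' / \<tau> k)" by (simp add: power2_eq_square)
    then show ?thesis using D_nz[OF that(2)] \<tau>_pos[of k] \<tau>_pos[of k'] by simp
  qed
  define k where "k = \<lfloor>s\<rfloor>"
  define k' where "k' = (if s = of_int k then k - 1 else k)"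
  have sk: "s \<in> {of_int k..of_int k + 1}" "s < of_int k + 1" unfolding k_def using in_segment by auto
  have sk': "s \<in> {of_int k'..of_int k' + 1}" "of_int k' < s" unfolding k'_def using sk by auto
  have same: "D k * D k' > 0" using two[of k' k] sk by (auto simp: k'_def)
  define \<sigma> where "\<sigma> = sgn (D k)"
  have \<sigma>: "\<sigma> * D k > 0" "\<sigma> * D k' > 0" "\<sigma> \<noteq> 0"
    using same unfolding \<sigma>_def by (auto simp: sgn_if zero_less_mult_iff split: if_splits)
  let ?f = "\<lambda>y. \<sigma> * \<mu> j y"
  have d: "(?f has_real_derivative \<sigma> * D k) (at s within {of_int k..of_int k + 1})"
    "(?f has_real_derivative \<sigma> * D k') (at s within {of_int k'..of_int k' + 1})"
    unfolding D_def by (intro DERIV_cmult \<mu>_deriv sk sk' j)+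
  obtain e1 where e1: "e1 > 0" "\<And>h. h > 0 \<Longrightarrow> s + h \<in> {of_int k..of_int k + 1} \<Longrightarrow> h < e1 \<Longrightarrow> ?f s < ?f (s + h)"
    using has_real_derivative_pos_inc_right[OF d(1) \<sigma>(1)] by blast
  obtain e2 where e2: "e2 > 0" "\<And>h. h > 0 \<Longrightarrow> s - h \<in> {of_int k'..of_int k' + 1} \<Longrightarrow> h < e2 \<Longrightarrow> ?f s > ?f (s - h)"
    using has_real_derivative_pos_inc_left[OF d(2) \<sigma>(2)] by blast
  define \<epsilon> where "\<epsilon> = min (min e1 e2) (min (of_int k + 1 - s) (s - of_int k'))"
  show thesis
  proof (rule that[of \<sigma> \<epsilon>])
    show "\<sigma> \<noteq> 0" by fact
    show "\<epsilon> > 0" using e1 e2 sk sk' by (simp add: \<epsilon>_def)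
    fix y assume y: "\<bar>y - s\<bar> < \<epsilon>" "y \<noteq> s"
    show "\<sigma> * ((\<mu> j y - \<mu> j s) * (y - s)) > 0"
    proof (cases "y > s")
      case True
      then have "?f s < ?f y" using e1(2)[of "y - s"] y sk by (auto simp: \<epsilon>_def)
      then have "(?f y - ?f s) * (y - s) > 0" using True by simp
      then show ?thesis by (simp add: algebra_simps)
    next
      case False
      then have "?f y < ?f s" using e2(2)[of "s - y"] y sk' by (auto simp: \<epsilon>_def)
      then have "(?f y - ?f s) * (y - s) > 0" using False y by (intro mult_neg_neg) auto
      then show ?thesis by (simp add: algebra_simps)
    qed
  qed
qed

end

section \<open>Integrals over oscillations\<close>

text \<open>The substitution z = m + r sin \<phi> absorbs the inverse square roots at both ends, so
  the antiderivative extends continuously to the turning values.\<close>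

lemma ex_arcsine_antiderivative:
  fixes k :: "real \<Rightarrow> real"
  assumes "lo < hi" "continuous_on {lo..hi} k"
  obtains H where "continuous_on {lo..hi} H"
    "\<And>z. lo < z \<Longrightarrow> z < hi \<Longrightarrow> (H has_real_derivative k z / sqrt ((z - lo) * (hi - z))) (at z)"
proof -
  define m r where "m = (lo + hi) / 2" and "r = (hi - lo) / 2"
  have r: "r > 0" using assms(1) by (simp add: r_def)
  have lohi: "lo = m - r" "hi = m + r" by (simp_all add: m_def r_def field_simps)
  have rng: "m + r * sin \<phi> \<in> {lo..hi}" for \<phi>
  proof -
    have "\<bar>r * sin \<phi>\<bar> \<le> r * 1" unfolding abs_mult using r by (intro mult_mono) auto
    then show ?thesis by (auto simp: lohi abs_le_iff)
  qed
  have "continuous_on {-pi/2..pi/2} (\<lambda>\<phi>. k (m + r * sin \<phi>))"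
    by (intro continuous_on_compose2[OF assms(2)] continuous_intros) (use rng in auto)
  then obtain G where G: "\<And>\<phi>. \<phi> \<in> {-pi/2..pi/2} \<Longrightarrow>
      (G has_vector_derivative k (m + r * sin \<phi>)) (at \<phi> within {-pi/2..pi/2})"
    using antiderivative_continuous by blast
  define A where "A z = arcsin ((z - m) / r)" for z
  have zr: "z \<in> {lo..hi} \<longleftrightarrow> (z - m) / r \<in> {-1..1}" for z
    using r by (auto simp: lohi field_simps)
  have Ab: "A z \<in> {-pi/2..pi/2}" if "z \<in> {lo..hi}" for z
    using that arcsin_bounded[of "(z - m) / r"] unfolding zr A_def by auto
  have contG: "continuous_on {-pi/2..pi/2} G"
    using G by (rule continuous_on_vector_derivative)
  have contA: "continuous_on {lo..hi} A"
    unfolding A_def using r zr by (intro continuous_intros) auto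
  show thesis
  proof (rule that[of "\<lambda>z. G (A z)"])
    show "continuous_on {lo..hi} (\<lambda>z. G (A z))"
      by (rule continuous_on_compose2[OF contG contA]) (use Ab in auto)
    fix z assume z: "lo < z" "z < hi"
    define y where "y = (z - m) / r"
    have y: "-1 < y" "y < 1" using z r by (auto simp: y_def lohi field_simps)
    have sA: "m + r * sin (A z) = z" using y r unfolding A_def y_def[symmetric] by (simp add: y_def)
    have Ai: "-pi/2 < A z" "A z < pi/2"
      using y arcsin_lt_bounded[of y] unfolding A_def y_def[symmetric] by auto
    then have "(G has_real_derivative k z) (at (A z))"
      using G[of "A z"] sA at_within_Icc_at[OF Ai] by (simp add: has_real_derivative_iff_has_vector_derivative)
    moreover have "(A has_real_derivative inverse (sqrt (1 - y\<^sup>2)) * (1 / r)) (at z)"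
      unfolding A_def
    proof (rule DERIV_chain2[where f = arcsin])
      show "(arcsin has_real_derivative inverse (sqrt (1 - y\<^sup>2))) (at ((z - m) / r))"
        using DERIV_arcsin[OF y] by (simp add: y_def)
      show "((\<lambda>z. (z - m) / r) has_real_derivative 1 / r) (at z)"
        using r by (auto intro!: derivative_eq_intros)
    qed
    ultimately have "((\<lambda>z. G (A z)) has_real_derivative k z * (inverse (sqrt (1 - y\<^sup>2)) * (1 / r))) (at z)"
      by (rule DERIV_chain2)
    moreover have "sqrt ((z - lo) * (hi - z)) = r * sqrt (1 - y\<^sup>2)"
    proof -
      have zy: "z = m + r * y" using r by (simp add: y_def)
      have "(z - lo) * (hi - z) = r\<^sup>2 * (1 - y\<^sup>2)" unfolding lohi zy by algebra
      then show ?thesis using r by (simp add: real_sqrt_mult)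
    qed
    ultimately show "((\<lambda>z. G (A z)) has_real_derivative k z / sqrt ((z - lo) * (hi - z))) (at z)"
      by (simp add: field_simps)
  qed
qed

text \<open>Meant for an elliptic coordinate \<open>f\<close>, with \<open>H i\<close> an
  antiderivative of z^i / (2 sqrt T) on its band and \<open>w\<close> the weight that turns time
  integrals over monotone pieces into differences of \<open>H i\<close>. Every complete oscillation
  then contributes the same constant \<open>P i\<close>.\<close>

locale oscillation =
  fixes f w :: "real \<Rightarrow> real" and H :: "nat \<Rightarrow> real \<Rightarrow> real" and lo hi N :: real and n :: nat
  assumes continuous: "continuous_on UNIV f" and range: "lo \<le> f s" "f s \<le> hi"
    and rise: "x \<le> y \<Longrightarrow> mono_on {x..y} f \<Longrightarrow> ((\<lambda>s. w s * f s ^ i) has_integral H i (f y) - H i (f x)) {x..y}"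
    and fall: "x \<le> y \<Longrightarrow> antimono_on {x..y} f \<Longrightarrow> ((\<lambda>s. w s * f s ^ i) has_integral H i (f x) - H i (f y)) {x..y}"
    and period: "0 < N" "f (s + N) = f s"
    and oscillations: "complete_oscillations f lo hi N n"
begin

definition P :: "nat \<Rightarrow> real" where "P i = 2 * (H i hi - H i lo)"

lemma n_pos: "0 < n"
proof (rule ccontr)
  assume "\<not> 0 < n"
  then show False using oscillations period(1) unfolding complete_oscillations_def by auto
qed

lemma period_int: "f (x + N * of_int k) = f x"
proof (induction k arbitrary: x rule: int_induct[where k = 0])
  case (step1 i)
  show ?case using step1(2)[of x] period(2)[of "x + N * of_int i"] by (simp add: algebra_simps)
next
  case (step2 i)
  show ?case using step2(2)[of x] period(2)[of "x + N * of_int (i - 1)"] by (simp add: algebra_simps)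
qed simp

definition turning :: "(int \<Rightarrow> real) \<Rightarrow> (int \<Rightarrow> real) \<Rightarrow> bool" where
  "turning s t \<longleftrightarrow> (\<forall>i. s i < t i \<and> t i < s (i + 1) \<and> f (s i) = lo \<and> f (t i) = hi \<and>
     mono_on {s i..t i} f \<and> antimono_on {t i..s (i + 1)} f)"

lemma turningD:
  assumes "turning s t"
  shows "s i < t i" "t i < s (i + 1)" "f (s i) = lo" "f (t i) = hi"
    "mono_on {s i..t i} f" "antimono_on {t i..s (i + 1)} f"
  using assms by (auto simp: turning_def)

text \<open>\<open>complete_oscillations\<close> lists turning times for one period only. Quotient
  and remainder modulo \<open>n\<close> extend the list to all integers, so that every time lies in
  some oscillation.\<close>

lemma turning_times:
  obtains s t where "turning s t" "\<forall>i. s (i + int n) = s i + N \<and> t (i + int n) = t i + N"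
    "\<forall>k. s (int n * k) = s 0 + N * of_int k"
proof -
  obtain S T where e: "S n = S 0 + N" and
    o: "\<And>i. i < n \<Longrightarrow> S i < T i \<and> T i < S (Suc i) \<and> f (S i) = lo \<and> f (T i) = hi \<and> f (S (Suc i)) = lo
      \<and> mono_on {S i..T i} f \<and> antimono_on {T i..S (Suc i)} f"
    using oscillations unfolding complete_oscillations_def by blast
  define r where "r i = nat (i mod int n)" for i
  define s t where "s i = S (r i) + N * of_int (i div int n)" and "t i = T (r i) + N * of_int (i div int n)" for i
  have r: "r i < n" for i using n_pos by (simp add: r_def nat_less_iff)
  have s1: "s (i + 1) = S (Suc (r i)) + N * of_int (i div int n)" for i
  proof (cases "Suc (r i) < n")
    case True
    have "i + 1 = int (Suc (r i)) + int n * (i div int n)"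
      using n_pos by (simp add: r_def algebra_simps)
    then have "(i + 1) mod int n = int (Suc (r i))" "(i + 1) div int n = i div int n"
      using True n_pos by (metis int_mod_pos_eq of_nat_0_le_iff of_nat_less_iff add.commute mult.commute)
        (metis True \<open>i + 1 = int (Suc (r i)) + int n * (i div int n)\<close> int_div_pos_eq of_nat_0_le_iff of_nat_less_iff add.commute mult.commute)
    then have "r (i + 1) = Suc (r i)" by (simp only: r_def nat_int)
    then show ?thesis using \<open>(i + 1) div int n = i div int n\<close> by (simp add: s_def)
  next
    case False
    then have "Suc (r i) = n" using r[of i] by simp
    moreover have "int (r i) = i mod int n" using n_pos by (simp add: r_def)
    ultimately have "i mod int n + 1 = int n" by linarith
    then have i: "i + 1 = int n * (i div int n + 1)"
      using mult_div_mod_eq[of "int n" i] by (simp only: distrib_left)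
    have "(i + 1) mod int n = 0" "(i + 1) div int n = i div int n + 1"
      using n_pos unfolding i by simp_all
    then show ?thesis using e \<open>Suc (r i) = n\<close> by (simp add: s_def r_def algebra_simps)
  qed
  have sh: "x \<in> {u + N * of_int k..v + N * of_int k} \<longleftrightarrow> x - N * of_int k \<in> {u..v}" for x u v k by auto
  have per: "f x = f (x - N * of_int k)" for x k using period_int[of "x - N * of_int k" k] by simp
  have turn: "s i < t i \<and> t i < s (i + 1) \<and> f (s i) = lo \<and> f (t i) = hi \<and>
     mono_on {s i..t i} f \<and> antimono_on {t i..s (i + 1)} f" for i
  proof (intro conjI)
    note oi = o[OF r[of i]]
    show "s i < t i" "t i < s (i + 1)" using oi unfolding s1 unfolding s_def t_def by auto
    show "f (s i) = lo" "f (t i) = hi" using oi by (auto simp: s_def t_def period_int)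
    show "mono_on {s i..t i} f"
    proof (rule mono_onI)
      fix x y assume xy: "x \<in> {s i..t i}" "y \<in> {s i..t i}" "x \<le> y"
      then have "f (x - N * of_int (i div int n)) \<le> f (y - N * of_int (i div int n))"
        using oi unfolding s_def t_def sh by (auto intro: mono_onD)
      then show "f x \<le> f y" using per by metis
    qed
    show "antimono_on {t i..s (i + 1)} f"
    proof (rule monotone_onI)
      fix x y assume xy: "x \<in> {t i..s (i + 1)}" "y \<in> {t i..s (i + 1)}" "x \<le> y"
      then have "f (y - N * of_int (i div int n)) \<le> f (x - N * of_int (i div int n))"
        using oi unfolding s1 unfolding t_def sh by (auto intro: monotone_onD)
      then show "f y \<le> f x" using per by metis
    qed
  qed
  show thesis
  proof (rule that[of s t])
    show "turning s t" unfolding turning_def using turn by blast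
    show "\<forall>i. s (i + int n) = s i + N \<and> t (i + int n) = t i + N"
      using n_pos by (simp add: s_def t_def r_def algebra_simps)
    show "\<forall>k. s (int n * k) = s 0 + N * of_int k"
      using n_pos by (simp add: s_def r_def)
  qed
qed

context
  fixes s t :: "int \<Rightarrow> real"
  assumes turning: "turning s t"
begin

lemmas st = turningD[OF turning]

lemma has_integral_oscillations:
  "s i \<le> s (i + int m) \<and> ((\<lambda>s. w s * f s ^ e) has_integral of_nat m * P e) {s i..s (i + int m)}"
proof (induction m)
  case 0
  show ?case by (simp add: has_integral_refl)
next
  case (Suc m)
  let ?j = "i + int m"
  note le = less_imp_le[OF st(1)[of ?j]] less_imp_le[OF st(2)[of ?j]]
  have up: "((\<lambda>s. w s * f s ^ e) has_integral (H e hi - H e lo)) {s ?j..t ?j}"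
    using rise[OF le(1) st(5)] by (simp add: st)
  have down: "((\<lambda>s. w s * f s ^ e) has_integral (H e hi - H e lo)) {t ?j..s (?j + 1)}"
    using fall[OF le(2) st(6)] by (simp add: st)
  have "((\<lambda>s. w s * f s ^ e) has_integral of_nat m * P e + ((H e hi - H e lo) + (H e hi - H e lo))) {s i..s (?j + 1)}"
    by (rule has_integral_combine[OF _ _ conjunct2[OF Suc] has_integral_combine[OF le up down]])
      (use Suc le in auto)
  then show ?case using Suc le by (simp add: P_def algebra_simps)
qed

text \<open>The part of the first oscillation that precedes \<open>x\<close> is made up for by the
  part of the last one that precedes \<open>y\<close>, so the integral does not depend on the
  phase.\<close>

lemma has_integral_same_phase:
  assumes "1 \<le> m" "f x = f y"
    and "x \<in> {s i..t i} \<and> y \<in> {s (i + int m)..t (i + int m)} \<or>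
         x \<in> {t i..s (i + 1)} \<and> y \<in> {t (i + int m)..s (i + int m + 1)}"
  shows "x \<le> y \<and> ((\<lambda>s. w s * f s ^ e) has_integral of_nat m * P e) {x..y}"
proof -
  let ?F = "\<lambda>s. w s * f s ^ e" and ?j = "i + int m"
  have im: "i + 1 + int (m - 1) = ?j" using assms(1) by simp
  have mid: "s (i + 1) \<le> s ?j" "(?F has_integral of_nat (m - 1) * P e) {s (i + 1)..s ?j}"
    using has_integral_oscillations[of "i + 1" "m - 1" e] unfolding im by auto
  have mP: "of_nat m * P e = of_nat (m - 1) * P e + 2 * H e hi - 2 * H e lo"
    using assms(1) by (simp add: P_def of_nat_diff algebra_simps)
  have up: "(?F has_integral H e (f y') - H e (f x')) {x'..y'}"
    if "s k \<le> x'" "x' \<le> y'" "y' \<le> t k" for x' y' k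
    by (rule rise[OF that(2) mono_on_subset[OF st(5)[of k]]]) (use that in auto)
  have down: "(?F has_integral H e (f x') - H e (f y')) {x'..y'}"
    if "t k \<le> x'" "x' \<le> y'" "y' \<le> s (k + 1)" for x' y' k
    by (rule fall[OF that(2) monotone_on_subset[OF st(6)[of k]]]) (use that in auto)
  from assms(3) show ?thesis
  proof
    assume xy: "x \<in> {s i..t i} \<and> y \<in> {s ?j..t ?j}"
    have 1: "(?F has_integral H e hi - H e (f x)) {x..t i}"
      using up[of i x "t i"] xy by (simp add: st)
    have 2: "(?F has_integral H e hi - H e lo) {t i..s (i + 1)}"
      using down[of i "t i" "s (i + 1)"] st(2)[of i] by (simp add: st)
    have 3: "(?F has_integral H e (f y) - H e lo) {s ?j..y}"
      using up[of ?j "s ?j" y] xy by (simp add: st)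
    have 4: "(?F has_integral (H e hi - H e (f x)) + (H e hi - H e lo)) {x..s (i + 1)}"
      by (rule has_integral_combine[OF _ _ 1 2]) (use xy st(2)[of i] in auto)
    have 5: "(?F has_integral (H e hi - H e (f x)) + (H e hi - H e lo) + of_nat (m - 1) * P e) {x..s ?j}"
      by (rule has_integral_combine[OF _ _ 4 mid(2)]) (use xy st(2)[of i] mid in auto)
    have "(?F has_integral (H e hi - H e (f x)) + (H e hi - H e lo) + of_nat (m - 1) * P e + (H e (f y) - H e lo)) {x..y}"
      by (rule has_integral_combine[OF _ _ 5 3]) (use xy st(2)[of i] mid in auto)
    moreover have "x \<le> y" using xy st(2)[of i] mid(1) by auto
    ultimately show ?thesis using assms(2) unfolding mP by (simp add: algebra_simps)
  next
    assume xy: "x \<in> {t i..s (i + 1)} \<and> y \<in> {t ?j..s (?j + 1)}"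
    have 1: "(?F has_integral H e (f x) - H e lo) {x..s (i + 1)}"
      using down[of i x "s (i + 1)"] xy by (simp add: st)
    have 2: "(?F has_integral H e hi - H e lo) {s ?j..t ?j}"
      using up[of ?j "s ?j" "t ?j"] st(1)[of ?j] by (simp add: st)
    have 3: "(?F has_integral H e hi - H e (f y)) {t ?j..y}"
      using down[of ?j "t ?j" y] xy by (simp add: st)
    have 4: "(?F has_integral (H e (f x) - H e lo) + of_nat (m - 1) * P e) {x..s ?j}"
      by (rule has_integral_combine[OF _ _ 1 mid(2)]) (use xy mid in auto)
    have 5: "(?F has_integral (H e (f x) - H e lo) + of_nat (m - 1) * P e + (H e hi - H e lo)) {x..t ?j}"
      by (rule has_integral_combine[OF _ _ 4 2]) (use xy st(1)[of ?j] mid in auto)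
    have "(?F has_integral (H e (f x) - H e lo) + of_nat (m - 1) * P e + (H e hi - H e lo) + (H e hi - H e (f y))) {x..y}"
      by (rule has_integral_combine[OF _ _ 5 3]) (use xy st(1)[of ?j] mid in auto)
    moreover have "x \<le> y" using xy st(1)[of ?j] mid(1) by auto
    ultimately show ?thesis using assms(2) unfolding mP by (simp add: algebra_simps)
  qed
qed

end

lemma phase:
  obtains s t i where "turning s t" "\<forall>i. s (i + int n) = s i + N \<and> t (i + int n) = t i + N"
    "s i \<le> x" "x < s (i + 1)"
proof -
  obtain s t where st: "turning s t" "\<forall>i. s (i + int n) = s i + N \<and> t (i + int n) = t i + N"
    "\<forall>k. s (int n * k) = s 0 + N * of_int k"
    by (rule turning_times)
  define k where "k = \<lfloor>(x - s 0) / N\<rfloor>"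
  have "of_int k \<le> (x - s 0) / N" "(x - s 0) / N < of_int k + 1" unfolding k_def by linarith+
  then have "s 0 + N * of_int k \<le> x" "x < s 0 + N * of_int k + N"
    using period(1) by (simp_all add: field_simps)
  then have k: "s (int n * k) \<le> x" "x < s (int n * k + int n)" using st(2,3) by auto
  obtain m where m: "m \<le> n" "\<forall>i<m. \<not> x < s (int n * k + int i)" "x < s (int n * k + int m)"
    using ex_least_nat_le[of "\<lambda>m. x < s (int n * k + int m)" n] k(2) by blast
  have "m \<noteq> 0" using m(3) k(1) by (cases "m = 0") auto
  then obtain m' where m': "m = Suc m'" by (cases m) auto
  show thesis
    by (rule that[OF st(1,2), of "int n * k + int m'"]) (use m m' in \<open>auto simp: algebra_simps\<close>)
qed

lemma has_integral_period: "((\<lambda>s. w s * f s ^ e) has_integral of_nat n * P e) {x..x + N}"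
proof -
  obtain s t i where turning: "turning s t" and n: "\<forall>i. s (i + int n) = s i + N \<and> t (i + int n) = t i + N"
    and x: "s i \<le> x" "x < s (i + 1)"
    by (rule phase[of x]) (rule that)
  have "s (i + int n + 1) = s (i + 1) + N" using n[rule_format, of "i + 1"] by (simp add: algebra_simps)
  then show ?thesis
    using has_integral_same_phase[OF turning, of n x "x + N" i e] n_pos period(2) x n[rule_format, of i]
    by (cases "x \<le> t i") auto
qed

text \<open>Supplies the time at which exactly \<open>m\<close> oscillations have passed since
  \<open>x\<close>. The monotonicity clause carries the sign of the velocity from \<open>x\<close>
  to \<open>y\<close>; at an end of the band there is no sign to carry.\<close>

lemma advance:
  assumes "1 \<le> m"
  obtains y where "x \<le> y" "f y = f x" "\<And>e. ((\<lambda>s. w s * f s ^ e) has_integral of_nat m * P e) {x..y}"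
    "f x = lo \<or> f x = hi \<or> (\<exists>\<epsilon>>0. mono_on {x..x + \<epsilon>} f \<and> mono_on {y..y + \<epsilon>} f
       \<or> antimono_on {x..x + \<epsilon>} f \<and> antimono_on {y..y + \<epsilon>} f)"
proof -
  obtain s t i where turning: "turning s t" and x: "s i \<le> x" "x < s (i + 1)"
    by (rule phase[of x]) (rule that)
  note st = turningD[OF turning]
  let ?j = "i + int m"
  show thesis
  proof (cases "x < t i")
    case True
    obtain y where y: "y \<in> {s ?j..t ?j}" "f y = f x"
      using IVT'[of f "s ?j" "f x" "t ?j"] st(1,3,4)[of ?j] range[of x] continuous
      by (auto intro: continuous_on_subset)
    have ph: "x \<le> y" "((\<lambda>s. w s * f s ^ e) has_integral of_nat m * P e) {x..y}" for e
      using has_integral_same_phase[OF turning assms, of x y i e] y x True by auto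
    have "\<exists>\<epsilon>>0. mono_on {x..x + \<epsilon>} f \<and> mono_on {y..y + \<epsilon>} f" if "f x \<noteq> hi"
    proof -
      have "y \<noteq> t ?j" using that y st(4) by metis
      moreover have "mono_on {x..x + min (t i - x) (t ?j - y)} f"
        by (rule mono_on_subset[OF st(5)[of i]]) (use x in auto)
      moreover have "mono_on {y..y + min (t i - x) (t ?j - y)} f"
        by (rule mono_on_subset[OF st(5)[of ?j]]) (use y in auto)
      moreover have "min (t i - x) (t ?j - y) > 0" using True y calculation(1) by auto
      ultimately show ?thesis by blast
    qed
    then show ?thesis using that[of y] ph y by blast
  next
    case False
    obtain y where y: "y \<in> {t ?j..s (?j + 1)}" "f y = f x"
      using IVT2'[of f "s (?j + 1)" "f x" "t ?j"] st(2,4)[of ?j] st(3)[of "?j + 1"] range[of x] continuous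
      by (auto intro: continuous_on_subset)
    have ph: "x \<le> y" "((\<lambda>s. w s * f s ^ e) has_integral of_nat m * P e) {x..y}" for e
      using has_integral_same_phase[OF turning assms, of x y i e] y x False by auto
    have "\<exists>\<epsilon>>0. antimono_on {x..x + \<epsilon>} f \<and> antimono_on {y..y + \<epsilon>} f" if "f x \<noteq> lo"
    proof -
      have "y \<noteq> s (?j + 1)" using that y st(3) by metis
      moreover have "antimono_on {x..x + min (s (i + 1) - x) (s (?j + 1) - y)} f"
        by (rule monotone_on_subset[OF st(6)[of i]]) (use x False in auto)
      moreover have "antimono_on {y..y + min (s (i + 1) - x) (s (?j + 1) - y)} f"
        by (rule monotone_on_subset[OF st(6)[of ?j]]) (use y in auto)
      moreover have "min (s (i + 1) - x) (s (?j + 1) - y) > 0" using x y calculation(1) by auto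
      ultimately show ?thesis by blast
    qed
    then show ?thesis using that[of y] ph y by blast
  qed
qed

end

text \<open>Replaces a nonzero derivative, since an elliptic coordinate need not be differentiable
  at a bounce.\<close>

definition transversal :: "(real \<Rightarrow> real) \<Rightarrow> real \<Rightarrow> bool" where
  "transversal f s \<longleftrightarrow> (\<exists>\<sigma> \<epsilon>. \<sigma> \<noteq> 0 \<and> \<epsilon> > 0 \<and>
     (\<forall>r. \<bar>r - s\<bar> < \<epsilon> \<longrightarrow> r \<noteq> s \<longrightarrow> \<sigma> * ((f r - f s) * (r - s)) > 0))"

lemma transversal_not_extremum:
  assumes "transversal f s" "u < s" "s < v"
  shows "\<not> (\<forall>r\<in>{u..v}. f r \<le> f s)" "\<not> (\<forall>r\<in>{u..v}. f s \<le> f r)"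
proof -
  obtain \<sigma> \<epsilon> where \<sigma>: "\<sigma> \<noteq> 0" "\<epsilon> > 0"
    "\<And>r. \<bar>r - s\<bar> < \<epsilon> \<Longrightarrow> r \<noteq> s \<Longrightarrow> \<sigma> * ((f r - f s) * (r - s)) > 0"
    using assms(1) unfolding transversal_def by blast
  define d where "d = min (\<epsilon> / 2) (min (s - u) (v - s))"
  have d: "d > 0" "d < \<epsilon>" "s - d \<in> {u..v}" "s + d \<in> {u..v}" using \<sigma>(2) assms by (auto simp: d_def)
  have "\<sigma> * ((f (s + d) - f s) * d) > 0" "\<sigma> * ((f (s - d) - f s) * (- d)) > 0"
    using \<sigma>(3)[of "s + d"] \<sigma>(3)[of "s - d"] d by auto
  then have "\<sigma> * (f (s + d) - f s) * d > 0" "(\<sigma> * (f s - f (s - d))) * d > 0"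
    by (auto simp: algebra_simps)
  then have "\<sigma> * (f (s + d) - f s) > 0" "\<sigma> * (f s - f (s - d)) > 0"
    using d(1) by (auto simp: zero_less_mult_iff)
  then have "\<not> (f (s + d) \<le> f s \<and> f (s - d) \<le> f s)" "\<not> (f s \<le> f (s + d) \<and> f s \<le> f (s - d))"
    by (auto simp: zero_less_mult_iff)
  then show "\<not> (\<forall>r\<in>{u..v}. f r \<le> f s)" "\<not> (\<forall>r\<in>{u..v}. f s \<le> f r)"
    using d(3,4) by blast+
qed

text \<open>A transversal point is not a local extremum. If \<open>f\<close> took equal values at
  the ends of a subinterval, its extrema there would sit at the ends and \<open>f\<close> would be
  constant, so \<open>f\<close> is injective; continuity makes it monotone, in the direction given
  by the end values.\<close>

lemma mono_on_of_transversal: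
  fixes f :: "real \<Rightarrow> real"
  assumes "x < y" "continuous_on {x..y} f" "f x < f y"
    and tr: "\<And>s. x < s \<Longrightarrow> s < y \<Longrightarrow> transversal f s"
  shows "mono_on {x..y} f"
proof -
  note no_max = transversal_not_extremum[OF tr]
  have inj: "f u \<noteq> f v" if uv: "x \<le> u" "u < v" "v \<le> y" for u v
  proof
    assume e: "f u = f v"
    have c: "continuous_on {u..v} f" by (rule continuous_on_subset[OF assms(2)]) (use uv in auto)
    obtain M where M: "M \<in> {u..v}" "\<forall>r\<in>{u..v}. f r \<le> f M"
      using continuous_attains_sup[OF _ _ c] uv by auto
    obtain m where m: "m \<in> {u..v}" "\<forall>r\<in>{u..v}. f m \<le> f r"
      using continuous_attains_inf[OF _ _ c] uv by auto
    have "M = u \<or> M = v" using no_max(1)[of M u v] M uv by fastforce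
    moreover have "m = u \<or> m = v" using no_max(2)[of m u v] m uv by fastforce
    ultimately have "f m = f u" "f M = f u" using e by auto
    have const: "\<forall>r\<in>{u..v}. f r = f u"
    proof
      fix r assume "r \<in> {u..v}"
      then have "f r \<le> f M" "f m \<le> f r" using M m by blast+
      then show "f r = f u" using \<open>f m = f u\<close> \<open>f M = f u\<close> by simp
    qed
    have mid: "u < (u + v) / 2" "(u + v) / 2 < v" using uv by simp_all
    then have m: "(u + v) / 2 \<in> {u..v}" by simp
    have "\<forall>r\<in>{u..v}. f r \<le> f ((u + v) / 2)"
    proof
      fix r assume "r \<in> {u..v}"
      then show "f r \<le> f ((u + v) / 2)" using bspec[OF const] m by (metis order_refl)
    qed
    then show False using no_max(1)[OF _ _ mid] mid uv by linarith
  qed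
  have ij: "inj_on f {x..v}" if "v \<le> y" for v
  proof (rule linorder_inj_onI)
    fix r s assume "r < s" "r \<in> {x..v}" "s \<in> {x..v}"
    then show "f r \<noteq> f s" using inj[of r s] that by auto
  qed auto
  have lt: "f x < f v" if "x < v" "v \<le> y" for v
  proof (cases "v = y")
    case False
    then show ?thesis using continuous_inj_imp_mono[OF that(1) _ assms(2) ij] that assms(3) by force
  qed (use assms(3) in simp)
  show ?thesis
  proof (intro strict_mono_on_imp_mono_on strict_mono_onI)
    fix u v assume uv: "u \<in> {x..y}" "v \<in> {x..y}" "u < v"
    show "f u < f v"
    proof (cases "u = x")
      case True then show ?thesis using lt[of v] uv by auto
    next
      case False
      have "continuous_on {x..v} f" by (rule continuous_on_subset[OF assms(2)]) (use uv in auto)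
      then show ?thesis
        using continuous_inj_imp_mono[of x u v f] ij[of v] lt[of v] uv False by auto
    qed
  qed
qed

lemma antimono_on_of_transversal:
  fixes f :: "real \<Rightarrow> real"
  assumes "x < y" "continuous_on {x..y} f" "f y < f x"
    and tr: "\<And>s. x < s \<Longrightarrow> s < y \<Longrightarrow> transversal f s"
  shows "antimono_on {x..y} f"
proof -
  have "transversal (\<lambda>s. - f s) s" if s: "x < s" "s < y" for s
  proof -
    obtain \<sigma> \<epsilon> where "\<sigma> \<noteq> 0" "\<epsilon> > 0" "\<forall>r. \<bar>r - s\<bar> < \<epsilon> \<longrightarrow> r \<noteq> s \<longrightarrow> \<sigma> * ((f r - f s) * (r - s)) > 0"
      using tr[OF s] unfolding transversal_def by blast
    then show ?thesis
      unfolding transversal_def by (intro exI[of _ "- \<sigma>"] exI[of _ \<epsilon>]) (auto simp: algebra_simps)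
  qed
  then have "mono_on {x..y} (\<lambda>s. - f s)"
    using assms by (intro mono_on_of_transversal continuous_on_minus) auto
  then show ?thesis by (auto simp: monotone_on_def)
qed

section \<open>Antiderivatives on the three bands\<close>

context caustics
begin

definition lo :: "nat \<Rightarrow> real" where "lo j = (if j = 0 then 0 else if j = 1 then c2 else c4)"
definition hi :: "nat \<Rightarrow> real" where "hi j = (if j = 0 then c1 else if j = 1 then c3 else a)"

lemma band_simps: "lo 0 = 0" "lo 1 = c2" "lo 2 = c4" "hi 0 = c1" "hi 1 = c3" "hi 2 = a"
  "lo (Suc 0) = c2" "hi (Suc 0) = c3"
  by (simp_all add: lo_def hi_def)

lemma lo_less_hi: "lo j < hi j"
  using c_order by (simp add: lo_def hi_def)

lemma T_factor_antiderivative: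
  assumes "x < y" and R: "continuous_on {x..y} R" "\<And>z. z \<in> {x..y} \<Longrightarrow> R z > 0"
    and T: "\<And>z. T z = (z - x) * (y - z) * R z"
  shows "\<exists>H. continuous_on {x..y} H \<and>
    (\<forall>z. x < z \<longrightarrow> z < y \<longrightarrow> (H has_real_derivative z ^ i / (2 * sqrt (T z))) (at z))"
proof -
  have "continuous_on {x..y} (\<lambda>z. z ^ i / (2 * sqrt (R z)))"
    using R by (intro continuous_intros) fastforce+
  then obtain H where H: "continuous_on {x..y} H" "\<And>z. x < z \<Longrightarrow> z < y \<Longrightarrow>
      (H has_real_derivative z ^ i / (2 * sqrt (R z)) / sqrt ((z - x) * (y - z))) (at z)"
    using ex_arcsine_antiderivative[OF assms(1)] by blast
  have "z ^ i / (2 * sqrt (R z)) / sqrt ((z - x) * (y - z)) = z ^ i / (2 * sqrt (T z))" for z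
    unfolding T by (simp add: real_sqrt_mult)
  then have "\<forall>z. x < z \<longrightarrow> z < y \<longrightarrow> (H has_real_derivative z ^ i / (2 * sqrt (T z))) (at z)"
    using H(2) by presburger
  then show ?thesis using H(1) by blast
qed

lemma ex_band_antiderivative:
  assumes "j \<in> {0, 1, 2}"
  shows "\<exists>H. continuous_on {lo j..hi j} H \<and>
    (\<forall>z. lo j < z \<longrightarrow> z < hi j \<longrightarrow> (H has_real_derivative z ^ i / (2 * sqrt (T z))) (at z))"
proof -
  note d = c_order
  from assms consider "j = 0" | "j = 1" | "j = 2" by auto
  then show ?thesis
  proof cases
    case 1
    define R where "R z = (c2 - z) * (c3 - z) * (c4 - z) * (a - z)" for z
    have R: "R z > 0" if "z \<in> {0..c1}" for z using that d by (auto simp: R_def)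
    \<comment> \<open>The lower end 0 of the first band is not a zero of \<open>T\<close>; the
      factor \<open>sqrt z\<close> cancels the singularity that the arcsine lemma introduces
      there.\<close>
    have "continuous_on {0..c1} (\<lambda>z. z ^ i * sqrt z / (2 * sqrt (R z)))"
      using R unfolding R_def by (intro continuous_intros) fastforce+
    then obtain H where H: "continuous_on {0..c1} H" "\<And>z. 0 < z \<Longrightarrow> z < c1 \<Longrightarrow>
        (H has_real_derivative z ^ i * sqrt z / (2 * sqrt (R z)) / sqrt ((z - 0) * (c1 - z))) (at z)"
      using ex_arcsine_antiderivative[OF d(1)] by blast
    have "z ^ i * sqrt z / (2 * sqrt (R z)) / sqrt ((z - 0) * (c1 - z)) = z ^ i / (2 * sqrt (T z))" if "0 < z" for z
    proof -
      have "T z = (c1 - z) * R z" by (simp add: T_def R_def)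
      then show ?thesis using that by (simp add: real_sqrt_mult)
    qed
    then have "\<forall>z. 0 < z \<longrightarrow> z < c1 \<longrightarrow> (H has_real_derivative z ^ i / (2 * sqrt (T z))) (at z)"
      using H(2) by presburger
    then show ?thesis using H(1) unfolding 1 band_simps by blast
  next
    case 2
    show ?thesis unfolding 2 band_simps
    proof (rule T_factor_antiderivative[OF d(3), of "\<lambda>z. (z - c1) * (c4 - z) * (a - z)"])
      show "(z - c1) * (c4 - z) * (a - z) > 0" if "z \<in> {c2..c3}" for z using that d by auto
      show "T z = (z - c2) * (c3 - z) * ((z - c1) * (c4 - z) * (a - z))" for z unfolding T_def by algebra
    qed (intro continuous_intros)
  next
    case 3
    show ?thesis unfolding 3 band_simps
    proof (rule T_factor_antiderivative[OF d(5), of "\<lambda>z. (z - c1) * (z - c2) * (z - c3)"])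
      show "(z - c1) * (z - c2) * (z - c3) > 0" if "z \<in> {c4..a}" for z using that d by auto
      show "T z = (z - c4) * (a - z) * ((z - c1) * (z - c2) * (z - c3))" for z unfolding T_def by algebra
    qed (intro continuous_intros)
  qed
qed

definition H :: "nat \<Rightarrow> nat \<Rightarrow> real \<Rightarrow> real" where
  "H j i = (SOME H. continuous_on {lo j..hi j} H \<and>
    (\<forall>z. lo j < z \<longrightarrow> z < hi j \<longrightarrow> (H has_real_derivative z ^ i / (2 * sqrt (T z))) (at z)))"

lemma H:
  assumes "j \<in> {0, 1, 2}"
  shows "continuous_on {lo j..hi j} (H j i)"
    "lo j < z \<Longrightarrow> z < hi j \<Longrightarrow> (H j i has_real_derivative z ^ i / (2 * sqrt (T z))) (at z)"
  using someI_ex[OF ex_band_antiderivative[OF assms, of i]] unfolding H_def by blast+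

end

section \<open>Weighted integrals along the trajectory\<close>

context nonsingular
begin

lemma \<mu>_in_band: "j \<in> {0, 1, 2} \<Longrightarrow> \<mu> j s \<in> {lo j..hi j}"
  using \<mu>_bands[of s] \<mu>0_nonneg[of s] by (auto simp: band_simps simp del: One_nat_def)

lemma T_\<mu>_zero_iff: "j \<in> {0, 1, 2} \<Longrightarrow> T (\<mu> j s) = 0 \<longleftrightarrow> \<mu> j s = hi j \<or> j \<noteq> 0 \<and> \<mu> j s = lo j"
  using \<mu>_bands[of s] c_order unfolding T_zero_iff
  by (elim insertE emptyE) (auto simp: band_simps simp del: One_nat_def)

lemma transversal_\<mu>:
  assumes "j \<in> {0, 1, 2}" "\<mu> j s \<noteq> lo j" "\<mu> j s \<noteq> hi j"
  shows "transversal (\<mu> j) s"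
proof -
  have "T (\<mu> j s) \<noteq> 0" using T_\<mu>_zero_iff[OF assms(1)] assms(2,3) by blast
  moreover have "\<mu> j s \<noteq> 0"
    using assms(1,2) \<mu>_bands[of s] c_order by (auto simp: band_simps simp del: One_nat_def)
  ultimately show ?thesis unfolding transversal_def using \<mu>_transversal[OF assms(1)] by metis
qed

definition w :: "nat \<Rightarrow> real \<Rightarrow> real" where
  "w j s = \<tau> \<lfloor>s\<rfloor> / \<bar>den j s\<bar>"

text \<open>Jacobi's relations, which come from Lagrange interpolation at the three elliptic coordinates.\<close>

lemma w_alternating_sum:
  "w 0 s - w 1 s + w 2 s = 0" "w 0 s * \<mu> 0 s - w 1 s * \<mu> 1 s + w 2 s * \<mu> 2 s = 0"
proof -
  have nz: "\<mu> 1 s - \<mu> 0 s \<noteq> 0" "\<mu> 2 s - \<mu> 0 s \<noteq> 0" "\<mu> 2 s - \<mu> 1 s \<noteq> 0"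
    using \<mu>_order[of s] by auto
  have "\<bar>den 0 s\<bar> = (\<mu> 1 s - \<mu> 0 s) * (\<mu> 2 s - \<mu> 0 s)" "\<bar>den 1 s\<bar> = (\<mu> 1 s - \<mu> 0 s) * (\<mu> 2 s - \<mu> 1 s)"
    "\<bar>den 2 s\<bar> = (\<mu> 2 s - \<mu> 0 s) * (\<mu> 2 s - \<mu> 1 s)"
    using \<mu>_order[of s] by (simp_all add: den_eq abs_mult del: One_nat_def)
  then have w: "w 0 s = \<tau> \<lfloor>s\<rfloor> / ((\<mu> 1 s - \<mu> 0 s) * (\<mu> 2 s - \<mu> 0 s))"
    "w 1 s = \<tau> \<lfloor>s\<rfloor> / ((\<mu> 1 s - \<mu> 0 s) * (\<mu> 2 s - \<mu> 1 s))"
    "w 2 s = \<tau> \<lfloor>s\<rfloor> / ((\<mu> 2 s - \<mu> 0 s) * (\<mu> 2 s - \<mu> 1 s))"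
    by (simp_all add: w_def)
  show "w 0 s - w 1 s + w 2 s = 0" "w 0 s * \<mu> 0 s - w 1 s * \<mu> 1 s + w 2 s * \<mu> 2 s = 0"
    unfolding w using nz by (simp_all add: divide_simps) (simp_all add: algebra_simps)
qed

lemma finite_exceptional: "finite {s \<in> {x..y}. s \<in> \<int> \<or> (\<exists>j\<in>{0, 1, 2}. T (\<mu> j s) = 0)}"
proof (rule finite_subset)
  let ?E = "\<lambda>k. {s \<in> {of_int k..of_int k + 1}. \<exists>j\<in>{0, 1, 2}. T (\<mu> j s) = 0}"
  show "finite (of_int ` {\<lfloor>x\<rfloor>..\<lfloor>y\<rfloor>} \<union> (\<Union>k\<in>{\<lfloor>x\<rfloor>..\<lfloor>y\<rfloor>}. ?E k))"
    by (intro finite_UnI finite_UN_I finite_imageI finite_edges) auto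
  show "{s \<in> {x..y}. s \<in> \<int> \<or> (\<exists>j\<in>{0, 1, 2}. T (\<mu> j s) = 0)} \<subseteq> of_int ` {\<lfloor>x\<rfloor>..\<lfloor>y\<rfloor>} \<union> (\<Union>k\<in>{\<lfloor>x\<rfloor>..\<lfloor>y\<rfloor>}. ?E k)"
  proof
    fix s assume s: "s \<in> {s \<in> {x..y}. s \<in> \<int> \<or> (\<exists>j\<in>{0, 1, 2}. T (\<mu> j s) = 0)}"
    then have k: "\<lfloor>s\<rfloor> \<in> {\<lfloor>x\<rfloor>..\<lfloor>y\<rfloor>}" by (auto intro: floor_mono)
    show "s \<in> of_int ` {\<lfloor>x\<rfloor>..\<lfloor>y\<rfloor>} \<union> (\<Union>k\<in>{\<lfloor>x\<rfloor>..\<lfloor>y\<rfloor>}. ?E k)"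
    proof (cases "s \<in> \<int>")
      case True
      then have "s = of_int \<lfloor>s\<rfloor>" by (auto elim: Ints_cases)
      then show ?thesis using k by blast
    next
      case False
      then have "s \<in> ?E \<lfloor>s\<rfloor>" using s in_segment[of s] by blast
      then show ?thesis using k by blast
    qed
  qed
qed

lemma \<mu>_deriv_interior:
  assumes "j \<in> {0, 1, 2}" "s \<notin> \<int>"
  obtains D where "(\<mu> j has_real_derivative D) (at s)" "\<bar>D\<bar> = 2 * w j s * sqrt (T (\<mu> j s))"
proof
  let ?k = "\<lfloor>s\<rfloor>"
  have "of_int ?k < s" "s < of_int ?k + 1" using assms(2) frac_gt_0_iff[of s] by (auto simp: frac_def)
  then show "(\<mu> j has_real_derivative - 2 * (\<tau> ?k * mix_poly (traj s) (u ?k) (\<mu> j s)) / den j s) (at s)"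
    using \<mu>_deriv[OF in_segment assms(1), of s] at_within_Icc_at[of "of_int ?k" s "of_int ?k + 1"] by simp
  have "\<bar>mix_poly (traj s) (u ?k) (\<mu> j s)\<bar> = sqrt (T (\<mu> j s))"
    using mix_poly_\<mu>[OF in_segment assms(1), of s] by (metis real_sqrt_abs)
  then show "\<bar>- 2 * (\<tau> ?k * mix_poly (traj s) (u ?k) (\<mu> j s)) / den j s\<bar> = 2 * w j s * sqrt (T (\<mu> j s))"
    using \<tau>_pos[of ?k] by (simp add: w_def abs_mult)
qed

text \<open>The factor \<open>sqrt T\<close> cancels between the derivative of the coordinate and
  that of \<open>H\<close>, leaving the weight. Turning points and bounces form a finite set, which
  the strong fundamental theorem of calculus tolerates.\<close>

lemma monotone_piece_integral:
  assumes j: "j \<in> {0, 1, 2}" and "x \<le> y" and \<sigma>: "\<sigma> \<in> {1, - 1}"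
    and sign: "\<And>s D. x < s \<Longrightarrow> s < y \<Longrightarrow> (\<mu> j has_real_derivative D) (at s) \<Longrightarrow> \<sigma> * D \<ge> 0"
  shows "((\<lambda>s. w j s * \<mu> j s ^ i) has_integral \<sigma> * (H j i (\<mu> j y) - H j i (\<mu> j x))) {x..y}"
proof -
  let ?F = "{s \<in> {x..y}. s \<in> \<int> \<or> (\<exists>j\<in>{0, 1, 2}. T (\<mu> j s) = 0)}"
  have "((\<lambda>s. w j s * \<mu> j s ^ i) has_integral \<sigma> * H j i (\<mu> j y) - \<sigma> * H j i (\<mu> j x)) {x..y}"
  proof (rule fundamental_theorem_of_calculus_interior_strong[OF finite_exceptional assms(2)])
    show "continuous_on {x..y} (\<lambda>s. \<sigma> * H j i (\<mu> j s))"
      using \<mu>_in_band[OF j] j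
      by (intro continuous_intros continuous_on_compose2[OF H(1)[OF j] continuous_on_\<mu>]) auto
    fix s assume s: "s \<in> {x<..<y} - ?F"
    then have sZ: "s \<notin> \<int>" and T: "T (\<mu> j s) \<noteq> 0" using j by auto
    have T0: "T (\<mu> j s) > 0" using T mix_poly_\<mu>[OF in_segment j, of s] by (metis less_le zero_le_power2)
    have b: "lo j < \<mu> j s" "\<mu> j s < hi j"
    proof -
      have "\<mu> j s \<noteq> hi j" "j \<noteq> 0 \<Longrightarrow> \<mu> j s \<noteq> lo j" using T T_\<mu>_zero_iff[OF j, of s] by blast+
      moreover have "j = 0 \<Longrightarrow> \<mu> j s \<noteq> lo j" using \<mu>0_pos[OF sZ] by (auto simp: band_simps)
      ultimately show "lo j < \<mu> j s" "\<mu> j s < hi j" using \<mu>_in_band[OF j, of s] by fastforce+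
    qed
    obtain D where D: "(\<mu> j has_real_derivative D) (at s)" "\<bar>D\<bar> = 2 * w j s * sqrt (T (\<mu> j s))"
      using \<mu>_deriv_interior[OF j sZ] by blast
    have "\<sigma> * D = \<bar>D\<bar>" using sign[OF _ _ D(1)] s \<sigma> by auto
    moreover have "((\<lambda>s. \<sigma> * H j i (\<mu> j s)) has_real_derivative \<sigma> * (\<mu> j s ^ i / (2 * sqrt (T (\<mu> j s))) * D)) (at s)"
      by (intro DERIV_cmult DERIV_chain2[OF H(2)[OF j b] D(1)])
    moreover have "\<sigma> * (\<mu> j s ^ i / (2 * sqrt (T (\<mu> j s))) * D) = \<mu> j s ^ i / (2 * sqrt (T (\<mu> j s))) * (\<sigma> * D)"
      by simp
    ultimately have "((\<lambda>s. \<sigma> * H j i (\<mu> j s)) has_real_derivative w j s * \<mu> j s ^ i) (at s)"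
      using T0 unfolding D(2) by (simp add: mult.commute)
    then show "((\<lambda>s. \<sigma> * H j i (\<mu> j s)) has_vector_derivative w j s * \<mu> j s ^ i) (at s)"
      by (simp add: has_real_derivative_iff_has_vector_derivative)
  qed
  then show ?thesis by (simp add: algebra_simps)
qed

lemma rising_integral:
  assumes "j \<in> {0, 1, 2}" "x \<le> y" "mono_on {x..y} (\<mu> j)"
  shows "((\<lambda>s. w j s * \<mu> j s ^ i) has_integral H j i (\<mu> j y) - H j i (\<mu> j x)) {x..y}"
proof -
  have "((\<lambda>s. w j s * \<mu> j s ^ i) has_integral 1 * (H j i (\<mu> j y) - H j i (\<mu> j x))) {x..y}"
  proof (rule monotone_piece_integral[OF assms(1,2)])
    fix s D assume "x < s" "s < y" "(\<mu> j has_real_derivative D) (at s)"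
    then show "1 * D \<ge> 0" using mono_on_imp_deriv_nonneg[OF assms(3)] by simp
  qed simp
  then show ?thesis by simp
qed

lemma falling_integral:
  assumes "j \<in> {0, 1, 2}" "x \<le> y" "antimono_on {x..y} (\<mu> j)"
  shows "((\<lambda>s. w j s * \<mu> j s ^ i) has_integral H j i (\<mu> j x) - H j i (\<mu> j y)) {x..y}"
proof -
  have m: "mono_on {x..y} (\<lambda>s. - \<mu> j s)" using assms(3) by (auto simp: monotone_on_def)
  have "((\<lambda>s. w j s * \<mu> j s ^ i) has_integral (- 1) * (H j i (\<mu> j y) - H j i (\<mu> j x))) {x..y}"
  proof (rule monotone_piece_integral[OF assms(1,2)])
    fix s D assume "x < s" "s < y" "(\<mu> j has_real_derivative D) (at s)"
    then show "- 1 * D \<ge> 0" using mono_on_imp_deriv_nonneg[OF m DERIV_minus] by simp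
  qed simp
  then show ?thesis by simp
qed

end

section \<open>Oscillations per bounce and comparison of integrals\<close>

context nonsingular
begin

text \<open>At a zero of \<open>T\<close> the quadratic \<open>pos_poly\<close> along the line has
  zero discriminant, and it is not identically zero by the rank one property. A root is therefore
  double, and there is at most one.\<close>

lemma contact_unique:
  assumes "T z = 0" and s: "s \<in> {of_int k..of_int k + 1}" "r \<in> {of_int k..of_int k + 1}"
    and "pos_poly (traj s) z = 0" "pos_poly (traj r) z = 0"
  shows "s = r"
proof -
  let ?p = "pos_poly (q k) z" and ?m = "mix_poly (q k) (u k) z" and ?d = "dir_poly (u k) z"
  have z: "?m\<^sup>2 + ?d * ?p = 0"
    using assms(1) by (simp add: discriminant_identity caustic_poly_eq T_eq)
  have sq: "(?m + (x - of_int k) * \<tau> k * ?d)\<^sup>2 = 0 \<and> (?d = 0 \<longrightarrow> ?m = 0 \<and> ?p = 0)"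
    if x: "x \<in> {of_int k..of_int k + 1}" "pos_poly (traj x) z = 0" for x
  proof
    have e: "?p - 2 * ((x - of_int k) * \<tau> k) * ?m - ((x - of_int k) * \<tau> k)\<^sup>2 * ?d = 0"
      using x(2) unfolding path_segment[OF x(1)] pos_poly_line .
    show "(?m + (x - of_int k) * \<tau> k * ?d)\<^sup>2 = 0" using e z by algebra
    show "?d = 0 \<longrightarrow> ?m = 0 \<and> ?p = 0" using e z by auto
  qed
  have "?d \<noteq> 0" using sq[OF s(1) assms(4)] rank_one_vertex[OF assms(1), of k] by blast
  moreover have "(s - r) * (\<tau> k * ?d) = 0"
  proof -
    have "?m + (s - of_int k) * \<tau> k * ?d = 0" "?m + (r - of_int k) * \<tau> k * ?d = 0"
      using sq[OF s(1) assms(4)] sq[OF s(2) assms(5)] by auto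
    then show ?thesis by algebra
  qed
  ultimately show ?thesis using \<tau>_pos[of k] by simp
qed

text \<open>The first coordinate vanishes exactly at the bounces, so its maximum on a segment is
  interior. An interior maximum is a turning value, hence \<open>c1\<close>, and the contact with
  \<open>c1\<close> is unique: one oscillation per bounce.\<close>

lemma \<mu>0_segment:
  obtains m where "of_int k < m" "m < of_int k + 1" "\<mu> 0 m = c1"
    "mono_on {of_int k..m} (\<mu> 0)" "antimono_on {m..of_int k + 1} (\<mu> 0)"
proof -
  let ?S = "{of_int k..of_int k + 1 :: real}"
  have nI: "s \<notin> \<int>" if "of_int k < s" "s < of_int k + 1" for s :: real
    using that by (metis Ints_cases floor_less_iff floor_of_int floor_unique less_irrefl less_le of_int_floor_le of_int_less_iff zless_imp_add1_zle linorder_not_le of_int_1 of_int_add)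
  have pos: "\<mu> 0 s > 0" if "of_int k < s" "s < of_int k + 1" for s using \<mu>0_pos[OF nI[OF that]] .
  obtain m where m: "m \<in> ?S" "\<forall>s\<in>?S. \<mu> 0 s \<le> \<mu> 0 m"
    using continuous_attains_sup[of ?S "\<mu> 0"] continuous_on_\<mu>[of 0] by auto
  have ends: "\<mu> 0 (of_int k) = 0" "\<mu> 0 (of_int k + 1) = 0"
    using \<mu>0_vertex[of k] \<mu>0_vertex[of "k + 1"] by simp_all
  have "of_int k + 1/2 \<in> ?S" by simp
  then have "\<mu> 0 (of_int k + 1/2) \<le> \<mu> 0 m" using m(2) by blast
  moreover have "\<mu> 0 (of_int k + 1/2) > 0" by (rule pos) auto
  ultimately have "\<mu> 0 m > 0" by linarith
  then have mi: "of_int k < m" "m < of_int k + 1" using m(1) ends by (auto simp: less_le)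
  have mc: "\<mu> 0 m = c1"
  proof (rule ccontr)
    assume "\<mu> 0 m \<noteq> c1"
    then have "transversal (\<mu> 0) m" using transversal_\<mu>[of 0 m] \<open>\<mu> 0 m > 0\<close> by (auto simp: band_simps)
    then show False using transversal_not_extremum(1)[OF _ mi] m(2) by blast
  qed
  have "\<mu> 0 s \<noteq> c1" if "s \<in> ?S" "s \<noteq> m" for s
    using contact_unique[of c1 s k m] that m(1) mc pos_poly_\<mu>_zero[of 0 s] pos_poly_\<mu>_zero[of 0 m] by (auto simp: T_zero_iff)
  then have tr: "transversal (\<mu> 0) s" if "of_int k < s" "s < of_int k + 1" "s \<noteq> m" for s
    using that pos[of s] transversal_\<mu>[of 0 s] by (auto simp: band_simps)
  show thesis
  proof
    show "of_int k < m" "m < of_int k + 1" "\<mu> 0 m = c1" by fact+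
    show "mono_on {of_int k..m} (\<mu> 0)"
      using mi mc ends c_order tr by (intro mono_on_of_transversal continuous_on_\<mu>) auto
    show "antimono_on {m..of_int k + 1} (\<mu> 0)"
      using mi mc ends c_order tr by (intro antimono_on_of_transversal continuous_on_\<mu>) auto
  qed
qed

lemma \<mu>0_segment_integral:
  "((\<lambda>s. w 0 s * \<mu> 0 s ^ i) has_integral 2 * (H 0 i c1 - H 0 i 0)) {of_int k..of_int k + 1}"
proof -
  obtain m where m: "of_int k < m" "m < of_int k + 1" "\<mu> 0 m = c1"
    "mono_on {of_int k..m} (\<mu> 0)" "antimono_on {m..of_int k + 1} (\<mu> 0)"
    by (rule \<mu>0_segment)
  have ends: "\<mu> 0 (of_int k) = 0" "\<mu> 0 (of_int k + 1) = 0"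
    using \<mu>0_vertex[of k] \<mu>0_vertex[of "k + 1"] by simp_all
  have up: "((\<lambda>s. w 0 s * \<mu> 0 s ^ i) has_integral H 0 i c1 - H 0 i 0) {of_int k..m}"
    using rising_integral[OF _ less_imp_le[OF m(1)] m(4), of i] unfolding m(3) ends by blast
  have down: "((\<lambda>s. w 0 s * \<mu> 0 s ^ i) has_integral H 0 i c1 - H 0 i 0) {m..of_int k + 1}"
    using falling_integral[OF _ less_imp_le[OF m(2)] m(5), of i] unfolding m(3) ends by blast
  have "((\<lambda>s. w 0 s * \<mu> 0 s ^ i) has_integral (H 0 i c1 - H 0 i 0) + (H 0 i c1 - H 0 i 0)) {of_int k..of_int k + 1}"
    by (rule has_integral_combine[OF less_imp_le[OF m(1)] less_imp_le[OF m(2)] up down])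
  then show ?thesis unfolding mult_2 .
qed

lemma \<mu>0_integral:
  "((\<lambda>s. w 0 s * \<mu> 0 s ^ i) has_integral of_nat n * (2 * (H 0 i c1 - H 0 i 0))) {0..of_nat n}"
proof (induction n)
  case 0
  show ?case by (simp add: has_integral_refl)
next
  case (Suc n)
  have "((\<lambda>s. w 0 s * \<mu> 0 s ^ i) has_integral of_nat n * (2 * (H 0 i c1 - H 0 i 0)) + 2 * (H 0 i c1 - H 0 i 0)) {0..of_nat n + 1}"
  proof (rule has_integral_combine[OF _ _ Suc])
    show "((\<lambda>s. w 0 s * \<mu> 0 s ^ i) has_integral 2 * (H 0 i c1 - H 0 i 0)) {of_nat n..of_nat n + 1}"
      using \<mu>0_segment_integral[of i "int n"] by (simp only: of_int_of_nat_eq)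
  qed auto
  then show ?case by (simp add: algebra_simps)
qed

text \<open>With a weight bounded away from 0 on compact intervals, a vanishing integral forces the
  interval to be trivial; this recovers times from integrals.\<close>

lemma w_lower_bound:
  assumes "j \<in> {0, 1, 2}"
  obtains \<delta> where "\<delta> > 0" "\<And>s. s \<in> {x..y} \<Longrightarrow> \<delta> \<le> w j s"
proof (cases "x \<le> y")
  case True
  let ?M = "Min (\<tau> ` {\<lfloor>x\<rfloor>..\<lfloor>y\<rfloor>})"
  have ne: "{\<lfloor>x\<rfloor>..\<lfloor>y\<rfloor>} \<noteq> {}" using True by (simp add: floor_mono)
  have M: "?M > 0" using ne \<tau>_pos by (subst Min_gr_iff) auto
  have "?M / a\<^sup>2 \<le> w j s" if s: "s \<in> {x..y}" for s
  proof -
    have "\<lfloor>s\<rfloor> \<in> {\<lfloor>x\<rfloor>..\<lfloor>y\<rfloor>}" using s by (auto intro: floor_mono)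
    then have 1: "?M \<le> \<tau> \<lfloor>s\<rfloor>" by (intro Min_le) auto
    have d: "\<bar>\<mu> i s - \<mu> i' s\<bar> \<le> a" if "i \<in> {0, 1, 2}" "i' \<in> {0, 1, 2}" for i i'
      using that \<mu>_bands[of s] \<mu>0_nonneg[of s] c_order by (auto simp: abs_le_iff simp del: One_nat_def)
    have "\<bar>den j s\<bar> \<le> a\<^sup>2"
      using assms unfolding power2_eq_square
      by (elim insertE emptyE) (auto simp: den_eq abs_mult simp del: One_nat_def intro!: mult_mono d, use a0 in auto)
    then have "?M / a\<^sup>2 \<le> ?M / \<bar>den j s\<bar>" using M den_nz[OF assms, of s] a0 by (intro divide_left_mono) auto
    also have "\<dots> \<le> w j s" unfolding w_def using 1 by (intro divide_right_mono) auto
    finally show ?thesis .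
  qed
  moreover have "?M / a\<^sup>2 > 0" using M a0 by simp
  ultimately show thesis using that by blast
next
  case False
  then show thesis using that[of 1] by auto
qed

text \<open>\<open>I 1 / I 0\<close> is a weighted mean of the coordinate, so it stays in the
  band.\<close>

lemma w_integral_bounds:
  assumes j: "j \<in> {0, 1, 2}" and "x < y" and I: "\<And>i. ((\<lambda>s. w j s * \<mu> j s ^ i) has_integral I i) {x..y}"
  shows "0 < I 0" "lo j * I 0 \<le> I 1" "I 1 \<le> hi j * I 0"
proof -
  obtain \<delta> where \<delta>: "\<delta> > 0" "\<And>s. s \<in> {x..y} \<Longrightarrow> \<delta> \<le> w j s" using w_lower_bound[OF j] by blast
  have I0: "(w j has_integral I 0) {x..y}" and I1: "((\<lambda>s. w j s * \<mu> j s) has_integral I 1) {x..y}"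
    using I[of 0] I[of 1] by simp_all
  have "\<delta> * (y - x) \<le> I 0"
    using has_integral_le[OF _ I0, of "\<lambda>_. \<delta>" "\<delta> * (y - x)"] has_integral_const_real[of \<delta> x y] \<delta>(2) assms(2)
    by (simp add: mult.commute)
  moreover have "\<delta> * (y - x) > 0" using \<delta>(1) assms(2) by simp
  ultimately show "0 < I 0" by linarith
  have wp: "w j s \<ge> 0" for s using \<tau>_pos[of "\<lfloor>s\<rfloor>"] by (simp add: w_def)
  show "lo j * I 0 \<le> I 1"
    by (rule has_integral_le[OF has_integral_mult_right[OF I0] I1])
      (use \<mu>_in_band[OF j] wp in \<open>auto simp: mult.commute intro!: mult_right_mono\<close>)
  show "I 1 \<le> hi j * I 0"
    by (rule has_integral_le[OF I1 has_integral_mult_right[OF I0]])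
      (use \<mu>_in_band[OF j] wp in \<open>auto simp: mult.commute intro!: mult_right_mono\<close>)
qed

text \<open>The difference of the two integrals lives on the interval between \<open>x\<close> and
  \<open>y\<close>, to which the mean value bound applies; the three cases are the possible orders
  of \<open>x\<close> and \<open>y\<close>.\<close>

lemma w_integral_compare:
  assumes j: "j \<in> {0, 1, 2}" and "0 \<le> x" "0 \<le> y"
    and X: "\<And>i. ((\<lambda>s. w j s * \<mu> j s ^ i) has_integral X i) {0..x}"
    and Y: "\<And>i. ((\<lambda>s. w j s * \<mu> j s ^ i) has_integral Y i) {0..y}"
  shows "x = y \<and> X 0 - Y 0 = 0
    \<or> 0 < X 0 - Y 0 \<and> lo j * (X 0 - Y 0) \<le> X 1 - Y 1 \<and> X 1 - Y 1 \<le> hi j * (X 0 - Y 0)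
    \<or> 0 < Y 0 - X 0 \<and> lo j * (Y 0 - X 0) \<le> Y 1 - X 1 \<and> Y 1 - X 1 \<le> hi j * (Y 0 - X 0)"
proof -
  have diff: "((\<lambda>s. w j s * \<mu> j s ^ i) has_integral V i - U i) {x'..y'}"
    if U: "\<And>i. ((\<lambda>s. w j s * \<mu> j s ^ i) has_integral U i) {0..x'}"
      and V: "\<And>i. ((\<lambda>s. w j s * \<mu> j s ^ i) has_integral V i) {0..y'}" and le: "0 \<le> x'" "x' \<le> y'"
    for U V x' y' i
  proof -
    have "(\<lambda>s. w j s * \<mu> j s ^ i) integrable_on {x'..y'}"
      using integrable_on_subinterval[OF has_integral_integrable[OF V]] le by simp
    then obtain D where D: "((\<lambda>s. w j s * \<mu> j s ^ i) has_integral D) {x'..y'}" by blast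
    have "((\<lambda>s. w j s * \<mu> j s ^ i) has_integral U i + D) {0..y'}"
      by (rule has_integral_combine[OF le U D])
    then have "V i = U i + D" using has_integral_unique V by blast
    then show ?thesis using D by simp
  qed
  consider "x = y" | "x < y" | "y < x" by linarith
  then show ?thesis
  proof cases
    case 1
    then show ?thesis using has_integral_unique[OF X Y[folded 1], of 0] by simp
  next
    case 2
    have "((\<lambda>s. w j s * \<mu> j s ^ i) has_integral Y i - X i) {x..y}" for i
      using diff[OF X Y] assms 2 by simp
    note b = w_integral_bounds[OF j 2, where I = "\<lambda>i. Y i - X i", OF this]
    show ?thesis using b by blast
  next
    case 3
    have "((\<lambda>s. w j s * \<mu> j s ^ i) has_integral X i - Y i) {y..x}" for i
      using diff[OF Y X] assms 3 by simp
    note b = w_integral_bounds[OF j 3, where I = "\<lambda>i. X i - Y i", OF this]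
    show ?thesis using b by blast
  qed
qed

lemma alternating_integrals:
  assumes "((\<lambda>s. w 0 s * \<mu> 0 s ^ i) has_integral I0) S" "((\<lambda>s. w 1 s * \<mu> 1 s ^ i) has_integral I1) S"
    "((\<lambda>s. w 2 s * \<mu> 2 s ^ i) has_integral I2) S" and i: "i \<in> {0, 1}"
  shows "I0 - I1 + I2 = 0"
proof -
  have "((\<lambda>s. w 0 s * \<mu> 0 s ^ i - w 1 s * \<mu> 1 s ^ i + w 2 s * \<mu> 2 s ^ i) has_integral I0 - I1 + I2) S"
    by (intro has_integral_add has_integral_diff assms)
  moreover have "w 0 s * \<mu> 0 s ^ i - w 1 s * \<mu> 1 s ^ i + w 2 s * \<mu> 2 s ^ i = 0" for s
    using i w_alternating_sum[of s] by auto
  ultimately have "((\<lambda>s. 0) has_integral I0 - I1 + I2) S" by (simp only:)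
  then show ?thesis using has_integral_unique[OF _ has_integral_0] by blast
qed

lemma oscillation_\<mu>:
  assumes j: "j \<in> {0, 1, 2}" and N: "0 < N" "\<And>k. q (k + int N) = q k"
    and "complete_oscillations (\<mu> j) (lo j) (hi j) (of_nat N) n"
  shows "oscillation (\<mu> j) (w j) (H j) (lo j) (hi j) (of_nat N) n"
proof
  show "continuous_on UNIV (\<mu> j)" using j by (intro continuous_on_\<mu>) auto
  show "lo j \<le> \<mu> j s" "\<mu> j s \<le> hi j" for s using \<mu>_in_band[OF j] by auto
  show "\<mu> j (s + of_nat N) = \<mu> j s" for s
    using trajectory_path_shift[of q "int N" s] N(2) by (simp add: \<mu>_def)
qed (use assms rising_integral[OF j] falling_integral[OF j] in auto)

lemma mix_poly_vertex_0: "mix_poly (q k) (u k) 0 < 0"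
proof -
  have "pos_poly (q k + \<tau> k *\<^sub>R u k) 0 = 0" using on_ellipsoid[of "k + 1"] flight[of k] by simp
  then have "\<tau> k * (2 * mix_poly (q k) (u k) 0 + \<tau> k * dir_poly (u k) 0) = 0"
    unfolding pos_poly_line on_ellipsoid by algebra
  then have "2 * mix_poly (q k) (u k) 0 + \<tau> k * dir_poly (u k) 0 = 0" using \<tau>_pos[of k] by simp
  moreover have "\<tau> k * dir_poly (u k) 0 > 0" using dir_poly_0_pos[OF u_nz] \<tau>_pos[of k] by simp
  ultimately show ?thesis by linarith
qed

lemma right_derivative_nonneg:
  assumes j: "j \<in> {0, 1, 2}" and "\<epsilon> > 0" and \<sigma>: "\<sigma> \<in> {1, - 1}" and "mono_on {of_int k..of_int k + \<epsilon>} (\<lambda>s. \<sigma> * \<mu> j s)"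
  shows "\<sigma> * (mix_poly (q k) (u k) (\<mu> j (of_int k)) * den j (of_int k)) \<le> 0"
proof (rule ccontr)
  let ?x = "of_int k :: real"
  let ?D = "- 2 * (\<tau> k * mix_poly (traj ?x) (u k) (\<mu> j ?x)) / den j ?x"
  assume "\<not> ?thesis"
  then have m: "\<sigma> * (mix_poly (q k) (u k) (\<mu> j ?x) * den j ?x) > 0" by simp
  have "\<sigma> * ?D = - (2 * \<tau> k) * (\<sigma> * (mix_poly (q k) (u k) (\<mu> j ?x) * den j ?x)) / (den j ?x)\<^sup>2"
    using den_nz[OF j, of ?x] by (simp add: path_vertex power2_eq_square)
  also have "\<dots> < 0" using m \<tau>_pos[of k] den_nz[OF j, of ?x] by (intro divide_neg_pos mult_neg_pos) auto
  finally have "\<sigma> * ?D < 0" .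
  moreover have "((\<lambda>s. \<sigma> * \<mu> j s) has_real_derivative \<sigma> * ?D) (at ?x within {?x..?x + 1})"
    by (intro DERIV_cmult \<mu>_deriv j) auto
  ultimately obtain d where d: "d > 0" "\<And>h. h > 0 \<Longrightarrow> ?x + h \<in> {?x..?x + 1} \<Longrightarrow> h < d \<Longrightarrow> \<sigma> * \<mu> j ?x > \<sigma> * \<mu> j (?x + h)"
    using has_real_derivative_neg_dec_right by blast
  define h where "h = min (d / 2) (min 1 \<epsilon>)"
  have h: "h > 0" "h < d" "h \<le> 1" "h \<le> \<epsilon>" using d(1) assms(2) by (auto simp: h_def)
  have "\<sigma> * \<mu> j ?x \<le> \<sigma> * \<mu> j (?x + h)" using h by (intro mono_onD[OF assms(4)]) auto
  then show False using d(2)[of h] h by auto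
qed

text \<open>Both values square to \<open>T\<close> at the same point, so only the sign is in
  question. It is read off from whether the coordinate rises or falls right after the bounce; at a
  turning value both sides are 0.\<close>

lemma mix_poly_same_phase:
  assumes j: "j \<in> {1, 2}" and \<mu>: "\<And>i. i \<in> {0, 1, 2} \<Longrightarrow> \<mu> i (of_int l) = \<mu> i (of_int k)"
    and ph: "\<mu> j (of_int k) = lo j \<or> \<mu> j (of_int k) = hi j \<or>
      (\<exists>\<epsilon>>0. mono_on {of_int k..of_int k + \<epsilon>} (\<mu> j) \<and> mono_on {of_int l..of_int l + \<epsilon>} (\<mu> j) \<or>
        antimono_on {of_int k..of_int k + \<epsilon>} (\<mu> j) \<and> antimono_on {of_int l..of_int l + \<epsilon>} (\<mu> j))"
  shows "mix_poly (q l) (u l) (\<mu> j (of_int k)) = mix_poly (q k) (u k) (\<mu> j (of_int k))"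
proof -
  let ?t = "\<mu> j (of_int k)"
  have j': "j \<in> {0, 1, 2}" using j by auto
  have sq: "(mix_poly (q k) (u k) ?t)\<^sup>2 = T ?t" "(mix_poly (q l) (u l) ?t)\<^sup>2 = T ?t"
    using mix_poly_\<mu>[of "of_int k" k j] mix_poly_\<mu>[of "of_int l" l j] \<mu> j' by (auto simp: path_vertex)
  show ?thesis
  proof (cases "T ?t = 0")
    case True then show ?thesis using sq by simp
  next
    case False
    then obtain \<epsilon> where e: "\<epsilon> > 0" and
      "mono_on {of_int k..of_int k + \<epsilon>} (\<mu> j) \<and> mono_on {of_int l..of_int l + \<epsilon>} (\<mu> j) \<or>
        antimono_on {of_int k..of_int k + \<epsilon>} (\<mu> j) \<and> antimono_on {of_int l..of_int l + \<epsilon>} (\<mu> j)"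
      using ph T_\<mu>_zero_iff[OF j', of "of_int k"] j by auto
    from this(2) obtain \<sigma> :: real where \<sigma>: "\<sigma> \<in> {1, - 1}"
      "mono_on {of_int k..of_int k + \<epsilon>} (\<lambda>s. \<sigma> * \<mu> j s)" "mono_on {of_int l..of_int l + \<epsilon>} (\<lambda>s. \<sigma> * \<mu> j s)"
    proof
      assume m: "mono_on {of_int k..of_int k + \<epsilon>} (\<mu> j) \<and> mono_on {of_int l..of_int l + \<epsilon>} (\<mu> j)"
      show ?thesis by (rule that[of 1]) (use m in auto)
    next
      assume m: "antimono_on {of_int k..of_int k + \<epsilon>} (\<mu> j) \<and> antimono_on {of_int l..of_int l + \<epsilon>} (\<mu> j)"
      show ?thesis by (rule that[of "- 1"]) (use m in \<open>auto simp: monotone_on_def\<close>)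
    qed
    have den: "den j (of_int l) = den j (of_int k)" unfolding den_def using \<mu> j' by (intro prod.cong) auto
    have "\<sigma> * (mix_poly (q k) (u k) ?t * den j (of_int k)) \<le> 0"
      "\<sigma> * (mix_poly (q l) (u l) ?t * den j (of_int k)) \<le> 0"
      using right_derivative_nonneg[OF j' e \<sigma>(1,2)] right_derivative_nonneg[OF j' e \<sigma>(1,3)] \<mu>[OF j'] den by auto
    then have "(\<sigma> * den j (of_int k)) * mix_poly (q k) (u k) ?t \<le> 0"
      "(\<sigma> * den j (of_int k)) * mix_poly (q l) (u l) ?t \<le> 0" by (simp_all add: mult_ac)
    moreover have "\<sigma> * den j (of_int k) \<noteq> 0" using \<sigma>(1) den_nz[OF j', of "of_int k"] by auto
    ultimately have "mix_poly (q k) (u k) ?t * mix_poly (q l) (u l) ?t \<ge> 0"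
      by (auto simp: mult_le_0_iff zero_le_mult_iff linorder_neq_iff)
    moreover have "mix_poly (q k) (u k) ?t = mix_poly (q l) (u l) ?t \<or> mix_poly (q k) (u k) ?t = - mix_poly (q l) (u l) ?t"
      using sq by (metis power2_eq_iff)
    ultimately show ?thesis using sq False by (auto simp: zero_le_mult_iff)
  qed
qed

end

section \<open>Closing after three bounces\<close>

lemma quadratic_zero:
  fixes A B C :: real
  assumes "infinite {s. C + B * s + A * s\<^sup>2 = 0}"
  shows "C + B * s + A * s\<^sup>2 = 0"
  using finite_quadratic_roots[of A B C] assms by (cases "A \<noteq> 0 \<or> B \<noteq> 0 \<or> C \<noteq> 0") auto

lemma quadratic_zero_three_roots:
  fixes A B C x y z :: real
  assumes "C + B * x + A * x\<^sup>2 = 0" "C + B * y + A * y\<^sup>2 = 0" "C + B * z + A * z\<^sup>2 = 0"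
    and "x \<noteq> y" "y \<noteq> z" "x \<noteq> z"
  shows "C + B * s + A * s\<^sup>2 = 0"
proof -
  have "(x - y) * (B + A * (x + y)) = 0" using assms(1,2) by algebra
  moreover have "(x - z) * (B + A * (x + z)) = 0" using assms(1,3) by algebra
  ultimately have e: "B + A * (x + y) = 0" "B + A * (x + z) = 0" using assms(4-6) by auto
  then have "A * (y - z) = 0" by algebra
  then have "A = 0" using assms(5) by simp
  then show ?thesis using e assms(1) by simp
qed

context semi_axes
begin

lemma mix_poly_coeffs:
  obtains A B C where "\<And>t. mix_poly p v t = C + B * t + A * t\<^sup>2"
proof
  show "mix_poly p v t = (p $ 1 * v $ 1 * (b * c) + p $ 2 * v $ 2 * (a * c) + p $ 3 * v $ 3 * (a * b))
     + (- (p $ 1 * v $ 1 * (b + c) + p $ 2 * v $ 2 * (a + c) + p $ 3 * v $ 3 * (a + b))) * t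
     + (p $ 1 * v $ 1 + p $ 2 * v $ 2 + p $ 3 * v $ 3) * t\<^sup>2" for t
    unfolding mix_poly_def by algebra
qed

lemma mix_poly_eqI:
  assumes "mix_poly p v 0 = mix_poly p' v' 0" "mix_poly p v x = mix_poly p' v' x"
    "mix_poly p v y = mix_poly p' v' y" "x \<noteq> 0" "y \<noteq> 0" "x \<noteq> y"
  shows "mix_poly p v t = mix_poly p' v' t"
proof -
  obtain A B C A' B' C' where e: "\<And>t. mix_poly p v t = C + B * t + A * t\<^sup>2"
    "\<And>t. mix_poly p' v' t = C' + B' * t + A' * t\<^sup>2"
    using mix_poly_coeffs by metis
  have "(C - C') + (B - B') * t + (A - A') * t\<^sup>2 = 0"
    by (rule quadratic_zero_three_roots[of _ _ 0 _ x y]) (use assms in \<open>auto simp: e algebra_simps\<close>)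
  then show ?thesis by (simp add: e algebra_simps)
qed

end

context nonsingular
begin

text \<open>Dividing by \<open>g\<close> turns the relation over a period into one for three
  oscillations of the first coordinate. Let \<open>y1\<close> and \<open>y2\<close> be the times at
  which the other two coordinates have made \<open>m1\<close> and \<open>m2\<close> oscillations
  from time 0. The signed integrals from \<open>y1\<close> to 3 and from \<open>y2\<close> to 3 then
  agree, both for exponent 0 (\<open>d\<close>) and exponent 1 (\<open>e\<close>). If
  \<open>d\<close> were nonzero, \<open>e / d\<close> would be a mean of values at most
  \<open>c3\<close> and also of values at least \<open>c4\<close>. So \<open>d = 0\<close>, which
  gives \<open>y1 = y2 = 3\<close>.\<close>

lemma closes_elliptically:
  assumes g: "0 < g" and N: "\<And>k. q (k + int (3 * g)) = q k"
    and o1: "complete_oscillations (\<mu> 1) c2 c3 (of_nat (3 * g)) (g * m1)"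
    and o2: "complete_oscillations (\<mu> 2) c4 a (of_nat (3 * g)) (g * m2)"
  shows "\<mu> 1 3 = \<mu> 1 0" "\<mu> 2 3 = \<mu> 2 0" "mix_poly (q 3) (u 3) t = mix_poly (q 0) (u 0) t"
proof -
  let ?N = "of_nat (3 * g) :: real"
  have N0: "0 < 3 * g" using g by simp
  interpret O1: oscillation "\<mu> 1" "w 1" "H 1" "lo 1" "hi 1" ?N "g * m1"
    by (rule oscillation_\<mu>) (use N N0 o1 in \<open>auto simp: band_simps\<close>)
  interpret O2: oscillation "\<mu> 2" "w 2" "H 2" "lo 2" "hi 2" ?N "g * m2"
    by (rule oscillation_\<mu>) (use N N0 o2 in \<open>auto simp: band_simps\<close>)
  have m: "1 \<le> m1" "1 \<le> m2" using O1.n_pos O2.n_pos by auto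
  define Q where "Q i = 2 * (H 0 i c1 - H 0 i 0)" for i
  have rel: "3 * Q i - of_nat m1 * O1.P i + of_nat m2 * O2.P i = 0" if i: "i \<in> {0, 1}" for i
  proof -
    have "?N * Q i - of_nat (g * m1) * O1.P i + of_nat (g * m2) * O2.P i = 0"
      using alternating_integrals[OF \<mu>0_integral[where n = "3 * g"] _ _ i]
        O1.has_integral_period[where x = 0] O2.has_integral_period[where x = 0] unfolding Q_def by auto
    then have "of_nat g * (3 * Q i - of_nat m1 * O1.P i + of_nat m2 * O2.P i) = 0"
      by (simp add: algebra_simps)
    then show ?thesis using g by simp
  qed
  obtain y1 where y1: "0 \<le> y1" "\<mu> 1 y1 = \<mu> 1 0"
    "\<And>e. ((\<lambda>s. w 1 s * \<mu> 1 s ^ e) has_integral of_nat m1 * O1.P e) {0..y1}"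
    "\<mu> 1 0 = lo 1 \<or> \<mu> 1 0 = hi 1 \<or> (\<exists>\<epsilon>>0. mono_on {0..0 + \<epsilon>} (\<mu> 1) \<and> mono_on {y1..y1 + \<epsilon>} (\<mu> 1)
       \<or> antimono_on {0..0 + \<epsilon>} (\<mu> 1) \<and> antimono_on {y1..y1 + \<epsilon>} (\<mu> 1))"
    by (rule O1.advance[OF m(1), of 0]) (rule that)
  obtain y2 where y2: "0 \<le> y2" "\<mu> 2 y2 = \<mu> 2 0"
    "\<And>e. ((\<lambda>s. w 2 s * \<mu> 2 s ^ e) has_integral of_nat m2 * O2.P e) {0..y2}"
    "\<mu> 2 0 = lo 2 \<or> \<mu> 2 0 = hi 2 \<or> (\<exists>\<epsilon>>0. mono_on {0..0 + \<epsilon>} (\<mu> 2) \<and> mono_on {y2..y2 + \<epsilon>} (\<mu> 2)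
       \<or> antimono_on {0..0 + \<epsilon>} (\<mu> 2) \<and> antimono_on {y2..y2 + \<epsilon>} (\<mu> 2))"
    by (rule O2.advance[OF m(2), of 0]) (rule that)
  have le: "0 + ?N \<ge> 3" using g by simp
  define X1 where "X1 i = integral {0..3} (\<lambda>s. w 1 s * \<mu> 1 s ^ i)" for i
  define X2 where "X2 i = integral {0..3} (\<lambda>s. w 2 s * \<mu> 2 s ^ i)" for i
  have X1: "((\<lambda>s. w 1 s * \<mu> 1 s ^ i) has_integral X1 i) {0..3}" for i
    unfolding X1_def
    by (intro integrable_integral integrable_on_subinterval[OF has_integral_integrable[OF O1.has_integral_period[of i 0]]])
      (use le in auto)
  have X2: "((\<lambda>s. w 2 s * \<mu> 2 s ^ i) has_integral X2 i) {0..3}" for i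
    unfolding X2_def
    by (intro integrable_integral integrable_on_subinterval[OF has_integral_integrable[OF O2.has_integral_period[of i 0]]])
      (use le in auto)
  have rel3: "3 * Q i - X1 i + X2 i = 0" if i: "i \<in> {0, 1}" for i
    using alternating_integrals[OF _ X1 X2 i] \<mu>0_integral[where n = 3, of i] unfolding Q_def by auto
  have eq: "X1 i - of_nat m1 * O1.P i = X2 i - of_nat m2 * O2.P i" if i: "i \<in> {0, 1}" for i
    using rel[OF i] rel3[OF i] by linarith
  have c1: "3 = y1 \<and> X1 0 - of_nat m1 * O1.P 0 = 0
    \<or> 0 < X1 0 - of_nat m1 * O1.P 0 \<and> X1 1 - of_nat m1 * O1.P 1 \<le> c3 * (X1 0 - of_nat m1 * O1.P 0)
    \<or> 0 < of_nat m1 * O1.P 0 - X1 0 \<and> of_nat m1 * O1.P 1 - X1 1 \<le> c3 * (of_nat m1 * O1.P 0 - X1 0)"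
    using w_integral_compare[OF _ _ y1(1) X1 y1(3)] unfolding band_simps by auto
  have c2: "3 = y2 \<and> X2 0 - of_nat m2 * O2.P 0 = 0
    \<or> 0 < X2 0 - of_nat m2 * O2.P 0 \<and> c4 * (X2 0 - of_nat m2 * O2.P 0) \<le> X2 1 - of_nat m2 * O2.P 1
    \<or> 0 < of_nat m2 * O2.P 0 - X2 0 \<and> c4 * (of_nat m2 * O2.P 0 - X2 0) \<le> of_nat m2 * O2.P 1 - X2 1"
    using w_integral_compare[OF _ _ y2(1) X2 y2(3)] unfolding band_simps by auto
  define d e where "d = X1 0 - of_nat m1 * O1.P 0" and "e = X1 1 - of_nat m1 * O1.P 1"
  have dd: "X2 0 - of_nat m2 * O2.P 0 = d" "X2 1 - of_nat m2 * O2.P 1 = e"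
    using eq[of 0] eq[of 1] by (auto simp: d_def e_def)
  have c1': "3 = y1 \<and> d = 0 \<or> 0 < d \<and> e \<le> c3 * d \<or> d < 0 \<and> c3 * d \<le> e"
    using c1 unfolding d_def e_def by (auto simp: algebra_simps)
  have c2': "3 = y2 \<and> d = 0 \<or> 0 < d \<and> c4 * d \<le> e \<or> d < 0 \<and> e \<le> c4 * d"
    using c2 unfolding dd[symmetric] by (auto simp: algebra_simps)
  have "\<not> d > 0"
  proof
    assume "d > 0"
    then have "c4 * d \<le> c3 * d" using c1' c2' by linarith
    then show False using \<open>d > 0\<close> c_order by simp
  qed
  moreover have "\<not> d < 0"
  proof
    assume "d < 0"
    then have "c3 * d \<le> c4 * d" using c1' c2' by linarith
    then show False using \<open>d < 0\<close> c_order by (simp add: mult_le_cancel_right)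
  qed
  ultimately have y3: "y1 = 3" "y2 = 3" using c1' c2' by auto
  show m1: "\<mu> 1 3 = \<mu> 1 0" and m2: "\<mu> 2 3 = \<mu> 2 0" using y1(2) y2(2) y3 by auto
  have m0: "\<mu> 0 3 = \<mu> 0 0" using \<mu>0_vertex[of 3] \<mu>0_vertex[of 0] by simp
  have all: "\<mu> i (of_int 3) = \<mu> i (of_int 0)" if "i \<in> {0, 1, 2}" for i
    using that m0 m1 m2 by auto
  have p1: "mix_poly (q 3) (u 3) (\<mu> 1 0) = mix_poly (q 0) (u 0) (\<mu> 1 0)"
    using mix_poly_same_phase[of 1 3 0] all y1(4) y3 by auto
  have p2: "mix_poly (q 3) (u 3) (\<mu> 2 0) = mix_poly (q 0) (u 0) (\<mu> 2 0)"
    using mix_poly_same_phase[of 2 3 0] all y2(4) y3 by auto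
  have "(mix_poly (q k) (u k) 0)\<^sup>2 = T 0" for k
    using discriminant_identity[of "q k" "u k" 0] by (simp add: on_ellipsoid caustic_poly_eq T_eq)
  then have "mix_poly (q 3) (u 3) 0 = mix_poly (q 0) (u 0) 0"
    using mix_poly_vertex_0[of 3] mix_poly_vertex_0[of 0] by (metis less_asym neg_0_less_iff_less power2_eq_iff)
  then show "mix_poly (q 3) (u 3) t = mix_poly (q 0) (u 0) t"
    by (rule mix_poly_eqI[OF _ p1 p2]) (use \<mu>_bands[of 0] \<mu>_order[of 0] c_order in auto)
qed

end

section \<open>Two by two matrices and the trace cubic\<close>

type_synonym mat2 = "real \<times> real \<times> real \<times> real"

fun mat2_mult :: "mat2 \<Rightarrow> mat2 \<Rightarrow> mat2" where
  "mat2_mult (p, r, s, t) (p', r', s', t') = (p * p' + r * s', p * r' + r * t', s * p' + t * s', s * r' + t * t')"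

fun mat2_trace :: "mat2 \<Rightarrow> real" where "mat2_trace (p, r, s, t) = p + t"

fun mat2_det :: "mat2 \<Rightarrow> real" where "mat2_det (p, r, s, t) = p * t - r * s"

text \<open>The triple \<open>(g, h, k)\<close> stands for the symmetric matrix \<open>G\<close> with rows \<open>(g, h)\<close> and \<open>(h, k)\<close>,
  and \<open>congr M\<close> is \<open>G \<mapsto> M G M\<^sup>T\<close>.\<close>

fun congr :: "mat2 \<Rightarrow> real \<times> real \<times> real \<Rightarrow> real \<times> real \<times> real" where
  "congr (p, r, s, t) (g, h, k) =
    (p\<^sup>2 * g + 2 * p * r * h + r\<^sup>2 * k, p * s * g + (p * t + r * s) * h + r * t * k,
     s\<^sup>2 * g + 2 * s * t * h + t\<^sup>2 * k)"

lemma congr_mult: "congr (mat2_mult A B) G = congr A (congr B G)"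
proof -
  obtain p r s t p' r' s' t' g h k where e: "A = (p, r, s, t)" "B = (p', r', s', t')" "G = (g, h, k)"
    by (metis prod.collapse)
  show ?thesis unfolding e by (simp; algebra)
qed

lemma mat2_det_mult: "mat2_det (mat2_mult A B) = mat2_det A * mat2_det B"
proof -
  obtain p r s t p' r' s' t' where e: "A = (p, r, s, t)" "B = (p', r', s', t')"
    by (metis prod.collapse)
  show ?thesis unfolding e by (simp; algebra)
qed

text \<open>The rank one form is \<open>\<plusminus>w w\<^sup>T\<close> for an eigenvector \<open>w\<close> with
  eigenvalue \<open>\<plusminus>1\<close>.\<close>

lemma trace_of_congr_fixed:
  assumes "mat2_det M = 1" "congr M (g, h, k) = (g, h, k)" "h\<^sup>2 = g * k" "g \<noteq> 0 \<or> h \<noteq> 0 \<or> k \<noteq> 0"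
  shows "(mat2_trace M)\<^sup>2 = 4"
proof -
  obtain p r s t where M: "M = (p, r, s, t)" by (metis prod.collapse)
  have d: "p * t - r * s = 1" using assms(1) M by simp
  have e: "p\<^sup>2 * g + 2 * p * r * h + r\<^sup>2 * k = g" "p * s * g + (p * t + r * s) * h + r * t * k = h"
    "s\<^sup>2 * g + 2 * s * t * h + t\<^sup>2 * k = k"
    using assms(2) M by auto
  have "(p + t)\<^sup>2 = 4"
  proof (cases "g = 0")
    case True
    then have "h = 0" "k \<noteq> 0" using assms(3,4) by auto
    then have "r = 0" "t\<^sup>2 = 1" using e True by auto
    then show ?thesis using d by algebra
  next
    case False
    \<comment> \<open>\<open>(x, y)\<close> is \<open>M\<close> applied to the first column of the
      rank one form, which spans its range.\<close>
    define x y where "x = p * g + r * h" and "y = s * g + t * h"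
    have "x\<^sup>2 = g * (p\<^sup>2 * g + 2 * p * r * h + r\<^sup>2 * k) + r\<^sup>2 * (h\<^sup>2 - g * k)" unfolding x_def by algebra
    then have "x\<^sup>2 = g\<^sup>2" unfolding e(1) assms(3) by (simp add: power2_eq_square)
    moreover have "x * y = g * (p * s * g + (p * t + r * s) * h + r * t * k) + r * t * (h\<^sup>2 - g * k)"
      unfolding x_def y_def by algebra
    then have xy: "x * y = g * h" unfolding e(2) assms(3) by simp
    ultimately obtain \<sigma> where \<sigma>: "\<sigma>\<^sup>2 = 1" "x = \<sigma> * g"
      by (metis mult_1 mult_minus_left power2_eq_iff power2_minus power_one)
    have "g * (y - \<sigma> * h) = 0" using \<sigma> xy by algebra
    then have y: "y = \<sigma> * h" using False by simp
    have "g * (1 - \<sigma> * (p + t) + 1) = 0"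
      using \<sigma> y d unfolding x_def y_def by algebra
    then have "\<sigma> * (p + t) = 2" using False by simp
    moreover have "(p + t)\<^sup>2 = (\<sigma> * (p + t))\<^sup>2" using \<sigma>(1) by (simp add: power_mult_distrib)
    ultimately show ?thesis by simp
  qed
  then show ?thesis by (simp add: M)
qed

text \<open>Position and direction of one coordinate after a flight of length \<open>t\<close> followed by a
  reflection of strength \<open>n\<close>.\<close>

definition step_mat :: "real \<Rightarrow> real \<Rightarrow> mat2" where
  "step_mat t n = (1, t, - n, 1 - n * t)"

text \<open>\<open>e\<close> stands for \<open>1/t\<close>. Of the coefficients only the sign of the
  leading one is recorded; the values +2 and -2 at five points determine the rest.\<close>

lemma trace_three_steps:
  assumes "t0 > 0" "t1 > 0" "t2 > 0" "n1 > 0" "n2 > 0" "n3 > 0"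
  obtains A B C where "C > (0 :: real)" "\<And>e. mat2_trace (mat2_mult (step_mat t2 (n3 * e))
      (mat2_mult (step_mat t1 (n2 * e)) (step_mat t0 (n1 * e)))) = 2 - A * e + B * e\<^sup>2 - C * e ^ 3"
proof
  show "t0 * t1 * t2 * n1 * n2 * n3 > 0" using assms by simp
  show "mat2_trace (mat2_mult (step_mat t2 (n3 * e)) (mat2_mult (step_mat t1 (n2 * e)) (step_mat t0 (n1 * e))))
    = 2 - ((t0 + t1 + t2) * (n1 + n2 + n3)) * e
      + (n1 * n2 * t1 * (t2 + t0) + n2 * n3 * t2 * (t0 + t1) + n1 * n3 * t0 * (t1 + t2)) * e\<^sup>2
      - (t0 * t1 * t2 * n1 * n2 * n3) * e ^ 3" for e
    unfolding step_mat_def by (simp; algebra)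
qed

text \<open>Besides 0, \<open>f - 2\<close> has at most two positive zeros, and \<open>f + 2\<close>
  has at most three, so the five points split into two \<open>x < y\<close> and three
  \<open>u < v < w\<close>. The two cubics differ by a constant, and Vieta gives z (z - x) (z - y) =
  (z - u) (z - v) (z - w) + u v w. Signs in this identity force u < v < x < y < w, which leaves a
  single assignment.\<close>

lemma cubic_pattern:
  fixes A B C :: real
  defines "f \<equiv> \<lambda>e. 2 - A * e + B * e\<^sup>2 - C * e ^ 3"
  assumes C: "C > 0" and e: "0 < e5" "e5 < e4" "e4 < e3" "e3 < e2" "e2 < e1"
    and sq: "(f e1)\<^sup>2 = 4" "(f e2)\<^sup>2 = 4" "(f e3)\<^sup>2 = 4" "(f e4)\<^sup>2 = 4" "(f e5)\<^sup>2 = 4"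
  shows "e2 + e3 = e1 + e4 + e5" "e2 * e3 = e1 * e4 + e1 * e5 + e4 * e5"
proof -
  have pm: "f x = 2 \<or> f x = - 2" if "(f x)\<^sup>2 = 4" for x
  proof -
    have "(f x - 2) * (f x + 2) = 0" using that by (simp add: power2_eq_square algebra_simps)
    then show ?thesis by auto
  qed
  have two: "B = C * (x + y) \<and> A = C * (x * y)" if "0 < x" "x < y" "f x = 2" "f y = 2" for x y
  proof -
    have "z * (A - B * z + C * z\<^sup>2) = 2 - f z" for z unfolding f_def by algebra
    then have "x * (A - B * x + C * x\<^sup>2) = 0" "y * (A - B * y + C * y\<^sup>2) = 0" using that(3,4) by auto
    then have 1: "A - B * x + C * x\<^sup>2 = 0" "A - B * y + C * y\<^sup>2 = 0" using that by auto
    then have "(x - y) * (B - C * (x + y)) = 0" by algebra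
    then have "B = C * (x + y)" using that by auto
    then show ?thesis using 1 by algebra
  qed
  have three: "B = C * (u + v + w) \<and> A = C * (u * v + u * w + v * w) \<and> 4 = C * (u * v * w)"
    if "0 < u" "u < v" "v < w" "f u = - 2" "f v = - 2" "f w = - 2" for u v w
  proof -
    have "(x - y) * (- A + B * (x + y) - C * (x\<^sup>2 + x * y + y\<^sup>2)) = f x - f y" for x y
      unfolding f_def by algebra
    then have "(u - v) * (- A + B * (u + v) - C * (u\<^sup>2 + u * v + v\<^sup>2)) = 0"
      "(u - w) * (- A + B * (u + w) - C * (u\<^sup>2 + u * w + w\<^sup>2)) = 0"
      using that(4-6) by auto
    then have 1: "- A + B * (u + v) - C * (u\<^sup>2 + u * v + v\<^sup>2) = 0" "- A + B * (u + w) - C * (u\<^sup>2 + u * w + w\<^sup>2) = 0"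
      using that by auto
    then have "(v - w) * (B - C * (u + v + w)) = 0" by algebra
    then have B: "B = C * (u + v + w)" using that by auto
    then have A: "A = C * (u * v + u * w + v * w)" using 1 by algebra
    have "4 = C * (u * v * w)" using that(4) A B unfolding f_def by algebra
    then show ?thesis using A B by blast
  qed
  have no3: "\<not> (f x = 2 \<and> f y = 2 \<and> f z = 2)" if "0 < x" "x < y" "y < z" for x y z
    using two[of x y] two[of x z] that C by auto
  have no4: "\<not> (f x = - 2 \<and> f y = - 2 \<and> f z = - 2 \<and> f s = - 2)" if "0 < x" "x < y" "y < z" "z < s" for x y z s
    using three[of x y z] three[of x y s] that C by auto
  have pat: "v < x \<and> y < w \<and> x + y = u + v + w \<and> x * y = u * v + u * w + v * w"
    if o: "0 < x" "x < y" "0 < u" "u < v" "v < w" and "f x = 2" "f y = 2" "f u = - 2" "f v = - 2" "f w = - 2"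
    for x y u v w
  proof -
    have s: "x + y = u + v + w" "x * y = u * v + u * w + v * w"
      using two[of x y] three[of u v w] that C by auto
    have id: "z * (z - x) * (z - y) = (z - u) * (z - v) * (z - w) + u * v * w" for z using s by algebra
    have p: "u * v * w > 0" using o by simp
    have out: "z < x \<or> y < z" if "z \<in> {u, v, w}" for z
    proof (rule ccontr)
      assume h: "\<not> ?thesis"
      have "z * (z - x) * (z - y) > 0" using id[of z] p that by auto
      moreover have "z * (z - x) * (z - y) \<le> 0" using h o that by (intro mult_nonneg_nonpos mult_nonneg_nonneg) auto
      ultimately show False by linarith
    qed
    have "(x - u) * (x - v) * (x - w) < 0" using id[of x] p by simp
    then have "\<not> (w < x)" using o by (auto simp: mult_less_0_iff)
    then have "y < w" using out[of w] by auto
    moreover have "\<not> y < v" using s(1) o calculation by linarith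
    ultimately show ?thesis using out[of v] s by auto
  qed
  note cs = pm[OF sq(1)] pm[OF sq(2)] pm[OF sq(3)] pm[OF sq(4)] pm[OF sq(5)]
  have o: "0 < e4" "0 < e3" "0 < e2" "0 < e1" "e5 < e3" "e5 < e2" "e5 < e1" "e4 < e2" "e4 < e1" "e3 < e1"
    using e by auto
  have "f e2 = 2 \<and> f e3 = 2 \<and> f e1 = - 2 \<and> f e4 = - 2 \<and> f e5 = - 2"
    using cs
      no3[of e5 e4 e3] no3[of e5 e4 e2] no3[of e5 e4 e1] no3[of e5 e3 e2] no3[of e5 e3 e1] no3[of e5 e2 e1]
      no3[of e4 e3 e2] no3[of e4 e3 e1] no3[of e4 e2 e1] no3[of e3 e2 e1]
      no4[of e5 e4 e3 e2] no4[of e5 e4 e3 e1] no4[of e5 e4 e2 e1] no4[of e5 e3 e2 e1] no4[of e4 e3 e2 e1]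
      pat[of e5 e4 e3 e2 e1] pat[of e5 e3 e4 e2 e1] pat[of e5 e2 e4 e3 e1] pat[of e5 e1 e4 e3 e2]
      pat[of e4 e3 e5 e2 e1] pat[of e4 e2 e5 e3 e1] pat[of e4 e1 e5 e3 e2] pat[of e3 e1 e5 e4 e2]
      pat[of e2 e1 e5 e4 e3] e o by argo
  then have "e3 + e2 = e5 + e4 + e1 \<and> e3 * e2 = e5 * e4 + e5 * e1 + e4 * e1"
    using pat[of e3 e2 e5 e4 e1] e o by auto
  then show "e2 + e3 = e1 + e4 + e5" "e2 * e3 = e1 * e4 + e1 * e5 + e4 * e5" by (auto simp: algebra_simps)
qed

context billiard
begin

definition G :: "int \<Rightarrow> real \<Rightarrow> real \<times> real \<times> real" where
  "G k z = (- pos_poly (q k) z, mix_poly (q k) (u k) z, dir_poly (u k) z)"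

lemma G_step:
  assumes "z \<noteq> 0"
  shows "G (k + 1) z = congr (step_mat (\<tau> k) (\<nu> (k + 1) / z)) (G k z)"
proof -
  have "2 * (u k \<bullet> normal (q (k + 1))) = \<nu> (k + 1) * (normal (q (k + 1)) \<bullet> normal (q (k + 1)))"
    "u (k + 1) = u k - \<nu> (k + 1) *\<^sub>R normal (q (k + 1))"
    using reflection_angle[of "k + 1"] reflection[of "k + 1"] by simp_all
  note r = reflection_step[OF on_ellipsoid this assms]
  have p: "pos_poly (q (k + 1)) z = pos_poly (q k) z - 2 * \<tau> k * mix_poly (q k) (u k) z - (\<tau> k)\<^sup>2 * dir_poly (u k) z"
    "mix_poly (q (k + 1)) (u k) z = mix_poly (q k) (u k) z + \<tau> k * dir_poly (u k) z"
    unfolding flight by (rule pos_poly_line mix_poly_line)+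
  show ?thesis unfolding G_def r unfolding p step_mat_def by (simp; algebra)
qed

end

context nonsingular
begin

lemma caustic_relation:
  assumes "\<And>t. pos_poly (q 3) t = pos_poly (q 0) t" "\<And>t. mix_poly (q 3) (u 3) t = mix_poly (q 0) (u 0) t"
  shows "1 / c2 + 1 / c3 = 1 / c1 + 1 / c4 + 1 / a"
    "1 / c2 * (1 / c3) = 1 / c1 * (1 / c4) + 1 / c1 * (1 / a) + 1 / c4 * (1 / a)"
proof -
  have disc: "(mix_poly (q k) (u k) t)\<^sup>2 + dir_poly (u k) t * pos_poly (q k) t = T t" for k t
    by (simp add: discriminant_identity caustic_poly_eq T_eq)
  \<comment> \<open>The discriminant identity determines the product of \<open>dir_poly\<close> and
    \<open>pos_poly\<close>. So the two direction polynomials agree off three points and, being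
    quadratic, everywhere.\<close>
  have dir: "dir_poly (u 3) t = dir_poly (u 0) t" for t
  proof -
    have m: "dir_poly v = mix_poly v v" for v by (rule ext) (rule mix_poly_self[symmetric])
    obtain A B C A' B' C' where e: "\<And>t. dir_poly (u 3) t = C + B * t + A * t\<^sup>2"
      "\<And>t. dir_poly (u 0) t = C' + B' * t + A' * t\<^sup>2"
      unfolding m using mix_poly_coeffs by metis
    have "dir_poly (u 3) t = dir_poly (u 0) t" if "t \<in> UNIV - {\<mu> 0 0, \<mu> 1 0, \<mu> 2 0}" for t
    proof -
      have "pos_poly (q 0) t \<noteq> 0" using that pos_poly_\<mu>[of 0 t] path_vertex[of 0] by auto
      moreover have "(dir_poly (u 3) t - dir_poly (u 0) t) * pos_poly (q 0) t = 0"
        using disc[of 3 t] disc[of 0 t] unfolding assms left_diff_distrib by linarith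
      ultimately show ?thesis by simp
    qed
    then have sub: "UNIV - {\<mu> 0 0, \<mu> 1 0, \<mu> 2 0} \<subseteq> {t. (C - C') + (B - B') * t + (A - A') * t\<^sup>2 = 0}"
      by (auto simp: e algebra_simps)
    have "infinite (UNIV - {\<mu> 0 0, \<mu> 1 0, \<mu> 2 0} :: real set)"
      by (intro Diff_infinite_finite infinite_UNIV_char_0) auto
    then have "infinite {t. (C - C') + (B - B') * t + (A - A') * t\<^sup>2 = 0}"
      using sub finite_subset by blast
    from quadratic_zero[OF this, of t] show ?thesis by (simp add: e algebra_simps)
  qed
  obtain A B C where C: "C > 0" and tr: "\<And>e. mat2_trace (mat2_mult (step_mat (\<tau> 2) (\<nu> 3 * e))
      (mat2_mult (step_mat (\<tau> 1) (\<nu> 2 * e)) (step_mat (\<tau> 0) (\<nu> 1 * e)))) = 2 - A * e + B * e\<^sup>2 - C * e ^ 3"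
    using trace_three_steps[OF \<tau>_pos[of 0] \<tau>_pos[of 1] \<tau>_pos[of 2] \<nu>_pos[of 1] \<nu>_pos[of 2] \<nu>_pos[of 3]] by metis
  have sq: "(2 - A * (1 / z) + B * (1 / z)\<^sup>2 - C * (1 / z) ^ 3)\<^sup>2 = 4" if z: "T z = 0" for z
  proof -
    have z0: "z \<noteq> 0" using z c_order by (auto simp: T_zero_iff)
    let ?M = "mat2_mult (step_mat (\<tau> 2) (\<nu> 3 / z)) (mat2_mult (step_mat (\<tau> 1) (\<nu> 2 / z)) (step_mat (\<tau> 0) (\<nu> 1 / z)))"
    have "G 3 z = G 0 z" by (simp add: G_def assms dir)
    moreover have "G 3 z = congr ?M (G 0 z)"
      using G_step[OF z0, of 0] G_step[OF z0, of 1] G_step[OF z0, of 2] by (simp add: congr_mult)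
    ultimately have fixed: "congr ?M (- pos_poly (q 0) z, mix_poly (q 0) (u 0) z, dir_poly (u 0) z)
        = (- pos_poly (q 0) z, mix_poly (q 0) (u 0) z, dir_poly (u 0) z)" by (simp add: G_def)
    have "(mat2_trace ?M)\<^sup>2 = 4"
    proof (rule trace_of_congr_fixed[OF _ fixed])
      show "mat2_det ?M = 1" by (simp only: mat2_det_mult) (simp add: step_mat_def)
      show "(mix_poly (q 0) (u 0) z)\<^sup>2 = - pos_poly (q 0) z * dir_poly (u 0) z"
        using disc[of 0 z] z by (simp add: algebra_simps)
    qed (use rank_one_vertex[OF z, of 0] in auto)
    then show ?thesis using tr[of "1 / z"] by simp
  qed
  have o: "0 < 1 / a" "1 / a < 1 / c4" "1 / c4 < 1 / c3" "1 / c3 < 1 / c2" "1 / c2 < 1 / c1"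
    using c_order by (auto intro!: divide_strict_left_mono)
  note cp = cubic_pattern[OF C o sq sq sq sq sq]
  show "1 / c2 + 1 / c3 = 1 / c1 + 1 / c4 + 1 / a"
    "1 / c2 * (1 / c3) = 1 / c1 * (1 / c4) + 1 / c1 * (1 / a) + 1 / c4 * (1 / a)"
    by (rule cp; simp add: T_zero_iff)+
qed

end

section \<open>The caustic types\<close>

definition caustic_rel :: "real \<Rightarrow> real \<Rightarrow> real \<Rightarrow> real \<Rightarrow> real \<Rightarrow> bool" where
  "caustic_rel x1 x2 x3 x4 x5 \<longleftrightarrow>
     (x1 + x4 + x5) * (x2 * x3) = x1 * x4 * x5 \<and>
     (x1 + x4 + x5) * (x2 + x3) = x1 * x4 + x1 * x5 + x4 * x5"

lemma caustic_rel_poly: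
  "caustic_rel x1 x2 x3 x4 x5 \<longleftrightarrow>
     (\<forall>t. t ^ 3 - (t - x1) * (t - x4) * (t - x5) = (x1 + x4 + x5) * ((t - x2) * (t - x3)))" (is "_ \<longleftrightarrow> (\<forall>t. ?P t)")
proof
  assume r: "caustic_rel x1 x2 x3 x4 x5"
  show "\<forall>t. ?P t"
  proof
    fix t
    have "t ^ 3 - (t - x1) * (t - x4) * (t - x5) - (x1 + x4 + x5) * ((t - x2) * (t - x3))
      = ((x1 + x4 + x5) * (x2 + x3) - (x1 * x4 + x1 * x5 + x4 * x5)) * t
        - ((x1 + x4 + x5) * (x2 * x3) - x1 * x4 * x5)" by algebra
    then show "?P t" using r unfolding caustic_rel_def by simp
  qed
next
  assume "\<forall>t. ?P t"
  then have "?P 0" "?P 1" by blast+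
  then show "caustic_rel x1 x2 x3 x4 x5"
    unfolding caustic_rel_def by (simp_all add: algebra_simps)
qed

lemma caustic_rel_roots:
  assumes "caustic_rel x1 x2 x3 x4 x5"
  shows "x2 ^ 3 = (x2 - x1) * (x2 - x4) * (x2 - x5)" "x3 ^ 3 = (x3 - x1) * (x3 - x4) * (x3 - x5)"
proof -
  note p = assms[unfolded caustic_rel_poly, rule_format]
  show "x2 ^ 3 = (x2 - x1) * (x2 - x4) * (x2 - x5)" "x3 ^ 3 = (x3 - x1) * (x3 - x4) * (x3 - x5)"
    using p[of x2] p[of x3] by simp_all
qed

text \<open>In the inverses, the relation is the pair of symmetric function identities produced by
  the trace cubic. The two conditions on sums are equivalent only modulo the condition on
  products.\<close>

lemma caustic_rel_inverse:
  assumes "x1 > 0" "x2 > 0" "x3 > 0" "x4 > 0" "x5 > 0"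
  shows "caustic_rel x1 x2 x3 x4 x5 \<longleftrightarrow>
    1 / x2 + 1 / x3 = 1 / x1 + 1 / x4 + 1 / x5 \<and>
    1 / x2 * (1 / x3) = 1 / x1 * (1 / x4) + 1 / x1 * (1 / x5) + 1 / x4 * (1 / x5)" (is "_ \<longleftrightarrow> ?A \<and> ?B")
proof -
  let ?K = "x1 + x4 + x5" and ?E = "x1 * x4 + x1 * x5 + x4 * x5"
  have B: "?B \<longleftrightarrow> ?K * (x2 * x3) = x1 * x4 * x5"
    using assms by (simp add: divide_simps) (auto simp: algebra_simps)
  have A: "?A \<longleftrightarrow> x1 * x4 * x5 * (x2 + x3) = ?E * (x2 * x3)"
    using assms by (simp add: divide_simps) (auto simp: algebra_simps)
  have "?A \<longleftrightarrow> ?K * (x2 + x3) = ?E" if e: "?K * (x2 * x3) = x1 * x4 * x5"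
  proof -
    have "x1 * x4 * x5 * (x2 + x3) - ?E * (x2 * x3) = (x2 * x3) * (?K * (x2 + x3) - ?E)"
      using e by algebra
    then show ?thesis unfolding A using assms by (metis mult_eq_0_iff eq_iff_diff_eq_0 less_irrefl)
  qed
  then show ?thesis unfolding caustic_rel_def B by blast
qed

lemma less_iff_square_less: "(y :: real) \<ge> 0 \<Longrightarrow> y < x \<longleftrightarrow> 0 < x \<and> y\<^sup>2 < x\<^sup>2"
  by (metis abs_of_nonneg abs_of_pos le_less_trans less_imp_le power2_less_imp_less power_strict_mono zero_less_numeral)

context semi_axes
begin

text \<open>Since \<open>c\<close> is one of the two middle parameters, the cubic identity at
  \<open>c\<close> determines \<open>l1\<close>, and the product condition then gives
  \<open>l2\<close>. The two halves of the squared condition \<open>C\<close> are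
  \<open>0 < l1\<close> and \<open>c < l2\<close>; the bounds \<open>l1 < c\<close> and
  \<open>l2 < b\<close> hold automatically.\<close>

lemma EH1_iff:
  "(\<exists>l1 l2. 0 < l1 \<and> l1 < c \<and> c < l2 \<and> l2 < b \<and> caustic_rel l1 c l2 b a) \<longleftrightarrow>
     c < a * b / (a + b + sqrt (a * b))"
proof -
  define p s D where "p = a * b" and "s = a + b" and "D = (b - c) * (a - c)"
  have pos: "p > 0" "s > 0" "D > 0" using a0 b0 cb ca by (simp_all add: p_def s_def D_def)
  have D: "D = p - s * c + c\<^sup>2" unfolding D_def p_def s_def by algebra
  have pc: "c\<^sup>2 < p" using mult_strict_mono[OF ca cb] c0 b0 a0 by (simp add: p_def power2_eq_square)
  have "c < a * b / (a + b + sqrt (a * b)) \<longleftrightarrow> c * sqrt p < p - s * c"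
    unfolding p_def[symmetric] s_def[symmetric] using pos by (simp add: pos_less_divide_eq add_pos_pos algebra_simps)
  also have "\<dots> \<longleftrightarrow> 0 < p - s * c \<and> c\<^sup>2 * p < (p - s * c)\<^sup>2"
    using less_iff_square_less[of "c * sqrt p" "p - s * c"] c0 pos by (simp add: power_mult_distrib)
  finally have C: "c < a * b / (a + b + sqrt (a * b)) \<longleftrightarrow> 0 < p - s * c \<and> c\<^sup>2 * p < (p - s * c)\<^sup>2" .
  have id: "c * ((p - s * c)\<^sup>2 - c\<^sup>2 * p) = l1 * D * (p - c\<^sup>2) - c\<^sup>2 * s * D" if "l1 * D = c * (p - s * c)" for l1
    using that unfolding D by algebra
  show ?thesis unfolding C
  proof (intro iffI; (elim exE conjE)?)
    fix l1 l2 assume l: "0 < l1" "l1 < c" "c < l2" "l2 < b" and r: "caustic_rel l1 c l2 b a"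
    have "c ^ 3 = (c - l1) * (c - b) * (c - a)" by (rule caustic_rel_roots[OF r])
    then have lD: "l1 * D = c * (p - s * c)" unfolding D_def p_def s_def by algebra
    then have 1: "0 < p - s * c" using l(1) pos c0 by (metis mult_pos_pos zero_less_mult_pos)
    have "(l1 + s) * (c * l2) = l1 * p" using r unfolding caustic_rel_def p_def s_def by (simp add: algebra_simps)
    moreover have "(l1 + s) * (c * c) < (l1 + s) * (c * l2)" using l pos c0 by simp
    ultimately have "l1 * (p - c\<^sup>2) - c\<^sup>2 * s > 0" by (simp add: algebra_simps power2_eq_square)
    then have "(l1 * (p - c\<^sup>2) - c\<^sup>2 * s) * D > 0" using pos(3) by (rule mult_pos_pos)
    then have "c * ((p - s * c)\<^sup>2 - c\<^sup>2 * p) > 0" unfolding id[OF lD] by (simp add: algebra_simps)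
    then show "0 < p - s * c \<and> c\<^sup>2 * p < (p - s * c)\<^sup>2" using 1 c0 by (simp add: zero_less_mult_iff)
  next
    assume h: "0 < p - s * c" "c\<^sup>2 * p < (p - s * c)\<^sup>2"
    define l1 where "l1 = c * (p - s * c) / D"
    define l2 where "l2 = l1 * p / (c * (l1 + s))"
    have lD: "l1 * D = c * (p - s * c)" using pos by (simp add: l1_def)
    have l10: "l1 > 0" using h c0 pos by (simp add: l1_def)
    have "(c - l1) * D = c ^ 3" using lD unfolding D by algebra
    then have l1c: "l1 < c" using c0 pos by (metis diff_gt_0_iff_gt zero_less_mult_pos2 zero_less_power)
    have l2e: "(l1 + s) * (c * l2) = l1 * p" using l10 pos c0 by (simp add: l2_def)
    have "(l1 * (p - c\<^sup>2) - c\<^sup>2 * s) * D = c * ((p - s * c)\<^sup>2 - c\<^sup>2 * p)" unfolding id[OF lD] by (simp add: algebra_simps)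
    also have "\<dots> > 0" using h c0 by simp
    finally have "l1 * (p - c\<^sup>2) - c\<^sup>2 * s > 0" using pos by (simp add: zero_less_mult_iff)
    then have "(l1 + s) * (c * c) < (l1 + s) * (c * l2)" unfolding l2e by (simp add: algebra_simps power2_eq_square)
    then have cl2: "c < l2" using l10 pos c0 by (simp add: mult_less_cancel_left_pos add_pos_pos)
    have "l1 * (a - c) < c * a" using l1c l10 ca a0 c0 by (smt (verit) mult_strict_mono mult_less_cancel_left_pos)
    moreover have "c * (l1 + a + b) - l1 * a = (c * a - l1 * (a - c)) + c * b" by algebra
    moreover have "c * b > 0" using b0 c0 by simp
    ultimately have "l1 * a < c * (l1 + a + b)" by linarith
    then have "l1 * a * b < c * (l1 + a + b) * b" using b0 by simp
    then have "(l1 + s) * c * l2 < (l1 + s) * c * b" using l2e by (simp add: p_def s_def algebra_simps)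
    then have l2b: "l2 < b" using l10 pos c0 by (simp add: mult_less_cancel_left_pos add_pos_pos)
    have "caustic_rel l1 c l2 b a"
      unfolding caustic_rel_def
    proof
      show "(l1 + b + a) * (c * l2) = l1 * b * a" using l2e by (simp add: p_def s_def algebra_simps)
      have "c * ((l1 + b + a) * (c + l2)) = c * (l1 * b + l1 * a + b * a)"
        using l2e lD unfolding D_def p_def s_def by algebra
      then show "(l1 + b + a) * (c + l2) = l1 * b + l1 * a + b * a" using c0 by simp
    qed
    then show "\<exists>l1 l2. 0 < l1 \<and> l1 < c \<and> c < l2 \<and> l2 < b \<and> caustic_rel l1 c l2 b a"
      using l10 l1c cl2 l2b by blast
  qed
qed

lemma EH1_formulas:
  assumes "caustic_rel l1 c l2 b a" "0 < l1" "0 < l2"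
  shows "c ^ 3 = (c - l1) * (b - c) * (a - c)" "1 / l2 + 1 / c = 1 / a + 1 / b + 1 / l1"
proof -
  have "c ^ 3 = (c - l1) * (c - b) * (c - a)" by (rule caustic_rel_roots[OF assms(1)])
  then show "c ^ 3 = (c - l1) * (b - c) * (a - c)" by algebra
  show "1 / l2 + 1 / c = 1 / a + 1 / b + 1 / l1"
    using assms caustic_rel_inverse[of l1 c l2 b a] a0 b0 c0 by (simp add: algebra_simps)
qed

text \<open>Both middle parameters are unknown, namely the zeros of the quadratic K t^2 - E t + p c
  = t^3 - (t - a) (t - b) (t - c). Its values at \<open>c\<close> and \<open>b\<close> are c^3 and
  b^3, both positive, so real zeros lie in (c, b) as soon as their midpoint does. The condition says
  that the discriminant is positive and selects the sign that puts the midpoint there.\<close>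

lemma H1H1_iff:
  "(\<exists>l1 l2. c < l1 \<and> l1 < l2 \<and> l2 < b \<and> caustic_rel c l1 l2 b a) \<longleftrightarrow>
     c < a * b / (a + b + 2 * sqrt (a * b))"
proof -
  define p s where "p = a * b" and "s = a + b"
  have pos: "p > 0" "s > 0" using a0 b0 by (simp_all add: p_def s_def)
  have pc: "c\<^sup>2 < p" using mult_strict_mono[OF ca cb] c0 b0 a0 by (simp add: p_def power2_eq_square)
  have "c < a * b / (a + b + 2 * sqrt (a * b)) \<longleftrightarrow> 2 * c * sqrt p < p - s * c"
    unfolding p_def[symmetric] s_def[symmetric] using pos by (simp add: pos_less_divide_eq add_pos_pos algebra_simps)
  also have "\<dots> \<longleftrightarrow> 0 < p - s * c \<and> 4 * c\<^sup>2 * p < (p - s * c)\<^sup>2"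
    using less_iff_square_less[of "2 * c * sqrt p" "p - s * c"] c0 pos by (simp add: power_mult_distrib)
  finally have C: "c < a * b / (a + b + 2 * sqrt (a * b)) \<longleftrightarrow> 0 < p - s * c \<and> 4 * c\<^sup>2 * p < (p - s * c)\<^sup>2" .
  define K E where "K = s + c" and "E = p + s * c"
  have K: "K > 0" using pos c0 by (simp add: K_def)
  have rel: "caustic_rel c l1 l2 b a \<longleftrightarrow> K * (l1 * l2) = p * c \<and> K * (l1 + l2) = E" for l1 l2
    unfolding caustic_rel_def K_def E_def p_def s_def by (auto simp: algebra_simps)
  have disc: "(p - s * c)\<^sup>2 - 4 * c\<^sup>2 * p = E\<^sup>2 - 4 * K * (p * c)" unfolding K_def E_def by algebra
  show ?thesis unfolding C
  proof (intro iffI; (elim exE conjE)?)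
    fix l1 l2 assume l: "c < l1" "l1 < l2" "l2 < b" and r: "caustic_rel c l1 l2 b a"
    have "2 * c * K < E" using r l K unfolding rel by (smt (verit) mult.commute mult_less_cancel_left_pos)
    then have "2 * c\<^sup>2 < p - s * c" unfolding E_def K_def by (simp add: algebra_simps power2_eq_square)
    then have 1: "0 < p - s * c" using c0 by (smt (verit) zero_le_power2)
    have "(p - s * c)\<^sup>2 - 4 * c\<^sup>2 * p = (K * (l1 - l2))\<^sup>2"
      unfolding disc using r unfolding rel by algebra
    also have "\<dots> > 0" using K l by simp
    finally show "0 < p - s * c \<and> 4 * c\<^sup>2 * p < (p - s * c)\<^sup>2" using 1 by simp
  next
    assume h: "0 < p - s * c" "4 * c\<^sup>2 * p < (p - s * c)\<^sup>2"
    define r where "r = sqrt (E\<^sup>2 - 4 * K * (p * c))"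
    have r2: "r\<^sup>2 = E\<^sup>2 - 4 * K * (p * c)" and r0: "r > 0"
      using h(2) disc by (simp_all add: r_def)
    define l1 l2 where "l1 = (E - r) / (2 * K)" and "l2 = (E + r) / (2 * K)"
    have e: "2 * K * l1 = E - r" "2 * K * l2 = E + r" using K by (simp_all add: l1_def l2_def)
    have "2 * K * (l1 + l2) = 2 * E" using e by algebra
    then have sum: "K * (l1 + l2) = E" by simp
    have "4 * K * (K * (l1 * l2)) = 4 * K * (p * c)" using e r2 by algebra
    then have prod: "K * (l1 * l2) = p * c" using K by simp
    have "(2 * c\<^sup>2)\<^sup>2 < (p - s * c)\<^sup>2"
    proof -
      have "4 * c\<^sup>2 * c\<^sup>2 < 4 * c\<^sup>2 * p" by (rule mult_strict_left_mono[OF pc]) (use c0 in simp)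
      then show ?thesis using h(2) by (simp add: power2_eq_square)
    qed
    then have "2 * c\<^sup>2 < p - s * c" using h(1) by (meson less_imp_le power2_less_imp_less)
    then have vc: "2 * K * c < E" unfolding K_def E_def by (simp add: algebra_simps power2_eq_square)
    have vb: "E < 2 * K * b"
    proof -
      have "2 * K * b - E = (a * b - c * a) + 2 * b\<^sup>2 + b * c" unfolding K_def E_def p_def s_def by algebra
      moreover have "a * b - c * a > 0" using cb a0 by (simp add: algebra_simps)
      moreover have "2 * b\<^sup>2 + b * c > 0" using b0 c0 by (simp add: add_pos_pos)
      ultimately show ?thesis by linarith
    qed
    have "(E - 2 * K * c)\<^sup>2 - r\<^sup>2 = 4 * K * c ^ 3" unfolding r2 K_def E_def p_def s_def by algebra
    then have "r\<^sup>2 < (E - 2 * K * c)\<^sup>2" using K c0 by (smt (verit) zero_less_power mult_pos_pos)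
    then have "r < E - 2 * K * c" using vc by (intro power2_less_imp_less[of r]) auto
    then have "2 * K * c < 2 * K * l1" using e by simp
    then have 1: "c < l1" using K by simp
    have "(2 * K * b - E)\<^sup>2 - r\<^sup>2 = 4 * K * b ^ 3" unfolding r2 K_def E_def p_def s_def by algebra
    then have "r\<^sup>2 < (2 * K * b - E)\<^sup>2" using K b0 by (smt (verit) zero_less_power mult_pos_pos)
    then have "r < 2 * K * b - E" using vb by (intro power2_less_imp_less[of r]) auto
    then have "2 * K * l2 < 2 * K * b" using e by simp
    then have 2: "l2 < b" using K by simp
    have "2 * K * l1 < 2 * K * l2" using e r0 by simp
    then have "l1 < l2" using K by simp
    then show "\<exists>l1 l2. c < l1 \<and> l1 < l2 \<and> l2 < b \<and> caustic_rel c l1 l2 b a"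
      using 1 2 sum prod unfolding rel by blast
  qed
qed

lemma H1H1_formulas:
  assumes "caustic_rel c l1 l2 b a"
  shows "{l1, l2} = {t. t ^ 3 - (t - a) * (t - b) * (t - c) = 0}"
proof -
  have "t ^ 3 - (t - a) * (t - b) * (t - c) = (c + b + a) * ((t - l1) * (t - l2))" for t
    using assms unfolding caustic_rel_poly by (metis (no_types, lifting) mult.assoc mult.commute)
  then show ?thesis using a0 b0 c0 by auto
qed

lemma EH2_rel_iff:
  "caustic_rel l1 c b l2 a \<longleftrightarrow>
     (a - b) * (a - c) * (l1 + l2) = (a * (b + c) - b * c) * a \<and> (a - b) * (a - c) * (l1 * l2) = a\<^sup>2 * b * c"
proof -
  define S R where "S = l1 + l2" and "R = l1 * l2"
  define L where "L = (a - b) * (a - c)"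
  have rel: "caustic_rel l1 c b l2 a \<longleftrightarrow> (S + a) * (b * c) = R * a \<and> (S + a) * (b + c) = R + a * S"
    unfolding caustic_rel_def S_def R_def by (auto simp: algebra_simps)
  have "(S + a) * (b * c) = R * a \<and> (S + a) * (b + c) = R + a * S \<longleftrightarrow>
    L * S = (a * (b + c) - b * c) * a \<and> L * R = a\<^sup>2 * b * c" (is "?A \<longleftrightarrow> ?B")
  proof
    assume A: ?A
    then have 1: "L * S = (a * (b + c) - b * c) * a" unfolding L_def by algebra
    have "a * (L * R) = a * (a\<^sup>2 * b * c)" using A 1 unfolding L_def by algebra
    then show ?B using 1 a0 by simp
  next
    assume B: ?B
    have "L * ((S + a) * (b * c)) = L * (R * a)" "L * ((S + a) * (b + c)) = L * (R + a * S)"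
      using B unfolding L_def by algebra+
    moreover have "L > 0" using ba ca by (simp add: L_def)
    ultimately show ?A by simp
  qed
  then show ?thesis unfolding rel L_def S_def R_def .
qed

text \<open>The quadratic \<open>g\<close> with zeros \<open>l1\<close> and \<open>l2\<close> is
  positive at 0 and negative at \<open>c\<close> and \<open>b\<close>. One zero is always in (0, c)
  and the other above \<open>b\<close>, so only \<open>l2 < a\<close> is at stake, which is the sign
  of \<open>g a\<close>. The inequality \<open>2 * b < a\<close> is a consequence that makes the
  denominator positive.\<close>

lemma EH2_iff:
  "(\<exists>l1 l2. 0 < l1 \<and> l1 < c \<and> b < l2 \<and> l2 < a \<and> caustic_rel l1 c b l2 a) \<longleftrightarrow>
     2 * b < a \<and> c < (a - 2 * b) / (2 * a - 3 * b) * a"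
proof -
  define L M g where "L = (a - b) * (a - c)" and "M = (a * (b + c) - b * c) * a"
    and "g t = L * t\<^sup>2 - M * t + a\<^sup>2 * b * c" for t
  have L: "L > 0" using ba ca by (simp add: L_def)
  have gc: "g c = - (c ^ 3 * (a - b))" and gb: "g b = - (b ^ 3 * (a - c))"
    and ga: "g a = a\<^sup>2 * (a * (a - 2 * b) - c * (2 * a - 3 * b))"
    unfolding g_def L_def M_def by algebra+
  have gneg: "g c < 0" "g b < 0" unfolding gc gb using ba ca b0 c0 by simp_all
  have C: "2 * b < a \<and> c < (a - 2 * b) / (2 * a - 3 * b) * a \<longleftrightarrow> g a > 0"
  proof -
    have "g a > 0 \<longleftrightarrow> c * (2 * a - 3 * b) < a * (a - 2 * b)" unfolding ga using a0 by (simp add: zero_less_mult_iff)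
    moreover have "2 * b < a" if h: "c * (2 * a - 3 * b) < a * (a - 2 * b)"
    proof (rule ccontr)
      assume n: "\<not> 2 * b < a"
      then have np: "a * (a - 2 * b) \<le> 0" using a0 by (simp add: mult_le_0_iff)
      show False
      proof (cases "2 * a \<ge> 3 * b")
        case True
        then have "c * (2 * a - 3 * b) \<ge> 0" using c0 by simp
        then show False using h np by linarith
      next
        case False
        then have "b * (2 * a - 3 * b) < c * (2 * a - 3 * b)" using cb by (intro mult_strict_right_mono_neg) auto
        then have "(a - b) * (a - 3 * b) > 0" using h by (simp add: algebra_simps)
        then show False using ba False b0 by (simp add: zero_less_mult_iff)
      qed
    qed
    moreover have "c < (a - 2 * b) / (2 * a - 3 * b) * a \<longleftrightarrow> c * (2 * a - 3 * b) < a * (a - 2 * b)" if "2 * b < a"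
      using that b0 by (simp add: pos_less_divide_eq algebra_simps)
    ultimately show ?thesis by blast
  qed
  show ?thesis unfolding C
  proof (intro iffI; (elim exE conjE)?)
    fix l1 l2 assume l: "0 < l1" "l1 < c" "b < l2" "l2 < a" and r: "caustic_rel l1 c b l2 a"
    have e: "L * (l1 + l2) = M" "L * (l1 * l2) = a\<^sup>2 * b * c" using r unfolding EH2_rel_iff L_def M_def by auto
    have "g a = L * ((a - l1) * (a - l2))" unfolding g_def e[symmetric] by algebra
    then show "g a > 0" using L l ca by simp
  next
    assume h: "g a > 0"
    have cont: "continuous_on S g" for S unfolding g_def by (intro continuous_intros)
    have g0: "g 0 > 0" using a0 b0 c0 by (simp add: g_def)
    obtain l1 where l1: "0 \<le> l1" "l1 \<le> c" "g l1 = 0"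
      using IVT2'[of g c 0 0] gneg g0 c0 cont by auto
    obtain l2 where l2: "b \<le> l2" "l2 \<le> a" "g l2 = 0"
      using IVT'[of g b 0 a] gneg h ba cont by auto
    have s: "0 < l1" "l1 < c" "b < l2" "l2 < a"
      using l1 l2 gneg g0 h by (auto simp: less_le)
    have "(l1 - l2) * (L * (l1 + l2) - M) = 0" using l1(3) l2(3) unfolding g_def by algebra
    then have sum: "L * (l1 + l2) = M" using s cb by auto
    then have "L * (l1 * l2) = a\<^sup>2 * b * c"
      using l1(3) unfolding g_def sum[symmetric] by (simp add: algebra_simps power2_eq_square)
    then show "\<exists>l1 l2. 0 < l1 \<and> l1 < c \<and> b < l2 \<and> l2 < a \<and> caustic_rel l1 c b l2 a"
      using s sum unfolding EH2_rel_iff L_def M_def by blast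
  qed
qed

lemma EH2_formulas:
  assumes "caustic_rel l1 c b l2 a"
  shows "{l1, l2} = {t. (a - b) * (a - c) * t\<^sup>2 + (b * c - a * (b + c)) * a * t + a\<^sup>2 * b * c = 0}"
proof -
  have e: "(a - b) * (a - c) * (l1 + l2) = (a * (b + c) - b * c) * a" "(a - b) * (a - c) * (l1 * l2) = a\<^sup>2 * b * c"
    using assms unfolding EH2_rel_iff by auto
  have "(a - b) * (a - c) * t\<^sup>2 + (b * c - a * (b + c)) * a * t + a\<^sup>2 * b * c
      = (a - b) * (a - c) * ((t - l1) * (t - l2))" for t
  proof -
    have "(b * c - a * (b + c)) * a * t = - ((a - b) * (a - c) * (l1 + l2)) * t" unfolding e by algebra
    then show ?thesis unfolding e(2)[symmetric] by algebra
  qed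
  then show ?thesis using ba ca by auto
qed

text \<open>As for EH1, with \<open>b\<close> as the known middle parameter: it determines
  \<open>l2\<close> and then \<open>l1\<close>. The first condition is \<open>l2 < a\<close> and the
  second \<open>l1 < b\<close>; the bounds \<open>b < l2\<close> and \<open>c < l1\<close> hold
  automatically.\<close>

lemma H1H2_iff:
  "(\<exists>l1 l2. c < l1 \<and> l1 < b \<and> b < l2 \<and> l2 < a \<and> caustic_rel c l1 b l2 a) \<longleftrightarrow>
     c < (a - 2 * b) / (a - b)\<^sup>2 * a * b \<and> b > a * c / (a + c - sqrt (a * c))"
proof -
  define p s D where "p = a * c" and "s = a + c" and "D = (b - c) * (a - b)"
  have pos: "p > 0" "s > 0" "D > 0" using a0 b0 c0 cb ba by (simp_all add: p_def s_def D_def)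
  have D: "D = b * s - p - b\<^sup>2" unfolding D_def p_def s_def by algebra
  have X: "b * s - p > 0" using D pos b0 by (smt (verit) zero_le_power2)
  have ps: "sqrt p < s"
  proof -
    have "p < s\<^sup>2" unfolding p_def s_def using a0 c0 by (simp add: power2_eq_square algebra_simps add_pos_pos)
    then show ?thesis using pos(2) real_sqrt_less_mono by fastforce
  qed
  have "b > a * c / (a + c - sqrt (a * c)) \<longleftrightarrow> b * sqrt p < b * s - p"
    unfolding p_def[symmetric] s_def[symmetric] using ps by (simp add: pos_divide_less_eq algebra_simps)
  also have "\<dots> \<longleftrightarrow> b\<^sup>2 * p < (b * s - p)\<^sup>2"
    using less_iff_square_less[of "b * sqrt p" "b * s - p"] b0 pos X by (simp add: power_mult_distrib)
  finally have C2: "b > a * c / (a + c - sqrt (a * c)) \<longleftrightarrow> b\<^sup>2 * p < (b * s - p)\<^sup>2" .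
  have C1: "c < (a - 2 * b) / (a - b)\<^sup>2 * a * b \<longleftrightarrow> b ^ 3 < D * (a - b)"
  proof -
    have "c < (a - 2 * b) / (a - b)\<^sup>2 * a * b \<longleftrightarrow> c * (a - b)\<^sup>2 < (a - 2 * b) * a * b"
      using ba by (simp add: pos_less_divide_eq)
    also have "\<dots> \<longleftrightarrow> b ^ 3 < D * (a - b)"
    proof -
      have "D * (a - b) - b ^ 3 = (a - 2 * b) * a * b - c * (a - b)\<^sup>2" unfolding D_def by algebra
      then show ?thesis by linarith
    qed
    finally show ?thesis .
  qed
  have rel: "(c + l2 + a) * (l1 * b) = l2 * p \<and> (l2 - b) * D = b ^ 3" if "caustic_rel c l1 b l2 a" for l1 l2
  proof
    show "(c + l2 + a) * (l1 * b) = l2 * p" using that unfolding caustic_rel_def p_def by (simp add: algebra_simps)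
    have "b ^ 3 = (b - c) * (b - l2) * (b - a)" by (rule caustic_rel_roots[OF that])
    then show "(l2 - b) * D = b ^ 3" unfolding D_def by algebra
  qed
  have l2D: "l2 * D = b * (b * s - p)" if "(l2 - b) * D = b ^ 3" for l2
  proof -
    have "l2 * D = b * D + b ^ 3" using that by (simp add: algebra_simps)
    then show ?thesis unfolding D by algebra
  qed
  have id: "b * ((b * s - p)\<^sup>2 - b\<^sup>2 * p) = (b\<^sup>2 * (l2 + s) - l2 * p) * D" if "(l2 - b) * D = b ^ 3" for l2
  proof -
    have "(b\<^sup>2 * (l2 + s) - l2 * p) * D = (b\<^sup>2 - p) * (l2 * D) + b\<^sup>2 * s * D" by algebra
    then show ?thesis unfolding l2D[OF that] unfolding D by algebra
  qed
  have l2a: "l2 < a \<longleftrightarrow> b ^ 3 < D * (a - b)" if "(l2 - b) * D = b ^ 3" for l2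
  proof -
    have "D * (a - b) - b ^ 3 = (a - l2) * D" unfolding that[symmetric] by algebra
    then show ?thesis using pos(3) by (metis diff_gt_0_iff_gt zero_less_mult_pos2 mult_pos_pos)
  qed
  show ?thesis unfolding C1 C2
  proof (intro iffI; (elim exE conjE)?)
    fix l1 l2 assume l: "c < l1" "l1 < b" "b < l2" "l2 < a" and r: "caustic_rel c l1 b l2 a"
    have e: "(c + l2 + a) * (l1 * b) = l2 * p" "(l2 - b) * D = b ^ 3" using rel[OF r] by auto
    have "(c + l2 + a) * (l1 * b) < (c + l2 + a) * (b * b)" using l a0 b0 c0 by simp
    then have "b\<^sup>2 * (l2 + s) - l2 * p > 0" using e(1) by (simp add: s_def power2_eq_square algebra_simps)
    then have "b * ((b * s - p)\<^sup>2 - b\<^sup>2 * p) > 0" unfolding id[OF e(2)] using pos by simp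
    then have "b\<^sup>2 * p < (b * s - p)\<^sup>2" using b0 by (simp add: zero_less_mult_iff)
    then show "b ^ 3 < D * (a - b) \<and> b\<^sup>2 * p < (b * s - p)\<^sup>2" using l2a[OF e(2)] l(4) by blast
  next
    assume h: "b ^ 3 < D * (a - b)" "b\<^sup>2 * p < (b * s - p)\<^sup>2"
    define l2 where "l2 = b + b ^ 3 / D"
    define l1 where "l1 = l2 * p / (b * (l2 + s))"
    have e2: "(l2 - b) * D = b ^ 3" using pos by (simp add: l2_def)
    have l2b: "b < l2" using pos b0 by (simp add: l2_def)
    have l2a': "l2 < a" using l2a[OF e2] h(1) by blast
    have e1: "(l2 + s) * (l1 * b) = l2 * p" using l2b pos b0 by (simp add: l1_def)
    have "(b\<^sup>2 * (l2 + s) - l2 * p) * D > 0" unfolding id[OF e2, symmetric] using h(2) b0 by simp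
    then have "b\<^sup>2 * (l2 + s) - l2 * p > 0" using pos by (simp add: zero_less_mult_iff)
    then have "(l2 + s) * b * l1 < (l2 + s) * b * b" using e1 by (simp add: power2_eq_square algebra_simps)
    then have l1b: "l1 < b" using l2b pos b0 by (simp add: mult_less_cancel_left_pos add_pos_pos)
    have "(l2 * (a - b) - b * s) * D = b * c\<^sup>2 * (a - b)"
    proof -
      have "(l2 * (a - b) - b * s) * D = (a - b) * (l2 * D) - b * s * D" by algebra
      then show ?thesis unfolding l2D[OF e2] unfolding D_def s_def p_def by algebra
    qed
    moreover have "b * c\<^sup>2 * (a - b) > 0" using b0 c0 ba by simp
    ultimately have "l2 * (a - b) - b * s > 0" using pos by (metis zero_less_mult_pos2)
    then have "b * (l2 + s) < l2 * a" by (simp add: algebra_simps)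
    then have "c * (b * (l2 + s)) < c * (l2 * a)" using c0 by (rule mult_strict_left_mono)
    then have "(l2 + s) * b * c < (l2 + s) * b * l1" using e1 by (simp add: p_def algebra_simps)
    then have l1c: "c < l1" using l2b pos b0 by (simp add: mult_less_cancel_left_pos add_pos_pos)
    have "caustic_rel c l1 b l2 a"
      unfolding caustic_rel_def
    proof
      show "(c + l2 + a) * (l1 * b) = c * l2 * a" using e1 by (simp add: p_def s_def algebra_simps)
      have "b * ((c + l2 + a) * (l1 + b)) = b * (c * l2 + c * a + l2 * a)"
        using e1 e2 unfolding D_def p_def s_def by algebra
      then show "(c + l2 + a) * (l1 + b) = c * l2 + c * a + l2 * a" using b0 by simp
    qed
    then show "\<exists>l1 l2. c < l1 \<and> l1 < b \<and> b < l2 \<and> l2 < a \<and> caustic_rel c l1 b l2 a"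
      using l1c l1b l2b l2a' by blast
  qed
qed

lemma H1H2_formulas:
  assumes "caustic_rel c l1 b l2 a" "0 < l1" "0 < l2"
  shows "b ^ 3 = (b - c) * (l2 - b) * (a - b)" "1 / l1 + 1 / b = 1 / a + 1 / c + 1 / l2"
proof -
  have "b ^ 3 = (b - c) * (b - l2) * (b - a)" by (rule caustic_rel_roots[OF assms(1)])
  then show "b ^ 3 = (b - c) * (l2 - b) * (a - b)" by algebra
  show "1 / l1 + 1 / b = 1 / a + 1 / c + 1 / l2"
    using assms caustic_rel_inverse[of c l1 b l2 a] a0 b0 c0 by (simp add: algebra_simps)
qed

section \<open>From periodicity to the caustic relation\<close>

lemma nonsingular_trajectoryD:
  assumes ns: "nonsingular_trajectory a b c l1 l2 q"
  obtains u \<tau> \<nu> where "nonsingular a b c q u \<tau> \<nu> l1 l2"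
proof -
  obtain u \<tau> \<nu> where "billiard a b c q u \<tau> \<nu>" and un: "\<And>k. norm (u k) = 1"
    and K: "\<And>k t. caustic_poly (q k) (u k) t = (t - l1) * (t - l2)"
    using nonsingular_billiard[OF ns] by metis
  then interpret billiard a b c q u \<tau> \<nu> by simp
  interpret caustics a b c l1 l2 by (rule nonsingular_caustics[OF ns])
  have "nonsingular a b c q u \<tau> \<nu> l1 l2" by unfold_locales (use un K in auto)
  then show thesis by (rule that)
qed

lemma periodic_caustic_rel:
  assumes "nonsingular_periodic a b c 3 l1 l2 q"
  shows "caustics a b c l1 l2" "caustic_rel (min c l1) (max c l1) (min b l2) (max b l2) a"
proof -
  have ns: "nonsingular_trajectory a b c l1 l2 q" and ep: "has_elliptic_period a b c l1 l2 q 3"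
    using assms unfolding nonsingular_periodic_def by auto
  show ca: "caustics a b c l1 l2" by (rule nonsingular_caustics[OF ns])
  obtain u \<tau> \<nu> where "nonsingular a b c q u \<tau> \<nu> l1 l2" by (rule nonsingular_trajectoryD[OF ns])
  then interpret nonsingular a b c q u \<tau> \<nu> l1 l2 .
  obtain m0 m1 m2 where w: "winding_numbers a b c l1 l2 q m0 m1 m2" and m: "3 = m0 div gcd m0 (gcd m1 m2)"
    and per: "periodic_trajectory q"
    using ep unfolding has_elliptic_period_def by auto
  let ?N = "trajectory_period q"
  have "closes_after q ?N"
    using per unfolding periodic_trajectory_def trajectory_period_def by (rule LeastI_ex)
  then have N: "0 < ?N" "\<And>k. q (k + int ?N) = q k" unfolding closes_after_def by auto
  define g where "g = gcd m0 (gcd m1 m2)"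
  have "g dvd m0" "g dvd m1" "g dvd m2" unfolding g_def by (auto intro: dvd_trans)
  moreover have m0: "m0 = ?N" using w unfolding winding_numbers_def Let_def by auto
  ultimately obtain m1' m2' where mm: "m1 = g * m1'" "m2 = g * m2'" and Ng: "?N = 3 * g" and g: "g > 0"
    using m N(1) unfolding g_def[symmetric] by (auto elim!: dvdE)
  have "(\<lambda>s. fst (snd (elliptic_coords a b c (traj s)))) = \<mu> 1" "(\<lambda>s. snd (snd (elliptic_coords a b c (traj s)))) = \<mu> 2"
    by (auto simp: elliptic_coords_eq \<mu>_def)
  then have o: "complete_oscillations (\<mu> 1) c2 c3 (of_nat (3 * g)) (g * m1')"
    "complete_oscillations (\<mu> 2) c4 a (of_nat (3 * g)) (g * m2')"
    using w unfolding winding_numbers_def Let_def osc_endpoints mm Ng by auto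
  have close: "\<mu> 1 3 = \<mu> 1 0" "\<mu> 2 3 = \<mu> 2 0" "mix_poly (q 3) (u 3) t = mix_poly (q 0) (u 0) t" for t
    by (rule closes_elliptically[OF g _ o]; use N(2) Ng in simp)+
  have "pos_poly (q 3) t = pos_poly (q 0) t" for t
    using pos_poly_\<mu>[of 3 t] pos_poly_\<mu>[of 0 t] close(1,2) \<mu>0_vertex[of 3] \<mu>0_vertex[of 0]
      path_vertex[of 3] path_vertex[of 0] by simp
  from caustic_relation[OF this close(3)]
  have "caustic_rel c1 c2 c3 c4 a" using caustic_rel_inverse[of c1 c2 c3 c4 a] c_order by auto
  then show "caustic_rel (min c l1) (max c l1) (min b l2) (max b l2) a"
    unfolding c1_def c2_def c3_def c4_def .
qed

end

section \<open>A symmetric orbit\<close>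

context semi_axes
begin

lemma mix_poly_at_axes:
  "mix_poly p v a = p $ 1 * v $ 1 * ((a - b) * (a - c))"
  "mix_poly p v b = - (p $ 2 * v $ 2 * ((a - b) * (b - c)))"
  "mix_poly p v c = p $ 3 * v $ 3 * ((a - c) * (b - c))"
  unfolding mix_poly_def by algebra+

text \<open>The linear coefficient carries the length of the normal. Through it the reflection law
  can be checked on prescribed polynomials.\<close>

lemma pos_poly_coeffs:
  obtains A B C where "\<And>t. pos_poly p t = C + B * t + A * t\<^sup>2 - t ^ 3"
    "pos_poly p 0 = 0 \<Longrightarrow> B = - (a * b * c * (normal p \<bullet> normal p))"
proof
  define X Y Z where "X = p $ 1 / a" and "Y = p $ 2 / b" and "Z = p $ 3 / c"
  have p: "p $ 1 = a * X" "p $ 2 = b * Y" "p $ 3 = c * Z"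
    using a0 b0 c0 by (simp_all add: X_def Y_def Z_def)
  define B where "B = (p $ 1)\<^sup>2 * (b + c) + (p $ 2)\<^sup>2 * (a + c) + (p $ 3)\<^sup>2 * (a + b) - (a * b + b * c + c * a)"
  show "pos_poly p t = pos_poly p 0 + B * t + (a + b + c - (p $ 1)\<^sup>2 - (p $ 2)\<^sup>2 - (p $ 3)\<^sup>2) * t\<^sup>2 - t ^ 3" for t
    unfolding pos_poly_def axes_poly_def B_def by algebra
  assume "pos_poly p 0 = 0"
  then have "a * b * c * (1 - (a * X\<^sup>2 + b * Y\<^sup>2 + c * Z\<^sup>2)) = 0"
    unfolding pos_poly_def axes_poly_def p by algebra
  then have e: "a * X\<^sup>2 + b * Y\<^sup>2 + c * Z\<^sup>2 = 1" using a0 b0 c0 by simp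
  have n: "normal p \<bullet> normal p = X\<^sup>2 + Y\<^sup>2 + Z\<^sup>2"
    by (simp add: inner3 normal_nth X_def Y_def Z_def power2_eq_square)
  have "B + a * b * c * (X\<^sup>2 + Y\<^sup>2 + Z\<^sup>2)
      = (a * b + b * c + c * a) * (a * X\<^sup>2 + b * Y\<^sup>2 + c * Z\<^sup>2 - 1)"
    unfolding B_def p by algebra
  then show "B = - (a * b * c * (normal p \<bullet> normal p))" unfolding e n by simp
qed

end

locale symmetric_orbit = caustics +
  assumes rel: "caustic_rel c1 c2 c3 c4 a"
begin

definition ck :: "nat \<Rightarrow> real" where
  "ck k = (if k = 1 then c1 else if k = 2 then c2 else if k = 3 then c3 else if k = 4 then c4 else a)"

lemma ck_simps: "ck 1 = c1" "ck (Suc 0) = c1" "ck 2 = c2" "ck 3 = c3" "ck 4 = c4" "ck 5 = a"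
  by (simp_all add: ck_def)

lemma ck_pos: "ck k > 0"
  using c_order by (simp add: ck_def)

text \<open>The kick at bounce 0 is \<open>2 * n0\<close>, and the first flight is the unit of
  length. Reversal about the midpoint after bounce 1 requires the scalars for \<open>c3\<close> and
  \<open>c4\<close> to be constant on that segment and the one for \<open>c2\<close> to change sign.
  The scalar for \<open>c4\<close> then forces the kick \<open>c4\<close> at bounces 1 and 2, the
  one for \<open>c3\<close> gives \<open>n0\<close>, and the one for \<open>c2\<close> gives
  \<open>\<tau>1\<close>.\<close>

definition n0 :: real where "n0 = 1 / (1 / c3 - 1 / c4)"
definition \<tau>1 :: real where "\<tau>1 = 2 * c2 / (c4 - c2)"

lemma inverse_order: "1 / a < 1 / c4" "1 / c4 < 1 / c3" "1 / c3 < 1 / c2" "1 / c2 < 1 / c1" "0 < 1 / a"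
  using c_order by (auto intro!: divide_strict_left_mono)

lemma n0_pos: "n0 > 0" and \<tau>1_pos: "\<tau>1 > 0"
  using inverse_order c_order by (simp_all add: n0_def \<tau>1_def)

lemma rel_inverse:
  "1 / c2 + 1 / c3 = 1 / c1 + 1 / c4 + 1 / a"
  "1 / c2 * (1 / c3) = 1 / c1 * (1 / c4) + 1 / c1 * (1 / a) + 1 / c4 * (1 / a)"
  using rel caustic_rel_inverse[of c1 c2 c3 c4 a] c_order by auto

text \<open>The scalar recurrences for one coordinate. Under the time reversals of the orbit about bounce 0
  and about the midpoint of the segment from bounce 1 to bounce 2, the coordinate belonging to
  \<open>ck k\<close> is multiplied by \<open>sR k\<close> and \<open>sM k\<close>, respectively.\<close>

definition sR :: "nat \<Rightarrow> real" where "sR k = (if odd k then 1 else - 1)"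
definition sM :: "nat \<Rightarrow> real" where "sM k = (if k = 3 \<or> k = 4 then 1 else - 1)"
text \<open>At elliptic coordinates 0, \<open>c2\<close>, \<open>c4\<close> the scalars for even
  \<open>k\<close> vanish, and their velocities are normalised to 1; for odd \<open>k\<close> the
  position is. Reversal at bounce 0 then makes the velocity jump from \<open>n0 / ck k\<close> to
  its negative for odd \<open>k\<close>. The scale of each coordinate is restored later by the
  amplitudes.\<close>

definition x0 :: "nat \<Rightarrow> real" where "x0 k = (if odd k then 1 else 0)"
definition y0 :: "nat \<Rightarrow> real" where "y0 k = (if odd k then - (n0 / ck k) else 1)"
definition x1 :: "nat \<Rightarrow> real" where "x1 k = x0 k + y0 k"

text \<open>The product of the two reversals advances by three bounces and multiplies the scalar by
  \<open>sR k * sM k\<close>. This factor squares to 1, whence the period six.\<close>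

definition turn :: "nat \<Rightarrow> int \<Rightarrow> real" where
  "turn k j = (if even (j div 3) then 1 else sR k * sM k)"

definition X :: "nat \<Rightarrow> int \<Rightarrow> real" where
  "X k j = turn k j *
     (if j mod 3 = 0 then x0 k else if j mod 3 = 1 then x1 k else sM k * x1 k)"

definition Y :: "nat \<Rightarrow> int \<Rightarrow> real" where
  "Y k j = turn k j *
     (if j mod 3 = 0 then y0 k else if j mod 3 = 1 then (sM k - 1) * x1 k / \<tau>1
      else sR k * sM k * x0 k - sM k * x1 k)"

definition \<tau> :: "int \<Rightarrow> real" where "\<tau> j = (if j mod 3 = 1 then \<tau>1 else 1)"
definition \<nu> :: "int \<Rightarrow> real" where "\<nu> j = (if j mod 3 = 0 then 2 * n0 else c4)"

lemma sign_squares: "sR k * sR k = 1" "sM k * sM k = 1" "sR k * (sR k * z) = z" "sM k * (sM k * z) = z"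
  by (auto simp: sR_def sM_def)

lemma turn_next:
  "(j + 1) div 3 = j div 3 \<Longrightarrow> turn k (j + 1) = turn k j"
  "(j + 1) div 3 = j div 3 + 1 \<Longrightarrow> turn k (j + 1) = turn k j * (sR k * sM k)"
  using sign_squares[of k] by (auto simp: turn_def sR_def sM_def)

lemma XY_values:
  "j mod 3 = 0 \<Longrightarrow> X k j = turn k j * x0 k" "j mod 3 = 0 \<Longrightarrow> Y k j = turn k j * y0 k"
  "j mod 3 = 1 \<Longrightarrow> X k j = turn k j * x1 k" "j mod 3 = 1 \<Longrightarrow> Y k j = turn k j * ((sM k - 1) * x1 k / \<tau>1)"
  "j mod 3 = 2 \<Longrightarrow> X k j = turn k j * (sM k * x1 k)"
  "j mod 3 = 2 \<Longrightarrow> Y k j = turn k j * (sR k * sM k * x0 k - sM k * x1 k)"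
  by (simp_all add: X_def Y_def)

lemma int_mod3_cases:
  fixes j :: int
  obtains "j mod 3 = 0" "(j + 1) mod 3 = 1" "(j + 1) div 3 = j div 3"
  | "j mod 3 = 1" "(j + 1) mod 3 = 2" "(j + 1) div 3 = j div 3"
  | "j mod 3 = 2" "(j + 1) mod 3 = 0" "(j + 1) div 3 = j div 3 + 1"
proof -
  have "j mod 3 = 0 \<and> (j + 1) mod 3 = 1 \<and> (j + 1) div 3 = j div 3
    \<or> j mod 3 = 1 \<and> (j + 1) mod 3 = 2 \<and> (j + 1) div 3 = j div 3
    \<or> j mod 3 = 2 \<and> (j + 1) mod 3 = 0 \<and> (j + 1) div 3 = j div 3 + 1" by presburger
  then show thesis by (elim disjE conjE) (rule that; assumption)+
qed

lemma X_flight: "X k (j + 1) = X k j + \<tau> j * Y k j"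
proof (rule int_mod3_cases[of j])
  assume h: "j mod 3 = 0" "(j + 1) mod 3 = 1" "(j + 1) div 3 = j div 3"
  show ?thesis unfolding XY_values(1,2)[OF h(1)] XY_values(3)[OF h(2)] turn_next(1)[OF h(3)]
    by (simp add: \<tau>_def h(1) x1_def algebra_simps)
next
  assume h: "j mod 3 = 1" "(j + 1) mod 3 = 2" "(j + 1) div 3 = j div 3"
  have e: "\<tau>1 * ((sM k - 1) * x1 k / \<tau>1) = (sM k - 1) * x1 k" using \<tau>1_pos by simp
  have "turn k j * (sM k * x1 k) = turn k j * x1 k + turn k j * (\<tau>1 * ((sM k - 1) * x1 k / \<tau>1))"
    unfolding e by algebra
  then show ?thesis unfolding XY_values(3,4)[OF h(1)] XY_values(5)[OF h(2)] turn_next(1)[OF h(3)]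
    by (simp add: \<tau>_def h(1) mult.left_commute)
next
  assume h: "j mod 3 = 2" "(j + 1) mod 3 = 0" "(j + 1) div 3 = j div 3 + 1"
  show ?thesis unfolding XY_values(5,6)[OF h(1)] XY_values(1)[OF h(2)] turn_next(2)[OF h(3)]
    by (simp add: \<tau>_def h(1) algebra_simps)
qed

text \<open>The reflection at bounce 1. For \<open>k\<close> = 2, 3, 4 it is how the constants were
  chosen. For \<open>k\<close> = 1, 5 it says that 1/c1 and 1/a are the roots of (e2 - e) (e3 - e4 -
  e) = e4 (e3 - e4), which is the caustic relation.\<close>

lemma kick_1:
  assumes "k \<in> {1, 2, 3, 4, 5}"
  shows "(sM k - 1) * x1 k / \<tau>1 = y0 k - c4 * x1 k / ck k"
proof -
  define e1 e2 e3 e4 e5 where "e1 = 1 / c1" and "e2 = 1 / c2" and "e3 = 1 / c3" and "e4 = 1 / c4" and "e5 = 1 / a"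
  note e = e1_def e2_def e3_def e4_def e5_def
  have pos: "e5 > 0" "e4 > 0" "e3 > 0" "e2 > 0" "e1 > 0" "e3 - e4 > 0" "e2 - e4 > 0"
    using inverse_order c_order unfolding e by auto
  have c: "c1 = 1 / e1" "c2 = 1 / e2" "c3 = 1 / e3" "c4 = 1 / e4" "a = 1 / e5" by (simp_all add: e)
  have r: "e2 + e3 = e1 + e4 + e5" "e2 * e3 = e1 * e4 + e1 * e5 + e4 * e5"
    using rel_inverse unfolding e by auto
  have "n0 = 1 / (e3 - e4)" by (simp only: n0_def e)
  then have n: "n0 * (e3 - e4) = 1" using pos(6) by simp
  have t: "2 / \<tau>1 = (e2 - e4) / e4" using pos(2,4,7) c_order by (simp add: \<tau>1_def c field_simps)
  have quad: "(e2 - e) * (e3 - e4 - e) = e4 * (e3 - e4)" if "e = e1 \<or> e = e5" for e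
    using that
  proof
    assume "e = e1"
    have "(e2 - e1) * (e3 - e4 - e1) = e4 * (e3 - e4)" using r by algebra
    then show ?thesis unfolding \<open>e = e1\<close> .
  next
    assume "e = e5"
    have "(e2 - e5) * (e3 - e4 - e5) = e4 * (e3 - e4)" using r by algebra
    then show ?thesis unfolding \<open>e = e5\<close> .
  qed
  have out: "- 2 * (1 - n0 * e) / \<tau>1 = - (n0 * e) - (1 - n0 * e) * e / e4" if h: "e = e1 \<or> e = e5" for e
  proof -
    have "(e3 - e4) * ((1 - n0 * e) * (e2 - e4)) = (e3 - e4) * (n0 * e * e4 + (1 - n0 * e) * e)"
      using quad[OF h] n by algebra
    then have "(1 - n0 * e) * (e2 - e4) = n0 * e * e4 + (1 - n0 * e) * e" using pos(6) by simp
    then have "(1 - n0 * e) * ((e2 - e4) / e4) = n0 * e + (1 - n0 * e) * e / e4"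
      using pos(2) by (simp add: field_simps)
    moreover have "- 2 * (1 - n0 * e) / \<tau>1 = - ((1 - n0 * e) * (2 / \<tau>1))"
      using \<tau>1_pos by (simp add: field_simps)
    ultimately show ?thesis unfolding t by linarith
  qed
  have odd_val: "y0 k = - (n0 * e)" "x1 k = 1 - n0 * e" "c4 * x1 k / ck k = x1 k * e / e4"
    if "odd k" "e = 1 / ck k" for e
    using that by (simp_all add: x1_def x0_def y0_def e4_def)
  from assms consider "k = 1 \<or> k = 5" | "k = 2" | "k = 3" | "k = 4" by auto
  then show ?thesis
  proof cases
    case 1
    then obtain e where h: "e = e1 \<or> e = e5" "e = 1 / ck k" "odd k" by (auto simp: ck_simps e)
    have "sM k = - 1" using 1 by (auto simp: sM_def)
    then have "(sM k - 1) * x1 k / \<tau>1 = - 2 * (1 - n0 * e) / \<tau>1"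
      unfolding odd_val(2)[OF h(3,2)] by simp
    moreover have "y0 k - c4 * x1 k / ck k = - (n0 * e) - (1 - n0 * e) * e / e4"
      unfolding odd_val(3)[OF h(3,2)] unfolding odd_val(1,2)[OF h(3,2)] ..
    ultimately show ?thesis by (simp only: out[OF h(1)])
  next
    case 2
    have "(sM k - 1) * x1 k / \<tau>1 = - (2 / \<tau>1)" "y0 k - c4 * x1 k / ck k = 1 - c4 / c2"
      using 2 by (simp_all add: sM_def x1_def x0_def y0_def ck_simps)
    moreover have "c4 / c2 = e2 / e4" by (simp add: e2_def e4_def)
    ultimately show ?thesis using t pos(2) by (simp add: diff_divide_distrib)
  next
    case 3
    have "n0 * e3 = 1 + n0 * e4" using n by (simp add: algebra_simps)
    then have "- (n0 * e3) - (1 - n0 * e3) * e3 / e4 = 0" using pos(2) n by (simp add: field_simps)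
    moreover have "e3 = 1 / ck k" "odd k" "sM k = 1" using 3 by (simp_all add: ck_simps e3_def sM_def)
    ultimately show ?thesis using odd_val[of e3] by simp
  next
    case 4
    then show ?thesis using c_order by (simp add: sM_def x1_def x0_def y0_def ck_simps)
  qed
qed

lemma kick_2: "sR k * sM k * x0 k - sM k * x1 k = - sM k * y0 k"
  by (auto simp: sR_def sM_def x0_def x1_def y0_def)

lemma Y_kick:
  assumes k: "k \<in> {1, 2, 3, 4, 5}"
  shows "Y k (j + 1) = Y k j - \<nu> (j + 1) * X k (j + 1) / ck k"
proof (rule int_mod3_cases[of j])
  assume h: "j mod 3 = 0" "(j + 1) mod 3 = 1" "(j + 1) div 3 = j div 3"
  have v: "\<nu> (j + 1) = c4" by (simp add: \<nu>_def h(2))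
  show ?thesis
    unfolding XY_values(2)[OF h(1)] XY_values(3,4)[OF h(2)] turn_next(1)[OF h(3)] kick_1[OF k] v
    by (simp add: algebra_simps)
next
  assume h: "j mod 3 = 1" "(j + 1) mod 3 = 2" "(j + 1) div 3 = j div 3"
  have e: "- sM k * y0 k = y0 k - c4 * x1 k / ck k - c4 * (sM k * x1 k) / ck k"
  proof (cases "sM k = 1")
    case True
    then show ?thesis using kick_1[OF k] by simp
  next
    case False
    then have "sM k = - 1" by (auto simp: sM_def split: if_splits)
    then show ?thesis by simp
  qed
  have v: "\<nu> (j + 1) = c4" by (simp add: \<nu>_def h(2))
  show ?thesis
    unfolding XY_values(4)[OF h(1)] XY_values(5,6)[OF h(2)] turn_next(1)[OF h(3)] kick_1[OF k] kick_2 e v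
    by (simp add: algebra_simps)
next
  assume h: "j mod 3 = 2" "(j + 1) mod 3 = 0" "(j + 1) div 3 = j div 3 + 1"
  have e: "sR k * sM k * y0 k = - sM k * y0 k - sR k * sM k * (2 * n0 * x0 k / ck k)"
    by (auto simp: sR_def sM_def x0_def y0_def)
  have "turn k j * (sR k * sM k * y0 k)
      = turn k j * (- sM k * y0 k) - turn k j * (sR k * sM k * (2 * n0 * x0 k / ck k))"
    unfolding e by algebra
  moreover have v: "\<nu> (j + 1) = 2 * n0" by (simp add: \<nu>_def h(2))
  ultimately show ?thesis
    unfolding XY_values(6)[OF h(1)] XY_values(1,2)[OF h(2)] turn_next(2)[OF h(3)] kick_2 v
    by (simp add: algebra_simps)
qed

text \<open>The polynomials of position, mixed product and direction prescribed at bounce 0, where the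
  elliptic coordinates are to be \<open>0\<close>, \<open>c2\<close> and \<open>c4\<close>. The amplitudes are then read off by evaluating
  them at \<open>a\<close>, \<open>b\<close> and \<open>c\<close>, that is, by Lagrange interpolation.\<close>

definition \<rho> :: real where "\<rho> = c2 * c4 / (c1 * c3 * a)"
definition ps :: "real \<Rightarrow> real" where "ps t = - t * ((c2 - t) * (c4 - t))"
definition ms :: "real \<Rightarrow> real" where "ms t = - n0 * ((c2 - t) * (c4 - t))"
definition ds :: "real \<Rightarrow> real" where
  "ds t = n0\<^sup>2 * (\<rho> * (c1 * c3 + c1 * a + c3 * a) - (c2 + c4) + (1 - \<rho> * (c1 + c3 + a)) * t + \<rho> * t\<^sup>2)"

text \<open>The discriminant formed from \<open>ps\<close>, \<open>ms\<close> and \<open>ds\<close>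
  has to be a multiple of \<open>T\<close>; after removal of the common factor (c2 - t) (c4 - t)
  this identity remains. The value of \<open>\<rho>\<close> is the one for which the right side
  vanishes at \<open>t = 0\<close>.\<close>

lemma ds_eq: "t * ds t = n0\<^sup>2 * ((c2 - t) * (c4 - t) - \<rho> * ((c1 - t) * (c3 - t) * (a - t)))"
proof -
  have "\<rho> * (c1 * c3 * a) = c2 * c4" using c_order by (simp add: \<rho>_def)
  then show ?thesis unfolding ds_def by algebra
qed

text \<open>The scale of the rank one matrix \<open>G 0 (ck k)\<close>, read off from the position
  where \<open>x0 k = 1\<close> and from the direction where \<open>y0 k = 1\<close>.\<close>

definition \<kappa> :: "nat \<Rightarrow> real" where
  "\<kappa> k = (if odd k then ck k * ((c2 - ck k) * (c4 - ck k)) else ds (ck k))"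

lemma initial_values:
  assumes "k \<in> {1, 2, 3, 4, 5}"
  shows "ps (ck k) = - (\<kappa> k * (x0 k)\<^sup>2)" "ms (ck k) = \<kappa> k * (x0 k * y0 k)" "ds (ck k) = \<kappa> k * (y0 k)\<^sup>2"
proof -
  show "ps (ck k) = - (\<kappa> k * (x0 k)\<^sup>2)" "ms (ck k) = \<kappa> k * (x0 k * y0 k)"
    using assms ck_pos[of k] by (auto simp: ps_def ms_def \<kappa>_def x0_def y0_def ck_simps)
  show "ds (ck k) = \<kappa> k * (y0 k)\<^sup>2"
  proof (cases "odd k")
    case True
    then have "(c1 - ck k) * (c3 - ck k) * (a - ck k) = 0" using assms by (auto simp: ck_simps)
    then have "ck k * ds (ck k) = n0\<^sup>2 * ((c2 - ck k) * (c4 - ck k))" by (simp add: ds_eq)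
    then have "ds (ck k) = n0\<^sup>2 * ((c2 - ck k) * (c4 - ck k)) / ck k" using ck_pos[of k] by (simp add: field_simps)
    then show ?thesis using True ck_pos[of k] by (simp add: \<kappa>_def y0_def power2_eq_square)
  next
    case False
    then show ?thesis by (simp add: \<kappa>_def y0_def)
  qed
qed

text \<open>These signs make the squared amplitudes positive, whichever of \<open>c1\<close>,
  \<open>c2\<close> is \<open>c\<close> and whichever of \<open>c3\<close>, \<open>c4\<close> is
  \<open>b\<close>.\<close>

lemma \<kappa>_sign: "\<kappa> 1 > 0" "\<kappa> 2 > 0" "\<kappa> 3 < 0" "\<kappa> 4 < 0" "\<kappa> 5 > 0"
proof -
  note o = c_order
  have r: "n0\<^sup>2 * \<rho> > 0" using n0_pos o by (simp add: \<rho>_def)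
  show "\<kappa> 1 > 0" using o by (simp add: \<kappa>_def ck_simps)
  show "\<kappa> 3 < 0" using o by (simp add: \<kappa>_def ck_simps mult_less_0_iff zero_less_mult_iff)
  show "\<kappa> 5 > 0" using o by (simp add: \<kappa>_def ck_simps mult_less_0_iff zero_less_mult_iff)
  have k2: "\<kappa> 2 = ds c2" and k4: "\<kappa> 4 = ds c4" by (simp_all add: \<kappa>_def ck_simps)
  have "c2 * \<kappa> 2 = (n0\<^sup>2 * \<rho>) * ((c2 - c1) * (c3 - c2) * (a - c2))"
    unfolding k2 ds_eq by algebra
  also have "\<dots> > 0" by (rule mult_pos_pos[OF r]) (use o in auto)
  finally show "\<kappa> 2 > 0" using o by (simp add: zero_less_mult_iff)
  have "c4 * \<kappa> 4 = - ((n0\<^sup>2 * \<rho>) * ((c4 - c1) * (c4 - c3) * (a - c4)))"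
    unfolding k4 ds_eq by algebra
  also have "\<dots> < 0" unfolding neg_less_0_iff_less by (rule mult_pos_pos[OF r]) (use o in auto)
  finally show "\<kappa> 4 < 0" using o by (simp add: mult_less_0_iff)
qed

lemma \<kappa>_nz: "k \<in> {1, 2, 3, 4, 5} \<Longrightarrow> \<kappa> k \<noteq> 0"
  using \<kappa>_sign by auto

definition kb :: nat where "kb = (if b < l2 then 3 else 4)"
definition kc :: nat where "kc = (if c < l1 then 1 else 2)"

lemma kb_in: "kb \<in> {1, 2, 3, 4, 5}" and kc_in: "kc \<in> {1, 2, 3, 4, 5}" and k5_in: "5 \<in> {1, 2, 3, 4, 5 :: nat}"
  and ck_kb: "ck kb = b" and ck_kc: "ck kc = c"
  by (auto simp: kb_def kc_def ck_simps c1_def c2_def c3_def c4_def)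

definition Aa :: real where "Aa = sqrt (\<kappa> 5 / ((a - b) * (a - c)))"
definition Ab :: real where "Ab = sqrt (- \<kappa> kb / ((a - b) * (b - c)))"
definition Ac :: real where "Ac = sqrt (\<kappa> kc / ((a - c) * (b - c)))"

lemma amplitudes:
  "Aa\<^sup>2 * ((a - b) * (a - c)) = \<kappa> 5" "Ab\<^sup>2 * ((a - b) * (b - c)) = - \<kappa> kb" "Ac\<^sup>2 * ((a - c) * (b - c)) = \<kappa> kc"
  "Aa > 0"
proof -
  have "\<kappa> kb < 0" "\<kappa> kc > 0" using \<kappa>_sign by (auto simp: kb_def kc_def)
  then have s: "\<kappa> 5 / ((a - b) * (a - c)) > 0" "- \<kappa> kb / ((a - b) * (b - c)) > 0" "\<kappa> kc / ((a - c) * (b - c)) > 0"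
    using \<kappa>_sign(5) ba cb ca by (auto intro!: divide_pos_pos divide_neg_pos)
  show "Aa\<^sup>2 * ((a - b) * (a - c)) = \<kappa> 5" "Ab\<^sup>2 * ((a - b) * (b - c)) = - \<kappa> kb" "Ac\<^sup>2 * ((a - c) * (b - c)) = \<kappa> kc"
    "Aa > 0"
    unfolding Aa_def Ab_def Ac_def s[THEN less_imp_le, THEN real_sqrt_pow2] using s(1) ba cb ca by simp_all
qed

definition q :: "int \<Rightarrow> real ^ 3" where "q j = vector [Aa * X 5 j, Ab * X kb j, Ac * X kc j]"
definition u :: "int \<Rightarrow> real ^ 3" where "u j = vector [Aa * Y 5 j, Ab * Y kb j, Ac * Y kc j]"

lemma q_nth: "q j $ 1 = Aa * X 5 j" "q j $ 2 = Ab * X kb j" "q j $ 3 = Ac * X kc j"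
  and u_nth: "u j $ 1 = Aa * Y 5 j" "u j $ 2 = Ab * Y kb j" "u j $ 3 = Ac * Y kc j"
  by (simp_all add: q_def u_def vector_3)

lemma q_flight: "q (j + 1) = q j + \<tau> j *\<^sub>R u j"
  unfolding vec_eq_iff forall_3 vector_add_component vector_scaleR_component q_nth u_nth X_flight
  by (simp add: algebra_simps)

lemma u_kick: "u (j + 1) = u j - \<nu> (j + 1) *\<^sub>R normal (q (j + 1))"
  unfolding vec_eq_iff forall_3 vector_minus_component vector_scaleR_component q_nth u_nth normal_nth
    Y_kick[OF kb_in] Y_kick[OF kc_in] Y_kick[OF k5_in] ck_kb ck_kc ck_simps
  by (simp add: right_diff_distrib)

lemma X_0: "X k 0 = x0 k" and Y_0: "Y k 0 = y0 k"
  by (simp_all add: X_def Y_def turn_def)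

lemma pos_poly_q0: "pos_poly (q 0) t = ps t"
proof -
  obtain A B C where P: "\<And>t. pos_poly (q 0) t = C + B * t + A * t\<^sup>2 - t ^ 3"
    using pos_poly_coeffs[of "q 0"] by metis
  have S: "ps t = 0 + (- (c2 * c4)) * t + (c2 + c4) * t\<^sup>2 - t ^ 3" for t unfolding ps_def by algebra
  have a: "pos_poly (q 0) a = ps a"
    using initial_values(1)[OF k5_in] amplitudes(1) unfolding pos_poly_at_axes q_nth X_0 ck_simps by algebra
  have b: "pos_poly (q 0) b = ps b"
    using initial_values(1)[OF kb_in] amplitudes(2) unfolding pos_poly_at_axes q_nth X_0 ck_kb by algebra
  have c: "pos_poly (q 0) c = ps c"
    using initial_values(1)[OF kc_in] amplitudes(3) unfolding pos_poly_at_axes q_nth X_0 ck_kc by algebra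
  have za: "(C - 0) + (B - (- (c2 * c4))) * a + (A - (c2 + c4)) * a\<^sup>2 = 0"
    using a unfolding P S by algebra
  have zb: "(C - 0) + (B - (- (c2 * c4))) * b + (A - (c2 + c4)) * b\<^sup>2 = 0"
    using b unfolding P S by algebra
  have zc: "(C - 0) + (B - (- (c2 * c4))) * c + (A - (c2 + c4)) * c\<^sup>2 = 0"
    using c unfolding P S by algebra
  have "(C - 0) + (B - (- (c2 * c4))) * t + (A - (c2 + c4)) * t\<^sup>2 = 0"
    by (rule quadratic_zero_three_roots[OF za zb zc]) (use ba cb in auto)
  then show ?thesis unfolding P S by (simp add: algebra_simps)
qed

lemma mix_poly_q0: "mix_poly (q 0) (u 0) t = ms t"
proof -
  obtain A B C where P: "\<And>t. mix_poly (q 0) (u 0) t = C + B * t + A * t\<^sup>2"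
    using mix_poly_coeffs[of "q 0" "u 0"] by metis
  have S: "ms t = - n0 * c2 * c4 + n0 * (c2 + c4) * t + (- n0) * t\<^sup>2" for t unfolding ms_def by algebra
  have a: "mix_poly (q 0) (u 0) a = ms a"
    using initial_values(2)[OF k5_in] amplitudes(1) unfolding mix_poly_at_axes q_nth u_nth X_0 Y_0 ck_simps by algebra
  have b: "mix_poly (q 0) (u 0) b = ms b"
    using initial_values(2)[OF kb_in] amplitudes(2) unfolding mix_poly_at_axes q_nth u_nth X_0 Y_0 ck_kb by algebra
  have c: "mix_poly (q 0) (u 0) c = ms c"
    using initial_values(2)[OF kc_in] amplitudes(3) unfolding mix_poly_at_axes q_nth u_nth X_0 Y_0 ck_kc by algebra
  have za: "(C - (- n0 * c2 * c4)) + (B - n0 * (c2 + c4)) * a + (A - (- n0)) * a\<^sup>2 = 0"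
    using a unfolding P S by algebra
  have zb: "(C - (- n0 * c2 * c4)) + (B - n0 * (c2 + c4)) * b + (A - (- n0)) * b\<^sup>2 = 0"
    using b unfolding P S by algebra
  have zc: "(C - (- n0 * c2 * c4)) + (B - n0 * (c2 + c4)) * c + (A - (- n0)) * c\<^sup>2 = 0"
    using c unfolding P S by algebra
  have "(C - (- n0 * c2 * c4)) + (B - n0 * (c2 + c4)) * t + (A - (- n0)) * t\<^sup>2 = 0"
    by (rule quadratic_zero_three_roots[OF za zb zc]) (use ba cb in auto)
  then show ?thesis unfolding P S by (simp add: algebra_simps)
qed

lemma dir_poly_u0: "dir_poly (u 0) t = ds t"
proof -
  obtain A B C where P: "\<And>t. mix_poly (u 0) (u 0) t = C + B * t + A * t\<^sup>2"
    using mix_poly_coeffs[of "u 0" "u 0"] by metis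
  define C' B' A' where "C' = n0\<^sup>2 * (\<rho> * (c1 * c3 + c1 * a + c3 * a) - (c2 + c4))"
    and "B' = n0\<^sup>2 * (1 - \<rho> * (c1 + c3 + a))" and "A' = n0\<^sup>2 * \<rho>"
  have S: "ds t = C' + B' * t + A' * t\<^sup>2" for t unfolding ds_def C'_def B'_def A'_def by algebra
  have a: "mix_poly (u 0) (u 0) a = ds a"
    using initial_values(3)[OF k5_in] amplitudes(1) unfolding mix_poly_at_axes u_nth Y_0 ck_simps by algebra
  have b: "mix_poly (u 0) (u 0) b = ds b"
    using initial_values(3)[OF kb_in] amplitudes(2) unfolding mix_poly_at_axes u_nth Y_0 ck_kb by algebra
  have c: "mix_poly (u 0) (u 0) c = ds c"
    using initial_values(3)[OF kc_in] amplitudes(3) unfolding mix_poly_at_axes u_nth Y_0 ck_kc by algebra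
  have za: "(C - C') + (B - B') * a + (A - A') * a\<^sup>2 = 0"
    using a unfolding P S by algebra
  have zb: "(C - C') + (B - B') * b + (A - A') * b\<^sup>2 = 0"
    using b unfolding P S by algebra
  have zc: "(C - C') + (B - B') * c + (A - A') * c\<^sup>2 = 0"
    using c unfolding P S by algebra
  have "(C - C') + (B - B') * t + (A - A') * t\<^sup>2 = 0"
    by (rule quadratic_zero_three_roots[OF za zb zc]) (use ba cb in auto)
  then show ?thesis using P[of t] unfolding S mix_poly_self by (simp add: algebra_simps)
qed

text \<open>The scalar recurrences are linear and leave two conditions at bounce 1 to be checked.
  The first identity puts \<open>q 1\<close> on the ellipsoid; the second makes the kick
  \<open>c4\<close> there obey the reflection law.\<close>

lemma key_identities:
  "n0 * (\<rho> * (c1 * c3 + c1 * a + c3 * a) - (c2 + c4)) = 2 * (c2 * c4)"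
  "2 * n0 * c2 = c2 * c4 + 2 * n0 * (c2 + c4) + n0\<^sup>2 * (1 - \<rho> * (c1 + c3 + a))"
proof -
  define e1 e2 e3 e4 e5 where "e1 = 1 / c1" and "e2 = 1 / c2" and "e3 = 1 / c3" and "e4 = 1 / c4" and "e5 = 1 / a"
  note e = e1_def e2_def e3_def e4_def e5_def
  define d where "d = e3 - e4"
  have "n0 = 1 / d" "d > 0" using inverse_order by (simp_all only: n0_def e d_def)
  then have n: "n0 * d = 1" by simp
  have d0: "d \<noteq> 0" using n by auto
  have i: "c1 * e1 = 1" "c2 * e2 = 1" "c3 * e3 = 1" "c4 * e4 = 1" "a * e5 = 1"
    using c_order by (simp_all add: e)
  have r: "e2 + e3 = e1 + e4 + e5" "e2 * e3 = e1 * e4 + e1 * e5 + e4 * e5"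
    using rel_inverse unfolding e by auto
  have rE: "\<rho> * (c1 * c3 + c1 * a + c3 * a) = c2 * c4 * (e1 + e3 + e5)"
    using c_order by (simp add: \<rho>_def e field_simps)
  have rF: "\<rho> * (c1 + c3 + a) = c2 * c4 * (e1 * e3 + e1 * e5 + e3 * e5)"
    using c_order by (simp add: \<rho>_def e field_simps)
  have s: "c2 + c4 = c2 * c4 * (e2 + e4)" using i by algebra
  have "e1 + e3 + e5 - (e2 + e4) = 2 * d" unfolding d_def using r(1) by algebra
  then have "c2 * c4 * (e1 + e3 + e5) - c2 * c4 * (e2 + e4) = c2 * c4 * (2 * d)" by (metis right_diff_distrib)
  then show "n0 * (\<rho> * (c1 * c3 + c1 * a + c3 * a) - (c2 + c4)) = 2 * (c2 * c4)"
    unfolding rE using n s by algebra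
  have k: "2 * d * e4 = d\<^sup>2 + 2 * d * (e2 + e4) + e2 * e4 - (e1 * e3 + e1 * e5 + e3 * e5)"
    unfolding d_def using r by algebra
  have "c2 * c4 * (2 * d * e4) = c2 * c4 * (d\<^sup>2 + 2 * d * (e2 + e4) + e2 * e4 - (e1 * e3 + e1 * e5 + e3 * e5))"
    unfolding k ..
  moreover have "c2 * c4 * (2 * d * e4) = 2 * d * c2" using i(4) by algebra
  moreover have "c2 * c4 * (e2 * e4) = 1" using i(2,4) by algebra
  ultimately have "2 * d * c2 = c2 * c4 * d\<^sup>2 + 2 * d * (c2 + c4) + 1 - \<rho> * (c1 + c3 + a)"
    unfolding rF s by algebra
  then have "n0\<^sup>2 * (2 * d * c2) = n0\<^sup>2 * (c2 * c4 * d\<^sup>2 + 2 * d * (c2 + c4) + 1 - \<rho> * (c1 + c3 + a))" by simp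
  moreover have "n0\<^sup>2 * (2 * d * c2) = 2 * n0 * c2" using n by algebra
  moreover have "n0\<^sup>2 * (c2 * c4 * d\<^sup>2 + 2 * d * (c2 + c4) + 1 - \<rho> * (c1 + c3 + a))
    = c2 * c4 + 2 * n0 * (c2 + c4) + n0\<^sup>2 * (1 - \<rho> * (c1 + c3 + a))" using n by algebra
  ultimately show "2 * n0 * c2 = c2 * c4 + 2 * n0 * (c2 + c4) + n0\<^sup>2 * (1 - \<rho> * (c1 + c3 + a))" by simp
qed

lemma q1: "q 1 = q 0 + 1 *\<^sub>R u 0"
  using q_flight[of 0] by (simp add: \<tau>_def)

lemma pos_poly_q1: "pos_poly (q 1) t = ps t - 2 * ms t - ds t"
  unfolding q1 pos_poly_line pos_poly_q0 mix_poly_q0 dir_poly_u0 by simp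

lemma ds_0: "ds 0 = 2 * n0 * c2 * c4"
  using key_identities(1) unfolding ds_def by (simp add: power2_eq_square mult.assoc)

lemma pos_poly_q01_zero: "pos_poly (q 0) 0 = 0" "pos_poly (q 1) 0 = 0"
  by (simp_all add: pos_poly_q0 pos_poly_q1 ps_def ms_def ds_0)

lemma norm_u1: "norm (u 1) = norm (u 0)"
proof -
  let ?N = "normal (q 1)"
  obtain A B C where P: "\<And>t. pos_poly (q 1) t = C + B * t + A * t\<^sup>2 - t ^ 3"
    and B: "B = - (a * b * c * (?N \<bullet> ?N))"
    using pos_poly_coeffs[of "q 1"] pos_poly_q01_zero(2) by metis
  have S: "pos_poly (q 1) t = ps t - 2 * ms t - ds t" for t by (rule pos_poly_q1)
  \<comment> \<open>The odd part at 1 and -1 isolates the linear coefficient; the summand 2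
    compensates for the cubic term.\<close>
  have "2 * B = pos_poly (q 1) 1 - pos_poly (q 1) (- 1) + 2" unfolding P by simp
  also have "\<dots> = - 2 * (c2 * c4) - 4 * n0 * (c2 + c4) - 2 * n0\<^sup>2 * (1 - \<rho> * (c1 + c3 + a))"
    unfolding S ps_def ms_def ds_def by (simp add: algebra_simps)
  finally have "B = - (2 * n0 * c2)" using key_identities(2) by simp
  then have NN: "a * b * c * (?N \<bullet> ?N) = 2 * n0 * c2" using B by simp
  have "mix_poly (q 1) (u 0) 0 = n0 * c2 * c4"
    unfolding q1 mix_poly_line mix_poly_q0 dir_poly_u0 ds_0 ms_def by simp
  then have "a * b * c * (?N \<bullet> u 0) = n0 * c2 * c4" unfolding normal_inner using a0 b0 c0 by simp
  then have "a * b * c * (2 * (?N \<bullet> u 0)) = a * b * c * (c4 * (?N \<bullet> ?N))" using NN by algebra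
  then have e: "2 * (?N \<bullet> u 0) = c4 * (?N \<bullet> ?N)" using a0 b0 c0 by simp
  have u1: "u 1 = u 0 - c4 *\<^sub>R ?N" using u_kick[of 0] by (simp add: \<nu>_def)
  have "(norm (u 1))\<^sup>2 = (norm (u 0))\<^sup>2 - c4 * (2 * (?N \<bullet> u 0)) + c4 * (c4 * (?N \<bullet> ?N))"
    unfolding u1 power2_norm_eq_inner by (simp add: inner_diff_left inner_diff_right inner_commute algebra_simps)
  then have "(norm (u 1))\<^sup>2 = (norm (u 0))\<^sup>2" unfolding e by simp
  then show ?thesis by (simp add: power2_eq_iff_nonneg)
qed

lemma X_square: "(X k j)\<^sup>2 = (if j mod 3 = 0 then (X k 0)\<^sup>2 else (X k 1)\<^sup>2)"
proof -
  have "(sR k)\<^sup>2 = 1" "(sM k)\<^sup>2 = 1" by (auto simp: sR_def sM_def)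
  then show ?thesis by (simp add: X_def turn_def power_mult_distrib)
qed

lemma Y_square: "(Y k j)\<^sup>2 = (if j mod 3 = 1 then (Y k 1)\<^sup>2 else (Y k 0)\<^sup>2)"
proof -
  have s: "(sR k)\<^sup>2 = 1" "(sM k)\<^sup>2 = 1" by (auto simp: sR_def sM_def)
  have "j mod 3 \<in> {0, 1, 2}" by auto
  then show ?thesis by (auto simp: Y_def turn_def power_mult_distrib s kick_2)
qed

text \<open>Only squares of the scalars enter, and these are the same, up to the reversals, as at
  bounce 0 or bounce 1.\<close>

lemma pos_poly_q_zero: "pos_poly (q j) 0 = 0"
proof -
  have "pos_poly (q j) 0 = pos_poly (q (if j mod 3 = 0 then 0 else 1)) 0"
    unfolding pos_poly_def q_nth power_mult_distrib by (simp add: X_square[of _ j])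
  then show ?thesis using pos_poly_q01_zero by simp
qed

lemma norm_u: "norm (u j) = norm (u 0)"
proof -
  have "(norm (u j))\<^sup>2 = (norm (u (if j mod 3 = 1 then 1 else 0)))\<^sup>2"
    unfolding norm3 u_nth power_mult_distrib by (simp add: Y_square[of _ j])
  then have "norm (u j) = norm (u (if j mod 3 = 1 then 1 else 0))" by (simp add: power2_eq_iff_nonneg)
  then show ?thesis using norm_u1 by simp
qed

lemma u0_pos: "norm (u 0) > 0"
proof -
  have "u 0 $ 1 \<noteq> 0" using amplitudes(4) n0_pos a0 by (simp add: u_nth Y_0 y0_def ck_simps)
  then show ?thesis by auto
qed

lemma \<nu>_positive: "\<nu> j > 0" and \<tau>_positive: "\<tau> j > 0"
  using n0_pos \<tau>1_pos c_order by (auto simp: \<nu>_def \<tau>_def)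

sublocale billiard a b c q u \<tau> \<nu>
proof
  fix k
  show "pos_poly (q k) 0 = 0" by (rule pos_poly_q_zero)
  show "q (k + 1) = q k + \<tau> k *\<^sub>R u k" by (rule q_flight)
  show r: "u k = u (k - 1) - \<nu> k *\<^sub>R normal (q k)" using u_kick[of "k - 1"] by simp
  have "(norm (u k))\<^sup>2 = (norm (u (k - 1)))\<^sup>2" using norm_u[of k] norm_u[of "k - 1"] by simp
  then have "\<nu> k * (\<nu> k * (normal (q k) \<bullet> normal (q k)) - 2 * (u (k - 1) \<bullet> normal (q k))) = 0"
    unfolding power2_norm_eq_inner r
    by (simp add: inner_diff_left inner_diff_right inner_commute algebra_simps)
  then show "2 * (u (k - 1) \<bullet> normal (q k)) = \<nu> k * (normal (q k) \<bullet> normal (q k))"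
    using \<nu>_positive[of k] by simp
qed (rule \<tau>_positive \<nu>_positive)+

lemma X_mod6: "X k (j mod 6) = X k j" and Y_mod6: "Y k (j mod 6) = Y k j"
proof -
  have "j mod 6 + 2 * (j div 6) * 3 = j" using mult_div_mod_eq[of 6 j] by linarith
  then have "j div 3 = 2 * (j div 6) + (j mod 6) div 3"
    using div_mult_self1[of 3 "j mod 6" "2 * (j div 6)"] by simp
  then have "even (j div 3) = even (2 * (j div 6) + (j mod 6) div 3)" by (rule arg_cong)
  then have e: "even ((j mod 6) div 3) = even (j div 3)" by simp
  have m: "(j mod 6) mod 3 = j mod 3" by (rule mod_mod_cancel) simp
  show "X k (j mod 6) = X k j" "Y k (j mod 6) = Y k j" unfolding X_def Y_def turn_def e m by (rule refl)+
qed

text \<open>This includes the two caustic parameters, to which no coordinate of space belongs: a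
  step acts on \<open>G\<close> by congruence with the same matrix that acts on the scalar pair.
  Negative indices are reduced by the period six.\<close>

lemma G_rank_one:
  assumes k: "k \<in> {1, 2, 3, 4, 5}"
  shows "G j (ck k) = (\<kappa> k * (X k j)\<^sup>2, \<kappa> k * (X k j * Y k j), \<kappa> k * (Y k j)\<^sup>2)"
proof -
  have pos: "G (int n) (ck k) = (\<kappa> k * (X k (int n))\<^sup>2, \<kappa> k * (X k (int n) * Y k (int n)), \<kappa> k * (Y k (int n))\<^sup>2)" for n
  proof (induction n)
    case 0
    show ?case
      by (simp add: G_def pos_poly_q0 mix_poly_q0 dir_poly_u0 initial_values[OF k] X_0 Y_0)
  next
    case (Suc n)
    have "G (int n + 1) (ck k) = congr (step_mat (\<tau> (int n)) (\<nu> (int n + 1) / ck k)) (G (int n) (ck k))"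
      using ck_pos[of k] by (intro G_step) simp
    also have "\<dots> = (\<kappa> k * (X k (int n + 1))\<^sup>2, \<kappa> k * (X k (int n + 1) * Y k (int n + 1)), \<kappa> k * (Y k (int n + 1))\<^sup>2)"
    proof -
      define Z W t m where "Z = X k (int n)" and "W = Y k (int n)" and "t = \<tau> (int n)" and "m = \<nu> (int n + 1) / ck k"
      have X': "X k (int n + 1) = Z + t * W" unfolding X_flight Z_def W_def t_def ..
      have Y': "Y k (int n + 1) = W - m * (Z + t * W)" unfolding Y_kick[OF k] X' W_def m_def by simp
      show ?thesis unfolding Suc X' Y' step_mat_def unfolding Z_def[symmetric] W_def[symmetric] t_def[symmetric] m_def[symmetric]
        by (simp; algebra)
    qed
    finally show ?case by (simp add: algebra_simps)
  qed
  have "q (j mod 6) = q j" "u (j mod 6) = u j" by (simp_all add: q_def u_def X_mod6 Y_mod6)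
  then have "G (j mod 6) (ck k) = G j (ck k)" by (simp add: G_def)
  moreover have "j mod 6 = int (nat (j mod 6))" by simp
  ultimately show ?thesis using pos[of "nat (j mod 6)"] by (simp add: X_mod6 Y_mod6)
qed

lemma nonsingular_orbit: "nonsingular_trajectory a b c l1 l2 q"
proof -
  have tan: "tangent_line a b c l (q j) (q (j + 1) - q j)" if k: "k \<in> {1, 2, 3, 4, 5}" "ck k = l" and l: "l \<notin> {a, b, c}" for k l j
  proof -
    have "axes_poly l * caustic_poly (q j) (u j) l = 0"
      using G_rank_one[OF k(1), of j] unfolding discriminant_identity[symmetric] k(2) G_def by simp algebra
    then have "caustic_poly (q j) (u j) l = 0" using axes_poly_nz[OF l] by simp
    moreover have "u j \<noteq> 0" using norm_u[of j] u0_pos by auto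
    then have "\<tau> j *\<^sub>R u j \<noteq> 0" using \<tau>_positive[of j] by simp
    moreover have "q (j + 1) - q j = \<tau> j *\<^sub>R u j" by (simp add: q_flight)
    ultimately show ?thesis by (simp add: tangent_line_iff[OF l] caustic_poly_scale)
  qed
  have "billiard_trajectory a b c q"
    by (rule billiard_trajectoryI[OF billiard_axioms norm_u u0_pos])
  moreover have l: "l1 \<notin> {a, b, c}" "l2 \<notin> {a, b, c}" using l1_c l1_b l2_b l2_a c_l2 l1_l2 by auto
  moreover have "tangent_line a b c l1 (q j) (q (j + 1) - q j)" for j
    by (rule tan[of "if c < l1 then 2 else 1"]) (use l in \<open>auto simp: ck_simps c1_def c2_def\<close>)
  moreover have "tangent_line a b c l2 (q j) (q (j + 1) - q j)" for j
    by (rule tan[of "if b < l2 then 4 else 3"]) (use l in \<open>auto simp: ck_simps c3_def c4_def\<close>)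
  ultimately show ?thesis unfolding nonsingular_trajectory_def using l1_l2 by blast
qed

end

context nonsingular
begin

lemma \<mu>_rises:
  assumes "j \<in> {0, 1, 2}" "x < y" "\<mu> j x = lo j" "\<mu> j y = hi j"
    "\<And>s. x < s \<Longrightarrow> s < y \<Longrightarrow> \<mu> j s \<noteq> lo j \<and> \<mu> j s \<noteq> hi j"
  shows "mono_on {x..y} (\<mu> j)"
  using assms lo_less_hi[of j]
  by (intro mono_on_of_transversal continuous_on_\<mu> transversal_\<mu>) auto

lemma \<mu>_falls:
  assumes "j \<in> {0, 1, 2}" "x < y" "\<mu> j x = hi j" "\<mu> j y = lo j"
    "\<And>s. x < s \<Longrightarrow> s < y \<Longrightarrow> \<mu> j s \<noteq> lo j \<and> \<mu> j s \<noteq> hi j"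
  shows "antimono_on {x..y} (\<mu> j)"
  using assms lo_less_hi[of j]
  by (intro antimono_on_of_transversal continuous_on_\<mu> transversal_\<mu>) auto

lemma \<mu>_eq_endpoint_iff:
  "\<mu> 1 s = c2 \<longleftrightarrow> pos_poly (traj s) c2 = 0" "\<mu> 1 s = c3 \<longleftrightarrow> pos_poly (traj s) c3 = 0"
  "\<mu> 2 s = c4 \<longleftrightarrow> pos_poly (traj s) c4 = 0" "\<mu> 2 s = a \<longleftrightarrow> pos_poly (traj s) a = 0"
  using \<mu>_bands[of s] c_order unfolding pos_poly_\<mu> by auto

lemma \<mu>0_oscillations: "complete_oscillations (\<mu> 0) 0 c1 (of_nat n) n"
proof -
  have "\<exists>m. of_int k < m \<and> m < of_int k + 1 \<and> \<mu> 0 m = c1 \<and>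
    mono_on {of_int k..m} (\<mu> 0) \<and> antimono_on {m..of_int k + 1} (\<mu> 0)" for k
    using \<mu>0_segment[of k] by metis
  then obtain m where m: "\<And>k. of_int k < m k \<and> m k < of_int k + 1 \<and> \<mu> 0 (m k) = c1 \<and>
    mono_on {of_int k..m k} (\<mu> 0) \<and> antimono_on {m k..of_int k + 1} (\<mu> 0)"
    by metis
  show ?thesis
    unfolding complete_oscillations_def
  proof (rule exI[of _ of_nat], rule exI[of _ "\<lambda>i. m (int i)"], intro conjI allI impI)
    fix i :: nat
    have v: "\<mu> 0 (of_nat k) = 0" for k using \<mu>0_vertex[of "int k"] by simp
    show "\<mu> 0 (of_nat i) = 0" "\<mu> 0 (of_nat (Suc i)) = 0" by (rule v)+
    show "of_nat i < m (int i)" "m (int i) < of_nat (Suc i)" "\<mu> 0 (m (int i)) = c1"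
      "mono_on {of_nat i..m (int i)} (\<mu> 0)" "antimono_on {m (int i)..of_nat (Suc i)} (\<mu> 0)"
      using m[of "int i"] by (simp_all add: add.commute)
  qed simp
qed

end

section \<open>Winding numbers of the symmetric orbit\<close>

context symmetric_orbit
begin

text \<open>These signs decide which segments touch which end of a band; the bounds on
  \<open>x1 5\<close> also exclude shorter periods.\<close>

lemma x1_values: "x1 2 = 1" "x1 4 = 1" "x1 3 < 0" "0 < x1 5" "x1 5 < 1"
proof -
  show "x1 2 = 1" "x1 4 = 1" by (simp_all add: x1_def x0_def y0_def)
  define d where "d = 1 / c3 - 1 / c4"
  have d: "d > 0" using inverse_order by (simp only: d_def)
  have n: "n0 = 1 / d" by (simp only: n0_def d_def)
  have x: "x1 k = (d - 1 / ck k) / d" if "odd k" for k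
    using d that by (simp add: x1_def x0_def y0_def n diff_divide_distrib)
  have "d - 1 / c3 < 0" using c_order by (simp add: d_def)
  then show "x1 3 < 0" using d by (simp add: x ck_simps divide_neg_pos)
  have "d - 1 / a > 0"
  proof (rule ccontr)
    assume h: "\<not> ?thesis"
    \<comment> \<open>The quadratic from bounce 1, evaluated at its root 1/a.\<close>
    have "(1 / c2 - 1 / a) * (d - 1 / a) = 1 / c4 * d"
      unfolding d_def using rel_inverse by algebra
    moreover have "1 / c4 * d > 0" using d c_order by simp
    moreover have "(1 / c2 - 1 / a) * (d - 1 / a) \<le> 0" using h inverse_order by (intro mult_nonneg_nonpos) auto
    ultimately show False by linarith
  qed
  then show "0 < x1 5" using d by (simp add: x ck_simps)
  have "d - 1 / a < d" using inverse_order by simp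
  then show "x1 5 < 1" using d by (simp add: x ck_simps)
qed

lemma sign_values: "sR 2 = - 1" "sR 3 = 1" "sR 4 = - 1" "sR 5 = 1" "sM 2 = - 1" "sM 3 = 1" "sM 4 = 1" "sM 5 = - 1"
  "x0 2 = 0" "x0 3 = 1" "x0 4 = 0" "x0 5 = 1"
  by (simp_all add: sR_def sM_def x0_def)

lemma X_values:
  "X k 0 = x0 k" "X k 1 = x1 k" "X k 2 = sM k * x1 k" "X k 3 = sR k * sM k * x0 k"
  "X k 4 = sR k * sM k * x1 k" "X k 5 = sR k * sM k * (sM k * x1 k)" "X k 6 = x0 k"
  by (simp_all add: X_def turn_def)

text \<open>By the rank one form, \<open>pos_poly\<close> at \<open>ck k\<close> is a nonzero
  multiple of the square of the linearly interpolated scalar. Contacts with \<open>ck k\<close> are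
  thus zeros of a piecewise linear function.\<close>

lemma pos_poly_orbit_zero_iff:
  assumes k: "k \<in> {1, 2, 3, 4, 5}" and s: "of_int j \<le> s" "s \<le> of_int j + 1"
  shows "pos_poly (trajectory_path q s) (ck k) = 0 \<longleftrightarrow> X k j + (s - of_int j) * (X k (j + 1) - X k j) = 0"
proof -
  have "q (j + 1) - q j = \<tau> j *\<^sub>R u j" using q_flight[of j] by simp
  then have p: "trajectory_path q s = q j + ((s - of_int j) * \<tau> j) *\<^sub>R u j"
    using trajectory_path_segment[OF s, of q] by simp
  have G: "pos_poly (q j) (ck k) = - (\<kappa> k * (X k j)\<^sup>2)" "mix_poly (q j) (u j) (ck k) = \<kappa> k * (X k j * Y k j)"
    "dir_poly (u j) (ck k) = \<kappa> k * (Y k j)\<^sup>2"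
    using G_rank_one[OF k, of j] by (auto simp: G_def)
  have "pos_poly (trajectory_path q s) (ck k) = - (\<kappa> k * (X k j + (s - of_int j) * (\<tau> j * Y k j))\<^sup>2)"
    unfolding p pos_poly_line G by algebra
  then show ?thesis using \<kappa>_nz[OF k] by (simp add: X_flight)
qed

lemma segment_cases:
  fixes s :: real
  assumes "s \<in> {0..6}"
  obtains j :: int where "j = 0 \<or> j = 1 \<or> j = 2 \<or> j = 3 \<or> j = 4 \<or> j = 5" "of_int j \<le> s" "s \<le> of_int j + 1"
proof -
  consider "s \<le> 1" | "1 \<le> s" "s \<le> 2" | "2 \<le> s" "s \<le> 3" | "3 \<le> s" "s \<le> 4" | "4 \<le> s" "s \<le> 5" | "5 \<le> s"
    by linarith
  then show thesis
    by cases (use assms that[of 0] that[of 1] that[of 2] that[of 3] that[of 4] that[of 5] in auto)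
qed

lemma segment_nonzero:
  fixes v w x :: real
  assumes "0 < v \<and> 0 < w \<or> v < 0 \<and> w < 0" "0 \<le> x" "x \<le> 1"
  shows "v + x * (w - v) \<noteq> 0"
proof -
  have e: "v + x * (w - v) = (1 - x) * v + x * w" by algebra
  from assms(1) show ?thesis
  proof
    assume h: "0 < v \<and> 0 < w"
    show ?thesis
    proof (cases "x = 0")
      case False
      then have "x * w > 0" "(1 - x) * v \<ge> 0" using h assms by auto
      then show ?thesis unfolding e by linarith
    qed (use h in simp)
  next
    assume h: "v < 0 \<and> w < 0"
    show ?thesis
    proof (cases "x = 0")
      case False
      then have "x * w < 0" "(1 - x) * v \<le> 0" using h assms by (auto simp: mult_less_0_iff mult_le_0_iff)
      then show ?thesis unfolding e by linarith
    qed (use h in simp)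
  qed
qed

text \<open>The zero, on the first segment, of the scalar for \<open>c3\<close>, which goes linearly
  from 1 to the negative value \<open>x1 3\<close>.\<close>

definition rr :: real where "rr = 1 / (1 - x1 3)"

lemma rr: "0 < rr" "rr < 1" "x1 3 = 1 - 1 / rr"
  using x1_values(3) by (simp_all add: rr_def)

lemma zeros_c2:
  assumes s: "s \<in> {0..6}"
  shows "pos_poly (trajectory_path q s) c2 = 0 \<longleftrightarrow> s = 0 \<or> s = 3 / 2 \<or> s = 3 \<or> s = 9 / 2 \<or> s = 6"
proof -
  obtain j :: int where j: "j = 0 \<or> j = 1 \<or> j = 2 \<or> j = 3 \<or> j = 4 \<or> j = 5" "of_int j \<le> s" "s \<le> of_int j + 1"
    by (rule segment_cases[OF s])
  have "pos_poly (trajectory_path q s) c2 = 0 \<longleftrightarrow> X 2 j + (s - of_int j) * (X 2 (j + 1) - X 2 j) = 0"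
    using pos_poly_orbit_zero_iff[OF _ j(2,3), of 2] by (simp add: ck_simps)
  then show ?thesis
    using j by (elim disjE) (auto simp: X_values sign_values x1_values)
qed

lemma zeros_c4:
  assumes s: "s \<in> {0..6}"
  shows "pos_poly (trajectory_path q s) c4 = 0 \<longleftrightarrow> s = 0 \<or> s = 3 \<or> s = 6"
proof -
  obtain j :: int where j: "j = 0 \<or> j = 1 \<or> j = 2 \<or> j = 3 \<or> j = 4 \<or> j = 5" "of_int j \<le> s" "s \<le> of_int j + 1"
    by (rule segment_cases[OF s])
  have "pos_poly (trajectory_path q s) c4 = 0 \<longleftrightarrow> X 4 j + (s - of_int j) * (X 4 (j + 1) - X 4 j) = 0"
    using pos_poly_orbit_zero_iff[OF _ j(2,3), of 4] by (simp add: ck_simps)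
  then show ?thesis
    using j by (elim disjE) (auto simp: X_values sign_values x1_values)
qed

lemma zeros_c3:
  assumes s: "s \<in> {0..6}"
  shows "pos_poly (trajectory_path q s) c3 = 0 \<longleftrightarrow> s = rr \<or> s = 3 - rr \<or> s = 3 + rr \<or> s = 6 - rr"
proof -
  obtain j :: int where j: "j = 0 \<or> j = 1 \<or> j = 2 \<or> j = 3 \<or> j = 4 \<or> j = 5" "of_int j \<le> s" "s \<le> of_int j + 1"
    by (rule segment_cases[OF s])
  have e: "pos_poly (trajectory_path q s) c3 = 0 \<longleftrightarrow> X 3 j + (s - of_int j) * (X 3 (j + 1) - X 3 j) = 0"
    using pos_poly_orbit_zero_iff[OF _ j(2,3), of 3] by (simp add: ck_simps)
  have down: "1 + x * (x1 3 - 1) = 0 \<longleftrightarrow> x = rr" and up: "x1 3 + x * (1 - x1 3) = 0 \<longleftrightarrow> x = 1 - rr" for x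
    unfolding rr(3) using rr(1) by (auto simp: field_simps)
  show ?thesis unfolding e
    using j rr(1,2) x1_values(3)
    by (elim disjE) (auto simp: X_values sign_values down up)
qed

lemma zeros_a:
  assumes s: "s \<in> {0..6}"
  shows "pos_poly (trajectory_path q s) a = 0 \<longleftrightarrow> s = 3 / 2 \<or> s = 9 / 2"
proof -
  obtain j :: int where j: "j = 0 \<or> j = 1 \<or> j = 2 \<or> j = 3 \<or> j = 4 \<or> j = 5" "of_int j \<le> s" "s \<le> of_int j + 1"
    by (rule segment_cases[OF s])
  have e: "pos_poly (trajectory_path q s) a = 0 \<longleftrightarrow> X 5 j + (s - of_int j) * (X 5 (j + 1) - X 5 j) = 0"
    using pos_poly_orbit_zero_iff[OF _ j(2,3), of 5] by (simp add: ck_simps)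
  have x: "0 \<le> s - of_int j" "s - of_int j \<le> 1" using j by auto
  have y: "- x1 5 < 0" "- 1 < (0 :: real)" "0 < (1 :: real)" using x1_values(4) by auto
  have mid: "x1 5 + x * (- x1 5 - x1 5) = 0 \<longleftrightarrow> x = 1 / 2" "- x1 5 + x * (x1 5 - - x1 5) = 0 \<longleftrightarrow> x = 1 / 2" for x
  proof -
    have "x1 5 + x * (- x1 5 - x1 5) = x1 5 * (1 - 2 * x)" "- x1 5 + x * (x1 5 - - x1 5) = x1 5 * (2 * x - 1)"
      by algebra+
    then show "x1 5 + x * (- x1 5 - x1 5) = 0 \<longleftrightarrow> x = 1 / 2" "- x1 5 + x * (x1 5 - - x1 5) = 0 \<longleftrightarrow> x = 1 / 2"
      using x1_values(4) by auto
  qed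
  have nz: "1 + (s - of_int j) * (x1 5 - 1) \<noteq> 0" "- x1 5 + (s - of_int j) * (- 1 - - x1 5) \<noteq> 0"
    "- 1 + (s - of_int j) * (- x1 5 - - 1) \<noteq> 0" "x1 5 + (s - of_int j) * (1 - x1 5) \<noteq> 0"
    using segment_nonzero[OF _ x] x1_values(4) y by blast+
  from j(1) show ?thesis
  proof (elim disjE)
    assume h: "j = 0"
    have "X 5 j = 1" "X 5 (j + 1) = x1 5" by (simp_all add: h X_values sign_values)
    then show ?thesis unfolding e using nz j h by auto
  next
    assume h: "j = 1"
    have "X 5 j = x1 5" "X 5 (j + 1) = - x1 5" by (simp_all add: h X_values sign_values)
    then show ?thesis unfolding e using j h by (simp only: mid) auto
  next
    assume h: "j = 2"
    have "X 5 j = - x1 5" "X 5 (j + 1) = - 1" by (simp_all add: h X_values sign_values)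
    then show ?thesis unfolding e using nz(2) j h by auto
  next
    assume h: "j = 3"
    have "X 5 j = - 1" "X 5 (j + 1) = - x1 5" by (simp_all add: h X_values sign_values)
    then show ?thesis unfolding e using nz(3) j h by auto
  next
    assume h: "j = 4"
    have "X 5 j = - x1 5" "X 5 (j + 1) = x1 5" by (simp_all add: h X_values sign_values)
    then show ?thesis unfolding e using j h by (simp only: mid) auto
  next
    assume h: "j = 5"
    have "X 5 j = x1 5" "X 5 (j + 1) = 1" by (simp_all add: h X_values sign_values)
    then show ?thesis unfolding e using nz(4) j h by auto
  qed
qed

text \<open>The first coordinate is proportional to 1, x, -x, -1, -x, x with 0 < x < 1, so its
  initial value does not recur before bounce six.\<close>

lemma orbit_period: "closes_after q 6" "trajectory_period q = 6"
proof -
  have per: "q (j + 6) = q j" for j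
  proof -
    have "(j + 6) mod 6 = j mod 6" by simp
    then show ?thesis using X_mod6[of _ "j + 6"] X_mod6[of _ j] unfolding q_def by metis
  qed
  then show c: "closes_after q 6" unfolding closes_after_def by simp
  have "\<not> closes_after q n" if "n < 6" for n
  proof
    assume "closes_after q n"
    then have n: "0 < n" "q (0 + int n) = q 0" unfolding closes_after_def by blast+
    then have "X 5 (int n) = 1" using amplitudes(4) q_nth(1)[of "int n"] q_nth(1)[of 0]
      by (simp add: X_values sign_values)
    moreover have "n = 1 \<or> n = 2 \<or> n = 3 \<or> n = 4 \<or> n = 5" using n(1) that by linarith
    ultimately show False using x1_values(4,5) by (elim disjE) (auto simp: X_values sign_values)
  qed
  then show "trajectory_period q = 6"
    unfolding trajectory_period_def using c by (intro Least_equality) (auto simp: not_less[symmetric])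
qed

lemma orbit_periodic: "nonsingular_periodic a b c 3 l1 l2 q"
proof -
  \<comment> \<open>The same \<open>q\<close> with velocities rescaled to unit length, as the lemmas
    on elliptic coordinates require.\<close>
  obtain u' \<tau>' \<nu>' where "nonsingular a b c q u' \<tau>' \<nu>' l1 l2"
    by (rule nonsingular_trajectoryD[OF nonsingular_orbit])
  then interpret N: nonsingular a b c q u' \<tau>' \<nu>' l1 l2 .
  note ends = N.\<mu>_eq_endpoint_iff
  have o1: "complete_oscillations (N.\<mu> 1) c2 c3 6 4"
  proof -
    \<comment> \<open>The turning times are the contacts with \<open>c2\<close> and
      \<open>c3\<close>; they alternate because \<open>rr\<close> lies strictly between 0 and
      1.\<close>
    define S where "S i = 3 / 2 * real i" for i
    define R where "R i = [rr, 3 - rr, 3 + rr, 6 - rr] ! i" for i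
    have piece: "S i < R i \<and> R i < S (Suc i) \<and> N.\<mu> 1 (S i) = c2 \<and> N.\<mu> 1 (R i) = c3 \<and> N.\<mu> 1 (S (Suc i)) = c2 \<and>
      mono_on {S i..R i} (N.\<mu> 1) \<and> antimono_on {R i..S (Suc i)} (N.\<mu> 1)" if "i < 4" for i
    proof -
      have i: "i = 0 \<or> i = 1 \<or> i = 2 \<or> i = 3" using that by linarith
      have ord: "0 \<le> S i" "S i < R i" "R i < S (Suc i)" "S (Suc i) \<le> 6"
        using i rr(1,2) by (auto simp: S_def R_def eval_nat_numeral)
      have v: "N.\<mu> 1 (S i) = c2" "N.\<mu> 1 (R i) = c3" "N.\<mu> 1 (S (Suc i)) = c2"
        using i ord unfolding ends
        by (simp_all add: zeros_c2 zeros_c3) (auto simp: S_def R_def eval_nat_numeral)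
      have no: "N.\<mu> 1 s \<noteq> c2 \<and> N.\<mu> 1 s \<noteq> c3" if "S i < s \<and> s < R i \<or> R i < s \<and> s < S (Suc i)" for s
      proof -
        have "s \<in> {0..6}" using that ord by auto
        then show ?thesis unfolding ends zeros_c2[OF \<open>s \<in> {0..6}\<close>] zeros_c3[OF \<open>s \<in> {0..6}\<close>]
          using i that rr(1,2) by (elim disjE) (auto simp: S_def R_def eval_nat_numeral)
      qed
      show ?thesis
        using ord v no N.\<mu>_rises[of 1 "S i" "R i"] N.\<mu>_falls[of 1 "R i" "S (Suc i)"] by (auto simp: band_simps)
    qed
    moreover have "S 4 = S 0 + 6" by (simp add: S_def)
    ultimately show ?thesis unfolding complete_oscillations_def by blast
  qed
  have o2: "complete_oscillations (N.\<mu> 2) c4 a 6 2"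
  proof -
    define S where "S i = 3 * real i" for i
    define R where "R i = 3 * real i + 3 / 2" for i
    have piece: "S i < R i \<and> R i < S (Suc i) \<and> N.\<mu> 2 (S i) = c4 \<and> N.\<mu> 2 (R i) = a \<and> N.\<mu> 2 (S (Suc i)) = c4 \<and>
      mono_on {S i..R i} (N.\<mu> 2) \<and> antimono_on {R i..S (Suc i)} (N.\<mu> 2)" if "i < 2" for i
    proof -
      have i: "i = 0 \<or> i = 1" using that by linarith
      have ord: "0 \<le> S i" "S i < R i" "R i < S (Suc i)" "S (Suc i) \<le> 6"
        using i by (auto simp: S_def R_def)
      have v: "N.\<mu> 2 (S i) = c4" "N.\<mu> 2 (R i) = a" "N.\<mu> 2 (S (Suc i)) = c4"
        using i ord unfolding ends by (simp_all add: zeros_c4 zeros_a) (auto simp: S_def R_def)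
      have no: "N.\<mu> 2 s \<noteq> c4 \<and> N.\<mu> 2 s \<noteq> a" if "S i < s \<and> s < R i \<or> R i < s \<and> s < S (Suc i)" for s
      proof -
        have "s \<in> {0..6}" using that ord by auto
        then show ?thesis unfolding ends zeros_c4[OF \<open>s \<in> {0..6}\<close>] zeros_a[OF \<open>s \<in> {0..6}\<close>]
          using i that by (elim disjE) (auto simp: S_def R_def)
      qed
      show ?thesis
        using ord v no N.\<mu>_rises[of 2 "S i" "R i"] N.\<mu>_falls[of 2 "R i" "S (Suc i)"] by (auto simp: band_simps)
    qed
    moreover have "S 2 = S 0 + 6" by (simp add: S_def)
    ultimately show ?thesis unfolding complete_oscillations_def by blast
  qed
  have \<mu>: "(\<lambda>s. fst (elliptic_coords a b c (trajectory_path q s))) = N.\<mu> 0"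
    "(\<lambda>s. fst (snd (elliptic_coords a b c (trajectory_path q s)))) = N.\<mu> 1"
    "(\<lambda>s. snd (snd (elliptic_coords a b c (trajectory_path q s)))) = N.\<mu> 2"
    by (auto simp: elliptic_coords_eq N.\<mu>_def)
  have "winding_numbers a b c l1 l2 q 6 4 2"
    unfolding winding_numbers_def Let_def \<mu> osc_endpoints orbit_period(2)
    using N.\<mu>0_oscillations[of 6] o1 o2 by simp
  moreover have "periodic_trajectory q" unfolding periodic_trajectory_def using orbit_period(1) by blast
  \<comment> \<open>The common divisor 2 records that the orbit closes in elliptic coordinates after
    half its period.\<close>
  moreover have "3 = 6 div gcd 6 (gcd 4 (2 :: nat))" by (simp add: gcd_non_0_nat)
  ultimately have "has_elliptic_period a b c l1 l2 q 3" unfolding has_elliptic_period_def by blast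
  then show ?thesis unfolding nonsingular_periodic_def using nonsingular_orbit by blast
qed

end

section \<open>From the caustic relation to the four types\<close>

context semi_axes
begin

lemma caustic_rel_periodic:
  assumes "caustics a b c l1 l2" "caustic_rel (min c l1) (max c l1) (min b l2) (max b l2) a"
  shows "\<exists>q. nonsingular_periodic a b c 3 l1 l2 q"
proof -
  interpret caustics a b c l1 l2 by fact
  interpret symmetric_orbit a b c l1 l2
    by unfold_locales (use assms(2) in \<open>simp add: c1_def c2_def c3_def c4_def\<close>)
  show ?thesis using orbit_periodic by blast
qed

lemma caustic_types:
  assumes "caustics a b c l1 l2"
  shows "\<exists>ty. has_caustic_type a b c ty l1 l2"
proof -
  interpret caustics a b c l1 l2 by fact
  consider "l1 < c" "l2 < b" | "c < l1" "l2 < b" | "l1 < c" "b < l2" | "c < l1" "b < l2"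
    using l1_c l2_b by linarith
  then show ?thesis
  proof cases
    case 1 show ?thesis by (rule exI[of _ EH1]) (use 1 l1_pos c_l2 in auto)
  next
    case 2 show ?thesis by (rule exI[of _ H1H1]) (use 2 l1_b c_l2 in auto)
  next
    case 3 show ?thesis by (rule exI[of _ EH2]) (use 3 l1_pos l2_a in auto)
  next
    case 4 show ?thesis by (rule exI[of _ H1H2]) (use 4 l1_b l2_a in auto)
  qed
qed

lemma periodic_iff:
  "(\<exists>q. nonsingular_periodic a b c 3 l1 l2 q) \<longleftrightarrow>
     caustics a b c l1 l2 \<and> caustic_rel (min c l1) (max c l1) (min b l2) (max b l2) a"
  using periodic_caustic_rel caustic_rel_periodic by blast

lemma caustics_iff:
  "caustics a b c l1 l2 \<longleftrightarrow> 0 < l1 \<and> l1 < l2 \<and> l2 < a \<and> l1 < b \<and> c < l2 \<and> l1 \<noteq> c \<and> l2 \<noteq> b"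
  by (auto simp: caustics_def caustics_axioms_def semi_axes_axioms)

lemma periodic_type_iff:
  "(\<exists>q. nonsingular_periodic a b c 3 l1 l2 q \<and> has_caustic_type a b c EH1 l1 l2) \<longleftrightarrow>
     0 < l1 \<and> l1 < c \<and> c < l2 \<and> l2 < b \<and> caustic_rel l1 c l2 b a"
  "(\<exists>q. nonsingular_periodic a b c 3 l1 l2 q \<and> has_caustic_type a b c H1H1 l1 l2) \<longleftrightarrow>
     c < l1 \<and> l1 < l2 \<and> l2 < b \<and> caustic_rel c l1 l2 b a"
  "(\<exists>q. nonsingular_periodic a b c 3 l1 l2 q \<and> has_caustic_type a b c EH2 l1 l2) \<longleftrightarrow>
     0 < l1 \<and> l1 < c \<and> b < l2 \<and> l2 < a \<and> caustic_rel l1 c b l2 a"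
  "(\<exists>q. nonsingular_periodic a b c 3 l1 l2 q \<and> has_caustic_type a b c H1H2 l1 l2) \<longleftrightarrow>
     c < l1 \<and> l1 < b \<and> b < l2 \<and> l2 < a \<and> caustic_rel c l1 b l2 a"
  using ba cb c0 by (auto simp: periodic_iff caustics_iff min_def max_def)

end

theorem proposition18:
  fixes a b c :: real
  assumes "a > b" and "b > c" and "c > 0"
  shows
    "(\<forall>l1 l2 q. nonsingular_periodic a b c 3 l1 l2 q \<longrightarrow>
        (\<exists>ty. has_caustic_type a b c ty l1 l2)) \<and>

     ((\<exists>l1 l2 q. nonsingular_periodic a b c 3 l1 l2 q \<and> has_caustic_type a b c EH1 l1 l2) \<longleftrightarrow>
        c < a * b / (a + b + sqrt (a * b))) \<and>
     (\<forall>l1 l2 q. nonsingular_periodic a b c 3 l1 l2 q \<and> has_caustic_type a b c EH1 l1 l2 \<longrightarrow>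
        c ^ 3 = (c - l1) * (b - c) * (a - c) \<and>
        1 / l2 + 1 / c = 1 / a + 1 / b + 1 / l1) \<and>

     ((\<exists>l1 l2 q. nonsingular_periodic a b c 3 l1 l2 q \<and> has_caustic_type a b c H1H1 l1 l2) \<longleftrightarrow>
        c < a * b / (a + b + 2 * sqrt (a * b))) \<and>
     (\<forall>l1 l2 q. nonsingular_periodic a b c 3 l1 l2 q \<and> has_caustic_type a b c H1H1 l1 l2 \<longrightarrow>
        {l1, l2} = {t. t ^ 3 - (t - a) * (t - b) * (t - c) = 0}) \<and>

     ((\<exists>l1 l2 q. nonsingular_periodic a b c 3 l1 l2 q \<and> has_caustic_type a b c EH2 l1 l2) \<longleftrightarrow>
        2 * b < a \<and> c < (a - 2 * b) / (2 * a - 3 * b) * a) \<and>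
     (\<forall>l1 l2 q. nonsingular_periodic a b c 3 l1 l2 q \<and> has_caustic_type a b c EH2 l1 l2 \<longrightarrow>
        {l1, l2} = {t. (a - b) * (a - c) * t\<^sup>2 + (b * c - a * (b + c)) * a * t
                         + a\<^sup>2 * b * c = 0}) \<and>

     ((\<exists>l1 l2 q. nonsingular_periodic a b c 3 l1 l2 q \<and> has_caustic_type a b c H1H2 l1 l2) \<longleftrightarrow>
        c < (a - 2 * b) / (a - b)\<^sup>2 * a * b \<and> b > a * c / (a + c - sqrt (a * c))) \<and>
     (\<forall>l1 l2 q. nonsingular_periodic a b c 3 l1 l2 q \<and> has_caustic_type a b c H1H2 l1 l2 \<longrightarrow>
        b ^ 3 = (b - c) * (l2 - b) * (a - b) \<and>
        1 / l1 + 1 / b = 1 / a + 1 / c + 1 / l2)"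
proof -
  interpret semi_axes a b c by unfold_locales (use assms in auto)
  note ex = EH1_iff[folded periodic_type_iff] H1H1_iff[folded periodic_type_iff]
    EH2_iff[folded periodic_type_iff] H1H2_iff[folded periodic_type_iff]
  note D = periodic_type_iff[THEN iffD1, OF exI]
  show ?thesis
  proof (intro conjI allI impI; (elim conjE)?)
    fix l1 l2 q assume "nonsingular_periodic a b c 3 l1 l2 q"
    then show "\<exists>ty. has_caustic_type a b c ty l1 l2" using caustic_types periodic_caustic_rel by blast
  next
    fix l1 l2 q assume h: "nonsingular_periodic a b c 3 l1 l2 q" "has_caustic_type a b c EH1 l1 l2"
    have r: "caustic_rel l1 c l2 b a" "0 < l1" "0 < l2" using D(1)[OF conjI[OF h]] c0 by auto
    show "c ^ 3 = (c - l1) * (b - c) * (a - c)" "1 / l2 + 1 / c = 1 / a + 1 / b + 1 / l1"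
      by (rule EH1_formulas[OF r])+
  next
    fix l1 l2 q assume h: "nonsingular_periodic a b c 3 l1 l2 q" "has_caustic_type a b c H1H1 l1 l2"
    show "{l1, l2} = {t. t ^ 3 - (t - a) * (t - b) * (t - c) = 0}"
      using D(2)[OF conjI[OF h]] by (intro H1H1_formulas) auto
  next
    fix l1 l2 q assume h: "nonsingular_periodic a b c 3 l1 l2 q" "has_caustic_type a b c EH2 l1 l2"
    show "{l1, l2} = {t. (a - b) * (a - c) * t\<^sup>2 + (b * c - a * (b + c)) * a * t + a\<^sup>2 * b * c = 0}"
      using D(3)[OF conjI[OF h]] by (intro EH2_formulas) auto
  next
    fix l1 l2 q assume h: "nonsingular_periodic a b c 3 l1 l2 q" "has_caustic_type a b c H1H2 l1 l2"
    have r: "caustic_rel c l1 b l2 a" "0 < l1" "0 < l2" using D(4)[OF conjI[OF h]] b0 c0 by auto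
    show "b ^ 3 = (b - c) * (l2 - b) * (a - b)" "1 / l1 + 1 / b = 1 / a + 1 / c + 1 / l2"
      by (rule H1H2_formulas[OF r])+
  qed (rule ex)+
qed

end
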